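(* Let $\zeta$ be the Riemann zeta function, let $\rho$ run over all its zeros and its pole, with multiplicities $n_\rho$ (positive for zeros, $n_1=-1$ for the pole). As distributions on $\mathbb{R}$, $$\sum_\rho n_\rho e^{\rho|t|}=2c_0(\zeta,0)\,\delta_0-\sum_{p,\,k\ge1}(\log p)\big(\delta_{k\log p}+\delta_{-k\log p}\big),$$ where $p$ runs over the prime numbers and $k$ over the positive integers, and $$c_0(\zeta,0)=-\log(2\pi).$$
   Context: The sum on the left is understood in the following distributional sense. The zeta function has convergence exponent $d=2$. With $\sigma=0$ (which is not in the divisor), $\mathbf{1}_{\mathbb{R}_+}$ the indicator of $[0,\infty)$ and $D/Dt$ the distributional derivative, $$K_2(t)=\sum_\rho\frac{n_\rho}{\rho^2}e^{\rho t}\,\mathbf{1}_{\mathbb{R}_+},\qquad W(t)=W(\zeta,0)=\frac{D^2}{Dt^2}\big((K_2(t)-K_2(0))\mathbf{1}_{\mathbb{R}_+}\big),$$ and $\sum_\rho n_\rho e^{\rho|t|}:=W(t)+W(-t)$, where $W(-t)$ is the image of $W$ under $t\mapsto-t$. The discrepancy of $\zeta$ relative to $\sigma=0$ is $G(s)-\zeta'(s)/\zeta(s)$, where $G(s)=\sum_\rho n_\rho\frac{s}{\rho}\frac1{s-\rho}$; it is a constant, denoted $c_0(\zeta,0)$. *)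

theory Defs
  imports "HOL-Complex_Analysis.Complex_Analysis" "HOL-Computational_Algebra.Primes"
begin

section \<open>Distributions on the real line\<close>

text \<open>
  Distributions are represented as functionals on functions of type
  \<^typ>\<open>real \<Rightarrow> complex\<close>; only their values on test functions matter.
\<close>

type_synonym functional = "(real \<Rightarrow> complex) \<Rightarrow> complex"

definition vderiv :: "(real \<Rightarrow> complex) \<Rightarrow> real \<Rightarrow> complex" where
  "vderiv \<phi> = (\<lambda>t. vector_derivative \<phi> (at t))"

definition support :: "(real \<Rightarrow> complex) \<Rightarrow> real set" where
  "support \<phi> = closure {t. \<phi> t \<noteq> 0}"

definition test_function :: "(real \<Rightarrow> complex) \<Rightarrow> bool" where
  "test_function \<phi> \<longleftrightarrow>
     (\<forall>n t. (vderiv ^^ n) \<phi> differentiable (at t)) \<and> compact (support \<phi>)"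

text \<open>
  Continuity is expressed by the usual seminorm estimates on each compact set; the suprema
  are suprema of bounded sets because all derivatives of a test function are bounded.
\<close>

definition distribution :: "functional \<Rightarrow> bool" where
  "distribution T \<longleftrightarrow>
     (\<forall>\<phi> \<psi>. test_function \<phi> \<longrightarrow> test_function \<psi> \<longrightarrow> T (\<lambda>t. \<phi> t + \<psi> t) = T \<phi> + T \<psi>) \<and>
     (\<forall>c \<phi>. test_function \<phi> \<longrightarrow> T (\<lambda>t. c * \<phi> t) = c * T \<phi>) \<and>
     (\<forall>K. compact K \<longrightarrow>
        (\<exists>(C::real) (N::nat). \<forall>\<phi>. test_function \<phi> \<longrightarrow> support \<phi> \<subseteq> K \<longrightarrow>
           norm (T \<phi>) \<le> C * (\<Sum>n\<le>N. SUP t. norm ((vderiv ^^ n) \<phi> t))))"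

definition distr_eq :: "functional \<Rightarrow> functional \<Rightarrow> bool" where
  "distr_eq S T \<longleftrightarrow>
     distribution S \<and> distribution T \<and> (\<forall>\<phi>. test_function \<phi> \<longrightarrow> S \<phi> = T \<phi>)"

definition dirac :: "real \<Rightarrow> functional" where
  "dirac a \<phi> = \<phi> a"

definition regular_distr :: "(real \<Rightarrow> complex) \<Rightarrow> functional" where
  "regular_distr g \<phi> = (\<integral>t. g t * \<phi> t \<partial>lborel)"

definition distr_deriv :: "functional \<Rightarrow> functional" where
  "distr_deriv T \<phi> = - T (vderiv \<phi>)"

definition distr_reflect :: "functional \<Rightarrow> functional" where
  "distr_reflect T \<phi> = T (\<lambda>t. \<phi> (- t))"


section \<open>The sum over the divisor and the discrepancy\<close>

text \<open>
  Multiplicities are given by \<^const>\<open>zorder\<close>, which is positive at zeros and negative at poles.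
  The definitions below are for convergence exponent \<open>d = 2\<close> and base point \<open>\<sigma> = 0\<close>.
\<close>

definition zeros_poles :: "(complex \<Rightarrow> complex) \<Rightarrow> complex set" where
  "zeros_poles f = {\<rho>. f \<rho> = 0 \<or> is_pole f \<rho>}"

definition K2 :: "(complex \<Rightarrow> complex) \<Rightarrow> real \<Rightarrow> complex" where
  "K2 f t = (\<Sum>\<^sub>\<infinity>\<rho>\<in>zeros_poles f.
     of_int (zorder f \<rho>) / \<rho>\<^sup>2 * exp (\<rho> * of_real t) * indicator {0..} t)"

definition W :: "(complex \<Rightarrow> complex) \<Rightarrow> functional" where
  "W f = distr_deriv (distr_deriv (regular_distr (\<lambda>t. (K2 f t - K2 f 0) * indicator {0..} t)))"

text \<open>The meaning of the formal sum of \<open>n(\<rho>) exp (\<rho> \<bar>t\<bar>)\<close> over the divisor.\<close>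

definition exp_abs_sum :: "(complex \<Rightarrow> complex) \<Rightarrow> functional" where
  "exp_abs_sum f \<phi> = W f \<phi> + distr_reflect (W f) \<phi>"

definition G :: "(complex \<Rightarrow> complex) \<Rightarrow> complex \<Rightarrow> complex" where
  "G f s = (\<Sum>\<^sub>\<infinity>\<rho>\<in>zeros_poles f. of_int (zorder f \<rho>) * (s / \<rho>) * (1 / (s - \<rho>)))"

definition discrepancy :: "(complex \<Rightarrow> complex) \<Rightarrow> complex \<Rightarrow> complex" where
  "discrepancy f s = G f s - deriv f s / f s"

text \<open>The value of the discrepancy when it is constant off the divisor.\<close>

definition c0 :: "(complex \<Rightarrow> complex) \<Rightarrow> complex" where
  "c0 f = (THE c. \<forall>s. s \<notin> zeros_poles f \<longrightarrow> discrepancy f s = c)"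


section \<open>The Riemann zeta function\<close>

text \<open>
  The analytic continuation of the Dirichlet series. The value at the pole is set to \<open>0\<close> only
  to make the function unique; neither \<^const>\<open>zorder\<close> nor \<^const>\<open>is_pole\<close> depends on it.
\<close>

definition riemann_zeta :: "complex \<Rightarrow> complex" where
  "riemann_zeta = (THE f. f holomorphic_on (UNIV - {1}) \<and> f 1 = 0 \<and>
     (\<forall>s. Re s > 1 \<longrightarrow> (\<lambda>n. 1 / of_nat (Suc n) powr s) sums f s))"

end

theory Submission
  imports Defs "HOL-Real_Asymp.Real_Asymp" "HOL-Number_Theory.Prime_Powers"
begin

text \<open>
  Let \<open>F s = (s - 1) * \<zeta> s\<close>. This is an entire function, and three facts about it carry the proof.

  (1) It has order below two: \<open>norm (F s) \<le> exp (C * (1 + norm s) powr (3 / 2))\<close>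
  (\<open>zeta_entire_exists\<close>). Growth of this kind makes the sum of \<open>1 / \<rho>\<^sup>2\<close> over the zeros converge
  absolutely and gives the partial fractions
  \<open>F' / F (s) - F' / F (0) = \<Sum> (1 / (s - \<rho>) + 1 / \<rho>)\<close> (\<open>log_deriv_has_sum\<close>). With the term of the
  pole added, the right-hand side is \<open>G s\<close>, so that \<open>G - \<zeta>' / \<zeta>\<close> is the constant
  \<open>c0 = - \<zeta>' / \<zeta> (0)\<close>, because \<open>G 0 = 0\<close>.

  (2) \<open>\<zeta>' / \<zeta> (0) = ln (2 * pi)\<close> (\<open>zeta_log_deriv_at_0\<close>). This comes from
  \<open>(1 - 2 powr (1 - s)) * \<zeta> s = 1 - 2 powr - s + 3 powr - s - ...\<close>: a suitable grouping of the
  alternating series converges around \<open>0\<close>, and its derivative there is the logarithm of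
  Wallis' product.

  (3) For \<open>Re s > 1\<close> there are no zeros, and \<open>- \<zeta>' / \<zeta> (s)\<close> is the sum of \<open>ln p * p powr (- k * s)\<close>
  over primes \<open>p\<close> and \<open>k \<ge> 1\<close> (\<open>log_deriv_zeta_prime_powers\<close>).

  By (1) and (3) all exponents in \<open>K2\<close> have real part at most one and the series is dominated by
  a multiple of \<open>exp t\<close>. Its Laplace transform can be taken term by term:
  \<open>K2 t - K2 0\<close> has the transform \<open>G s / s\<^sup>2 = (c0 + \<zeta>' / \<zeta> (s)) / s\<^sup>2\<close>, and by (3) so has
  \<open>c0 * t - \<Sum> ln p * max 0 (t - k * ln p)\<close>. Continuous functions with the same transform agree
  (\<open>laplace_unique\<close>), hence \<open>K2 t - K2 0\<close> is this explicit piecewise linear function for \<open>t \<ge> 0\<close>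
  (\<open>zeta_explicit_formula\<close>). Its second distributional derivative is
  \<open>c0 * \<delta> 0 - \<Sum> ln p * \<delta> (k * ln p)\<close> (\<open>W_zeta\<close>); adding the reflected distribution gives the
  theorem.

  Both the continuation of \<open>\<zeta>\<close> and the growth of \<open>F\<close> come from Riemann's integral
  \<open>Gamma s * \<zeta> s = \<integral> x powr (s - 1) / (exp x - 1)\<close>, split at \<open>x = 1\<close>: on \<open>(0, 1]\<close> the
  power series of \<open>x / (exp x - 1)\<close> is integrated term by term, and multiplication by
  \<open>sin (pi * s) / pi\<close> removes all poles and leaves \<open>\<zeta> s / Gamma (1 - s)\<close>
  (\<open>zeta_times_rGamma_holomorphic\<close>).
\<close>

section \<open>Entire functions of order below two\<close>

lemma divide_out_zero:
  fixes g :: "complex \<Rightarrow> complex"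
  assumes holo: "g holomorphic_on UNIV" and nz: "\<exists>w. g w \<noteq> 0"
  obtains h m where "h holomorphic_on UNIV" "h \<rho> \<noteq> 0" "\<And>z. g z = (z - \<rho>) ^ m * h z"
proof -
  define n where "n = zorder g \<rho>"
  define k where "k = zor_poly g \<rho>"
  obtain r where r: "r > 0" "k holomorphic_on cball \<rho> r"
     "\<And>w. w \<in> cball \<rho> r \<Longrightarrow> g w = k w * (w - \<rho>) ^ nat n \<and> k w \<noteq> 0"
    using conjunct2[OF zorder_exist_zero[OF holo open_UNIV connected_UNIV UNIV_I, of \<rho>]] nz
    unfolding n_def k_def by blast
  define h where "h = (\<lambda>z. if z = \<rho> then k \<rho> else g z / (z - \<rho>) ^ nat n)"
  have hk: "h w = k w" if "w \<in> ball \<rho> r" for w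
    using r(3)[of w] that by (auto simp: h_def)
  have "h holomorphic_on (ball \<rho> r \<union> (UNIV - {\<rho>}))"
  proof (rule holomorphic_on_Un)
    have "k holomorphic_on ball \<rho> r" using r(2) by (rule holomorphic_on_subset) auto
    then show "h holomorphic_on ball \<rho> r" by (rule holomorphic_transform) (use hk in auto)
    have "(\<lambda>z. g z / (z - \<rho>) ^ nat n) holomorphic_on (UNIV - {\<rho>})"
      by (intro holomorphic_intros holomorphic_on_subset[OF holo]) auto
    then show "h holomorphic_on (UNIV - {\<rho>})"
      by (rule holomorphic_transform) (auto simp: h_def)
  qed auto
  moreover have "ball \<rho> r \<union> (UNIV - {\<rho>}) = UNIV" using r(1) by auto
  ultimately have "h holomorphic_on UNIV" by simp
  moreover have "h \<rho> \<noteq> 0" using r(3)[of \<rho>] r(1) by (simp add: h_def)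
  moreover have "g z = (z - \<rho>) ^ nat n * h z" for z
    using r(3)[of \<rho>] r(1) by (auto simp: h_def)
  ultimately show ?thesis using that by blast
qed

text \<open>
  The factors are normalised to be \<open>1\<close> at \<open>0\<close>, so that the cofactor keeps the value of \<open>f\<close>
  at \<open>0\<close>: every zero divided out makes the cofactor smaller on large circles and leaves it
  unchanged at the origin.
\<close>

lemma divide_out_zeros:
  fixes f :: "complex \<Rightarrow> complex"
  assumes holo: "f holomorphic_on UNIV" and nz: "\<exists>w. f w \<noteq> 0" and fin: "finite Z" "0 \<notin> Z"
  obtains g where "g holomorphic_on UNIV" "\<And>\<rho>. \<rho> \<in> Z \<Longrightarrow> g \<rho> \<noteq> 0"
    "\<And>z. f z = (\<Prod>\<rho>\<in>Z. (1 - z / \<rho>) ^ nat (zorder f \<rho>)) * g z"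
proof -
  have "\<exists>g m. g holomorphic_on UNIV \<and> (\<forall>\<rho>\<in>Z. g \<rho> \<noteq> 0) \<and>
    (\<forall>z. f z = (\<Prod>\<rho>\<in>Z. (1 - z / \<rho>) ^ m \<rho>) * g z)"
    using fin
  proof (induction Z rule: finite_induct)
    case empty
    then show ?case using holo by auto
  next
    case (insert \<rho> Z)
    then obtain g m where g: "g holomorphic_on UNIV" "\<forall>\<rho>\<in>Z. g \<rho> \<noteq> 0"
      "\<And>z. f z = (\<Prod>\<rho>\<in>Z. (1 - z / \<rho>) ^ m \<rho>) * g z" by auto
    have "\<exists>w. g w \<noteq> 0" using nz g(3) by (metis mult_zero_right)
    then obtain h k where h: "h holomorphic_on UNIV" "h \<rho> \<noteq> 0" "\<And>z. g z = (z - \<rho>) ^ k * h z"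
      using divide_out_zero[OF g(1)] by metis
    have \<rho>: "\<rho> \<noteq> 0" using insert.prems by auto
    define m' where "m' = m(\<rho> := k)"
    have m'k: "m' \<rho> = k" by (simp add: m'_def)
    have P: "(\<Prod>\<rho>\<in>Z. (1 - z / \<rho>) ^ m' \<rho>) = (\<Prod>\<rho>\<in>Z. (1 - z / \<rho>) ^ m \<rho>)" for z
      using insert.hyps by (intro prod.cong) (auto simp: m'_def)
    have 1: "(1 - z / \<rho>) ^ k * (- \<rho>) ^ k = (z - \<rho>) ^ k" for z
      using \<rho> by (simp add: power_mult_distrib[symmetric] field_simps)
    have "f z = (\<Prod>\<rho>\<in>insert \<rho> Z. (1 - z / \<rho>) ^ m' \<rho>) * ((- \<rho>) ^ k * h z)" for z
      using insert.hyps by (simp add: P g(3) h(3) 1[symmetric] m'k)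
    moreover have "(\<lambda>z. (- \<rho>) ^ k * h z) holomorphic_on UNIV"
      by (intro holomorphic_intros h)
    moreover have "\<forall>\<sigma>\<in>insert \<rho> Z. (- \<rho>) ^ k * h \<sigma> \<noteq> 0"
      using g(2) h(2,3) \<rho> by auto
    ultimately show ?case by (intro exI[of _ "\<lambda>z. (- \<rho>) ^ k * h z"] exI[of _ m']) blast
  qed
  then obtain g m where g: "g holomorphic_on UNIV" "\<And>\<rho>. \<rho> \<in> Z \<Longrightarrow> g \<rho> \<noteq> 0"
    "\<And>z. f z = (\<Prod>\<rho>\<in>Z. (1 - z / \<rho>) ^ m \<rho>) * g z" by blast
  have m: "zorder f \<rho> = int (m \<rho>)" if "\<rho> \<in> Z" for \<rho>
  proof (rule zorder_eqI[OF open_UNIV UNIV_I])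
    have [simp]: "\<rho> \<noteq> 0" using that fin by auto
    have nz0: "\<sigma> \<noteq> 0" if "\<sigma> \<in> Z - {\<rho>}" for \<sigma> using that fin by auto
    let ?G = "\<lambda>w. (\<Prod>\<sigma>\<in>Z - {\<rho>}. (1 - w / \<sigma>) ^ m \<sigma>) * g w * (- 1 / \<rho>) ^ m \<rho>"
    show "?G holomorphic_on UNIV" by (intro holomorphic_intros g) (use nz0 in auto)
    show "?G \<rho> \<noteq> 0" using fin g(2)[OF that] nz0 by auto
    fix w
    have "1 - w / \<rho> = (- 1 / \<rho>) * (w - \<rho>)" by (simp add: field_simps)
    then have "(1 - w / \<rho>) ^ m \<rho> = (- 1 / \<rho>) ^ m \<rho> * (w - \<rho>) ^ m \<rho>"
      by (simp only: power_mult_distrib)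
    then show "f w = ?G w * (w - \<rho>) powi int (m \<rho>)"
      by (simp add: g(3) prod.remove[OF fin(1) that] power_int_of_nat)
  qed
  have "(\<Prod>\<rho>\<in>Z. (1 - z / \<rho>) ^ m \<rho>) = (\<Prod>\<rho>\<in>Z. (1 - z / \<rho>) ^ nat (zorder f \<rho>))" for z
    by (intro prod.cong) (auto simp: m)
  with g show ?thesis using that by metis
qed

text \<open>
  The Borel--Caratheodory argument. If \<open>k\<close> is the logarithm of \<open>g / g 0\<close> with \<open>k 0 = 0\<close>, then
  \<open>Re k < M\<close>, and the Moebius map \<open>k / (2 * M - k)\<close> takes this half-plane into the unit disc;
  Schwarz' lemma then gives \<open>norm k \<le> 2 * M\<close> on the disc of radius \<open>R / 2\<close>, and Cauchy's estimate
  bounds the second derivative of \<open>k\<close> by a multiple of \<open>M / R\<^sup>2\<close>. The bound is useful when \<open>M\<close>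
  grows more slowly than \<open>R\<^sup>2\<close>.
\<close>

lemma log_deriv_diff_bound:
  fixes g :: "complex \<Rightarrow> complex"
  assumes holo: "g holomorphic_on ball 0 R" and R: "R > 0"
    and nz: "\<And>z. norm z < R \<Longrightarrow> g z \<noteq> 0"
    and bound: "\<And>z. norm z < R \<Longrightarrow> norm (g z) < norm (g 0) * exp M"
    and z: "norm z \<le> R / 4"
  shows "norm (deriv g z / g z - deriv g 0 / g 0) \<le> 96 * M / R\<^sup>2 * norm z"
proof -
  obtain h where h: "h holomorphic_on ball 0 R" "\<And>x. x \<in> ball 0 R \<Longrightarrow> exp (h x) = g x"
    using holomorphic_logarithm_exists[OF convex_ball open_ball holo, of 0] nz R by auto
  define k where "k = (\<lambda>z. h z - h 0)"
  have k: "k holomorphic_on ball 0 R" unfolding k_def by (intro holomorphic_intros h)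
  have [simp]: "k 0 = 0" by (simp add: k_def)
  have Rek: "Re (k z) < M" if "norm z < R" for z
  proof -
    have "exp (Re (k z)) * norm (g 0) = norm (g z)"
      using that R h(2)[of z] h(2)[of 0]
        nz[of 0]
      by (simp add: k_def exp_diff norm_divide flip: norm_exp_eq_Re)
    with bound[OF that] have "norm (g 0) * exp (Re (k z)) < norm (g 0) * exp M"
      by (simp add: mult.commute)
    then have "exp (Re (k z)) < exp M" using nz[of 0] R by (subst (asm) mult_less_cancel_left_pos) auto
    then show ?thesis by simp
  qed
  have M: "M > 0" using Rek[of 0] R by simp
  define \<phi> where "\<phi> = (\<lambda>\<zeta>. k (of_real R * \<zeta>) / (2 * of_real M - k (of_real R * \<zeta>)))"
  have less: "norm w < norm (2 * of_real M - w)" if "Re w < M" for w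
  proof -
    have "norm w ^ 2 < norm (2 * of_real M - w) ^ 2"
      using that M mult_strict_left_mono[OF that M] unfolding cmod_power2
      by (simp add: power2_eq_square algebra_simps)
    then show ?thesis by (rule power_less_imp_less_base) simp
  qed
  have inR: "norm (of_real R * \<zeta>) < R" if "norm \<zeta> < 1" for \<zeta> :: complex
    using that R by (simp add: norm_mult)
  have "(k \<circ> (\<lambda>\<zeta>. of_real R * \<zeta>)) holomorphic_on ball 0 1"
    by (rule holomorphic_on_compose_gen[OF _ k]) (use inR in \<open>auto intro!: holomorphic_intros\<close>)
  then have "\<phi> holomorphic_on ball 0 1"
    unfolding \<phi>_def o_def using less[OF Rek[OF inR]]
    by (intro holomorphic_intros) fastforce+
  then have \<phi>: "norm (\<phi> \<zeta>) \<le> norm \<zeta>" if "norm \<zeta> < 1" for \<zeta>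
  proof (rule Schwarz_Lemma(1)[OF _ _ _ that])
    show "norm (\<phi> z) < 1" if "norm z < 1" for z
      using less[OF Rek[OF inR[OF that]]] unfolding \<phi>_def norm_divide
      by (subst divide_less_eq_1_pos) (auto intro: le_less_trans[OF norm_ge_zero])
  qed (simp add: \<phi>_def)
  have kb: "norm (k w) \<le> 2 * M" if "norm w \<le> R / 2" for w
  proof -
    define \<zeta> where "\<zeta> = w / of_real R"
    have w: "w = of_real R * \<zeta>" using R by (simp add: \<zeta>_def)
    have \<zeta>: "norm \<zeta> \<le> 1/2" using that R by (simp add: \<zeta>_def norm_divide field_simps)
    have "norm w < R" using that R by simp
    note l = less[OF Rek[OF this]]
    have "norm (\<phi> \<zeta>) \<le> 1/2" using \<phi>[of \<zeta>] \<zeta> by simp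
    then have "norm (k w) \<le> 1/2 * norm (2 * of_real M - k w)"
      using le_less_trans[OF norm_ge_zero l]
      by (simp add: \<phi>_def flip: w) (simp add: norm_divide divide_simps mult.commute)
    also have "\<dots> \<le> 1/2 * (2 * M + norm (k w))"
      using norm_triangle_ineq4[of "2 * complex_of_real M" "k w"] M by (simp add: norm_mult)
    finally show ?thesis by simp
  qed
  \<comment> \<open>\<open>Cauchy_higher_deriv_bound\<close> asks for an open ball, hence the radius \<open>3 * M\<close> in place of \<open>2 * M\<close>.\<close>
  have k2: "norm (deriv (deriv k) z) \<le> 96 * M / R\<^sup>2" if "norm z \<le> R / 4" for z
  proof -
    have in2: "norm w \<le> R / 2" if "dist z w \<le> R / 4" for w
      using that \<open>norm z \<le> R/4\<close> norm_triangle_ineq4[of z "z - w"] by (simp add: dist_norm)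
    have subc: "cball z (R / 4) \<subseteq> ball 0 R"
    proof
      fix w assume "w \<in> cball z (R / 4)"
      then show "w \<in> ball 0 R" using in2[of w] R by simp
    qed
    then have sub: "ball z (R / 4) \<subseteq> ball 0 R" using ball_subset_cball by blast
    have "norm ((deriv ^^ 2) k z) \<le> fact 2 * (3 * M) / (R / 4) ^ 2"
    proof (rule Cauchy_higher_deriv_bound[where y = 0])
      show "k holomorphic_on ball z (R/4)"
        using sub by (rule holomorphic_on_subset[OF k])
      show "continuous_on (cball z (R / 4)) k"
        using subc by (rule continuous_on_subset[OF holomorphic_on_imp_continuous_on[OF k]])
      show "k w \<in> ball 0 (3 * M)" if "w \<in> ball z (R / 4)" for w
        using kb[OF in2[of w]] that M by simp
    qed (use R in auto)
    then show ?thesis by (simp add: numeral_2_eq_2 power2_eq_square)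
  qed
  have "norm (deriv k z - deriv k 0) \<le> 96 * M / R\<^sup>2 * norm (z - 0)"
  proof (rule field_differentiable_bound[where f' = "deriv (deriv k)" and S = "cball 0 (R/4)"])
    fix w :: complex assume "w \<in> cball 0 (R/4)"
    then have "w \<in> ball 0 R" using R by simp
    then have "(deriv k has_field_derivative deriv (deriv k) w) (at w)"
      using holomorphic_deriv[OF k open_ball] open_ball by (rule holomorphic_derivI[rotated 2])
    then show "(deriv k has_field_derivative deriv (deriv k) w) (at w within cball 0 (R/4))"
      by (rule has_field_derivative_at_within)
  qed (use k2 z R in auto)
  moreover have "deriv k w = deriv g w / g w" if "norm w < R" for w
  proof -
    have w: "w \<in> ball 0 R" using that by simp
    have hd: "(h has_field_derivative deriv h w) (at w)"
      using w by (rule holomorphic_derivI[OF h(1) open_ball])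
    have "((\<lambda>z. exp (h z)) has_field_derivative exp (h w) * deriv h w) (at w)"
      by (rule DERIV_fun_exp[OF hd])
    then have "(g has_field_derivative g w * deriv h w) (at w)"
      unfolding h(2)[OF w]
      by (rule has_field_derivative_transform_within_open[OF _ open_ball w]) (use h(2) in auto)
    then have "deriv g w = g w * deriv h w" by (rule DERIV_imp_deriv)
    moreover have "deriv k w = deriv h w"
      unfolding k_def by (rule DERIV_imp_deriv) (auto intro!: derivative_eq_intros hd)
    ultimately show ?thesis using nz[OF that] by simp
  qed
  ultimately show ?thesis using z R by simp
qed

lemma prod_power_has_log_deriv:
  fixes Z :: "complex set"
  assumes "finite Z" "0 \<notin> Z" "z \<notin> Z"
  shows "((\<lambda>z. \<Prod>\<rho>\<in>Z. (1 - z / \<rho>) ^ m \<rho>) has_field_derivative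
     (\<Prod>\<rho>\<in>Z. (1 - z / \<rho>) ^ m \<rho>) * (\<Sum>\<rho>\<in>Z. of_nat (m \<rho>) / (z - \<rho>))) (at z)"
  using assms
proof (induction Z rule: finite_induct)
  case (insert \<rho> Z)
  have [simp]: "\<rho> \<noteq> 0" "z \<noteq> \<rho>" "1 - z / \<rho> \<noteq> 0" using insert.prems by auto
  have 1: "((\<lambda>z. (1 - z / \<rho>) ^ m \<rho>) has_field_derivative
      (1 - z / \<rho>) ^ m \<rho> * (of_nat (m \<rho>) / (z - \<rho>))) (at z)"
  proof (cases "m \<rho>")
    case (Suc k)
    have "((\<lambda>z. (1 - z / \<rho>) ^ m \<rho>) has_field_derivative
      of_nat (m \<rho>) * (1 - z / \<rho>) ^ (m \<rho> - 1) * (- 1 / \<rho>)) (at z)"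
      by (auto intro!: derivative_eq_intros)
    also have "of_nat (m \<rho>) * (1 - z / \<rho>) ^ (m \<rho> - 1) * (- 1 / \<rho>) =
        of_nat (m \<rho>) * (1 - z / \<rho>) ^ (m \<rho> - 1) * ((1 - z / \<rho>) / (z - \<rho>))"
      by (simp add: field_simps)
    also have "\<dots> = (1 - z / \<rho>) ^ m \<rho> * (of_nat (m \<rho>) / (z - \<rho>))"
      by (simp add: Suc)
    finally show ?thesis .
  qed simp
  show ?case
    using DERIV_mult[OF 1 insert.IH] insert by (simp add: algebra_simps)
qed simp

locale entire_order_below_2 =
  fixes f :: "complex \<Rightarrow> complex" and C a :: real
  assumes holo: "f holomorphic_on UNIV" and nz0: "f 0 \<noteq> 0"
    and growth: "\<And>z. norm (f z) \<le> exp (C * (1 + norm z) powr a)"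
    and C: "C > 0" and a: "0 < a" "a < 2"
begin

definition zeros_within :: "real \<Rightarrow> complex set" where
  "zeros_within R = {\<rho>. f \<rho> = 0 \<and> norm \<rho> \<le> R}"

definition zero_mult :: "complex \<Rightarrow> nat" where
  "zero_mult \<rho> = nat (zorder f \<rho>)"

definition zero_count :: "real \<Rightarrow> nat" where
  "zero_count R = (\<Sum>\<rho>\<in>zeros_within R. zero_mult \<rho>)"

lemma finite_zeros_within: "finite (zeros_within R)"
proof -
  have "\<not> f constant_on UNIV \<or> (\<forall>z. f z \<noteq> 0)"
    using nz0 by (auto simp: constant_on_def)
  then show ?thesis
  proof
    assume "\<not> f constant_on UNIV"
    from holomorphic_compact_finite_zeros[OF holo open_UNIV connected_UNIV compact_cball subset_UNIV this]
    have "finite {z \<in> cball 0 R. f z = 0}" .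
    moreover have "{z \<in> cball 0 R. f z = 0} = zeros_within R" by (auto simp: zeros_within_def)
    ultimately show ?thesis by simp
  qed (simp add: zeros_within_def)
qed

lemma zero_notin_zeros_within: "0 \<notin> zeros_within R"
  using nz0 by (simp add: zeros_within_def)

text \<open>
  On the circle of radius \<open>3 * R\<close> each factor \<open>1 - z / \<rho>\<close> with \<open>norm \<rho> \<le> R\<close> has modulus at
  least \<open>2\<close>, so the cofactor is smaller than \<open>f\<close> there by a factor of two for every zero; the
  maximum principle carries this into the disc. At \<open>0\<close> the estimate limits the number of
  zeros. On the disc of radius \<open>R\<close>, where the cofactor has no zeros, it is the bound that
  \<open>log_deriv_diff_bound\<close> asks for.
\<close>

lemma quotient_by_zeros:
  assumes R: "R > 0"
  shows "\<exists>g. g holomorphic_on UNIV \<and> g 0 = f 0 \<and>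
    (\<forall>z. f z = (\<Prod>\<rho>\<in>zeros_within R. (1 - z / \<rho>) ^ zero_mult \<rho>) * g z) \<and>
    (\<forall>z. norm z \<le> R \<longrightarrow> g z \<noteq> 0) \<and>
    (\<forall>z. norm z \<le> 3 * R \<longrightarrow> norm (g z) \<le> exp (C * (1 + 3 * R) powr a) / 2 ^ zero_count R)"
proof -
  obtain g where g: "g holomorphic_on UNIV" "\<And>\<rho>. \<rho> \<in> zeros_within R \<Longrightarrow> g \<rho> \<noteq> 0"
    "\<And>z. f z = (\<Prod>\<rho>\<in>zeros_within R. (1 - z / \<rho>) ^ zero_mult \<rho>) * g z"
    using divide_out_zeros[OF holo _ finite_zeros_within zero_notin_zeros_within] nz0 unfolding zero_mult_def by metis
  have "g z \<noteq> 0" if "norm z \<le> R" for z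
    using g(2)[of z] g(3)[of z] that by (auto simp: zeros_within_def)
  moreover have "g 0 = f 0" using g(3)[of 0] by simp
  moreover have "norm (g z) \<le> exp (C * (1 + 3 * R) powr a) / 2 ^ zero_count R" if "norm z \<le> 3 * R" for z
  proof (rule maximum_modulus_frontier[where f = g and S = "cball 0 (3 * R)"])
    show "g holomorphic_on interior (cball 0 (3 * R))" using g(1) holomorphic_on_subset by blast
    show "continuous_on (closure (cball 0 (3 * R))) g"
      using g(1) holomorphic_on_imp_continuous_on continuous_on_subset by blast
    fix w :: complex assume "w \<in> frontier (cball 0 (3 * R))"
    then have w: "norm w = 3 * R" using R by simp
    have "2 ^ zero_count R = (\<Prod>\<rho>\<in>zeros_within R. (2::real) ^ zero_mult \<rho>)" by (simp add: zero_count_def power_sum)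
    also have "\<dots> \<le> (\<Prod>\<rho>\<in>zeros_within R. norm (1 - w / \<rho>) ^ zero_mult \<rho>)"
    proof (rule prod_mono, intro conjI power_mono)
      fix \<rho> assume \<rho>: "\<rho> \<in> zeros_within R"
      then have "norm \<rho> > 0" "norm \<rho> \<le> R" using zero_notin_zeros_within[of R] by (auto simp: zeros_within_def)
      then have "norm (w / \<rho>) \<ge> 3" using w by (simp add: norm_divide field_simps)
      then show "2 \<le> norm (1 - w / \<rho>)"
        using norm_triangle_ineq2[of "w / \<rho>" 1] by (simp add: norm_minus_commute)
    qed auto
    finally have "2 ^ zero_count R * norm (g w) \<le> (\<Prod>\<rho>\<in>zeros_within R. norm (1 - w / \<rho>) ^ zero_mult \<rho>) * norm (g w)"
      by (rule mult_right_mono) simp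
    also have "\<dots> = norm (f w)" by (simp add: g(3) norm_mult norm_power flip: prod_norm)
    also have "\<dots> \<le> exp (C * (1 + 3 * R) powr a)" using growth[of w] w by simp
    finally show "norm (g w) \<le> exp (C * (1 + 3 * R) powr a) / 2 ^ zero_count R"
      by (simp add: field_simps)
  qed (use that in auto)
  ultimately show ?thesis using g by blast
qed

lemma zero_count_bound:
  obtains D where "D > 0" "\<And>R. R > 0 \<Longrightarrow> real (zero_count R) \<le> D * (1 + R) powr a"
proof -
  define D where "D = (C * 3 powr a + \<bar>ln (norm (f 0))\<bar>) / ln 2"
  have "D > 0" unfolding D_def using C by (intro divide_pos_pos add_pos_nonneg) auto
  moreover have "real (zero_count R) \<le> D * (1 + R) powr a" if R: "R > 0" for R
  proof -
    obtain g :: "complex \<Rightarrow> complex" where g: "g 0 = f 0"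
      "\<And>z. norm z \<le> 3 * R \<Longrightarrow> norm (g z) \<le> exp (C * (1 + 3 * R) powr a) / 2 ^ zero_count R"
      using quotient_by_zeros[OF R] by blast
    have "2 ^ zero_count R * norm (f 0) \<le> exp (C * (1 + 3 * R) powr a)"
      using g(2)[of 0] g(1) R by (simp add: field_simps)
    then have "ln (2 ^ zero_count R * norm (f 0)) \<le> C * (1 + 3 * R) powr a"
      using nz0 by (subst (asm) ln_le_cancel_iff[symmetric]) auto
    then have le: "real (zero_count R) * ln 2 \<le> C * (1 + 3 * R) powr a + \<bar>ln (norm (f 0))\<bar>"
      using nz0 by (simp add: ln_mult ln_realpow)
    have "(1 + 3 * R) powr a \<le> (3 * (1 + R)) powr a"
      using R a by (intro powr_mono2) auto
    also have "(3 * (1 + R)) powr a = 3 powr a * (1 + R) powr a"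
      by (rule powr_mult)
    finally have "C * (1 + 3 * R) powr a \<le> C * (3 powr a * (1 + R) powr a)"
      using C by (intro mult_left_mono) auto
    moreover have "\<bar>ln (norm (f 0))\<bar> \<le> \<bar>ln (norm (f 0))\<bar> * (1 + R) powr a"
      using R a ge_one_powr_ge_zero[of "1 + R" a] by (simp add: mult_le_cancel_left1)
    ultimately have "real (zero_count R) * ln 2 \<le> (C * 3 powr a + \<bar>ln (norm (f 0))\<bar>) * (1 + R) powr a"
      using le by (simp add: algebra_simps)
    then show ?thesis by (simp add: D_def field_simps)
  qed
  ultimately show ?thesis using that by blast
qed

text \<open>
  The zeros with \<open>2 ^ K < norm \<rho> \<le> 2 ^ (K + 1)\<close> contribute at most a constant times
  \<open>(2 powr a / 4) ^ K\<close>, and this is a geometric series because \<open>a < 2\<close>.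
\<close>

lemma summable_inverse_squares: "(\<lambda>\<rho>. real (zero_mult \<rho>) / norm \<rho> ^ 2) summable_on {\<rho>. f \<rho> = 0}"
proof -
  obtain D where D: "D > 0" "\<And>R. R > 0 \<Longrightarrow> real (zero_count R) \<le> D * (1 + R) powr a"
    using zero_count_bound by blast
  define S where "S = (\<lambda>R. \<Sum>\<rho>\<in>zeros_within R. real (zero_mult \<rho>) / norm \<rho> ^ 2)"
  define q where "q = 2 powr a / 4"
  have "2 powr a < 2 powr (2::real)" using a by (intro powr_less_mono) auto
  then have q: "0 < q" "q < 1" by (auto simp: q_def)
  have step: "S (2 ^ Suc K) \<le> S (2 ^ K) + D * 4 powr a * q ^ K" for K
  proof -
    have sub: "zeros_within (2 ^ K) \<subseteq> zeros_within (2 ^ Suc K)"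
      by (auto simp: zeros_within_def intro: order_trans)
    have "S (2 ^ Suc K) - S (2 ^ K) = (\<Sum>\<rho>\<in>zeros_within (2 ^ Suc K) - zeros_within (2 ^ K). real (zero_mult \<rho>) / norm \<rho> ^ 2)"
      unfolding S_def by (rule sum_diff[OF finite_zeros_within sub, symmetric])
    also have "\<dots> \<le> (\<Sum>\<rho>\<in>zeros_within (2 ^ Suc K) - zeros_within (2 ^ K). real (zero_mult \<rho>) / 4 ^ K)"
    proof (intro sum_mono divide_left_mono)
      fix \<rho> assume "\<rho> \<in> zeros_within (2 ^ Suc K) - zeros_within (2 ^ K)"
      then have n: "norm \<rho> \<ge> 2 ^ K" by (auto simp: zeros_within_def)
      have "(4::real) ^ K = (2 ^ K) ^ 2" by (simp add: power2_eq_square flip: power_mult_distrib)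
      also have "\<dots> \<le> norm \<rho> ^ 2" using n by (intro power_mono) auto
      finally show "4 ^ K \<le> norm \<rho> ^ 2" .
      have "norm \<rho> > 0" using n by (rule less_le_trans[rotated]) simp
      then show "norm \<rho> ^ 2 * 4 ^ K > 0" by simp
    qed auto
    also have "\<dots> \<le> (\<Sum>\<rho>\<in>zeros_within (2 ^ Suc K). real (zero_mult \<rho>) / 4 ^ K)"
      by (intro sum_mono2 finite_zeros_within) auto
    also have "\<dots> = real (zero_count (2 ^ Suc K)) / 4 ^ K"
      by (simp add: zero_count_def sum_divide_distrib)
    also have "\<dots> \<le> D * (1 + 2 ^ Suc K) powr a / 4 ^ K"
      using D(2)[of "2 ^ Suc K"] by (intro divide_right_mono) auto
    also have "\<dots> \<le> D * (4 * 2 ^ K) powr a / 4 ^ K"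
    proof (intro divide_right_mono mult_left_mono powr_mono2)
      have "(1::real) \<le> 2 ^ K" by simp
      then show "1 + 2 ^ Suc K \<le> 4 * (2::real) ^ K" unfolding power_Suc by linarith
    qed (use D(1) a in auto)
    also have "(4 * 2 ^ K) powr a = 4 powr a * (2 powr a) ^ K"
      by (simp add: powr_mult powr_power powr_powr mult.commute flip: powr_realpow)
    also have "D * (4 powr a * (2 powr a) ^ K) / 4 ^ K = D * 4 powr a * q ^ K"
      by (simp add: q_def power_divide)
    finally show ?thesis by simp
  qed
  have S: "S (2 ^ K) \<le> S 1 + D * 4 powr a * (\<Sum>k<K. q ^ k)" for K
  proof (induction K)
    case (Suc K)
    then show ?case using step[of K] by (simp add: algebra_simps)
  qed simp
  have geo: "(\<Sum>k<K. q ^ k) \<le> 1 / (1 - q)" for K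
    using q by (simp add: sum_gp_strict divide_right_mono)
  have fin: "(\<Sum>\<rho>\<in>F. real (zero_mult \<rho>) / norm \<rho> ^ 2) \<le> S 1 + D * 4 powr a * (1 / (1 - q))"
    if F: "finite F" "F \<subseteq> {\<rho>. f \<rho> = 0}" for F
  proof -
    obtain B where B: "\<And>\<rho>. \<rho> \<in> F \<Longrightarrow> norm \<rho> \<le> B"
      using finite_imp_bounded[OF F(1)] by (auto simp: bounded_iff)
    obtain K where "B < 2 ^ K" using real_arch_pow[of 2 B] by auto
    then have sub: "F \<subseteq> zeros_within (2 ^ K)" using B F(2) by (fastforce simp: zeros_within_def)
    have "(\<Sum>\<rho>\<in>F. real (zero_mult \<rho>) / norm \<rho> ^ 2) \<le> S (2 ^ K)"
      unfolding S_def by (intro sum_mono2 finite_zeros_within sub) auto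
    also have "\<dots> \<le> S 1 + D * 4 powr a * (\<Sum>k<K. q ^ k)" by (rule S)
    also have "\<dots> \<le> S 1 + D * 4 powr a * (1 / (1 - q))"
      using D(1) geo by (intro add_left_mono mult_left_mono) auto
    finally show ?thesis .
  qed
  show ?thesis
    by (rule nonneg_bdd_above_summable_on)
       (auto intro!: bdd_aboveI2 fin)
qed

lemma summable_log_deriv_terms:
  assumes z: "f z \<noteq> 0"
  shows "(\<lambda>\<rho>. of_nat (zero_mult \<rho>) * (1 / (z - \<rho>) + 1 / \<rho>)) summable_on {\<rho>. f \<rho> = 0}"
proof -
  let ?Z = "{\<rho>. f \<rho> = 0}"
  let ?t = "\<lambda>\<rho>. of_nat (zero_mult \<rho>) * (1 / (z - \<rho>) + 1 / \<rho>)"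
  \<comment> \<open>Outside this finite set, \<open>norm (z - \<rho>) \<ge> norm \<rho> / 2\<close>, and a term is of size \<open>norm z / (norm \<rho>)\<^sup>2\<close>.\<close>
  define E where "E = zeros_within (2 * norm z)"
  have "(\<lambda>\<rho>. 2 * norm z * (real (zero_mult \<rho>) / norm \<rho> ^ 2)) summable_on (?Z - E)"
    by (intro summable_on_cmult_right summable_on_subset_banach[OF summable_inverse_squares]) auto
  then have "(\<lambda>\<rho>. norm (?t \<rho>)) summable_on (?Z - E)"
  proof (rule summable_on_comparison_test)
    fix \<rho> assume \<rho>: "\<rho> \<in> ?Z - E"
    then have n: "norm \<rho> > 2 * norm z" by (auto simp: E_def zeros_within_def)
    then have n0: "norm \<rho> > 0" "\<rho> \<noteq> 0" using norm_ge_zero[of z] by auto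
    have zr: "z \<noteq> \<rho>" using \<rho> z by auto
    have h: "norm (z - \<rho>) \<ge> norm \<rho> / 2"
      using n norm_triangle_ineq2[of \<rho> z] by (simp add: norm_minus_commute)
    have "?t \<rho> = of_nat (zero_mult \<rho>) * (z / (\<rho> * (z - \<rho>)))"
      using n0 zr by (simp add: field_simps)
    then have "norm (?t \<rho>) = real (zero_mult \<rho>) * (norm z / (norm \<rho> * norm (z - \<rho>)))"
      by (simp add: norm_mult norm_divide)
    also have "\<dots> \<le> real (zero_mult \<rho>) * (norm z / (norm \<rho> * (norm \<rho> / 2)))"
      using h n0 zr by (intro mult_left_mono divide_left_mono mult_pos_pos) auto
    also have "\<dots> = 2 * norm z * (real (zero_mult \<rho>) / norm \<rho> ^ 2)"
      by (simp add: power2_eq_square)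
    finally show "norm (?t \<rho>) \<le> 2 * norm z * (real (zero_mult \<rho>) / norm \<rho> ^ 2)" .
  qed auto
  then have "?t summable_on (?Z - E)" by (rule abs_summable_summable)
  moreover have "?t summable_on E" unfolding E_def by (intro summable_on_finite finite_zeros_within)
  ultimately have "?t summable_on ((?Z - E) \<union> E)" by (rule summable_on_union)
  moreover have "(?Z - E) \<union> E = ?Z" by (auto simp: E_def zeros_within_def)
  ultimately show ?thesis by simp
qed

text \<open>
  The polynomial built from the zeros in the disc accounts exactly for the finite sum; the
  error is the contribution of the cofactor without zeros.
\<close>

lemma log_deriv_approx:
  assumes z: "f z \<noteq> 0" and R: "R > 0" "norm z \<le> R / 4"
  shows "norm (deriv f z / f z - deriv f 0 / f 0 -
      (\<Sum>\<rho>\<in>zeros_within R. of_nat (zero_mult \<rho>) * (1 / (z - \<rho>) + 1 / \<rho>)))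
    \<le> 96 * (C * (1 + 3 * R) powr a - ln (norm (f 0)) + 1) / R\<^sup>2 * norm z"
proof -
  let ?P = "\<lambda>z. \<Prod>\<rho>\<in>zeros_within R. (1 - z / \<rho>) ^ zero_mult \<rho>"
  obtain g where g: "g holomorphic_on UNIV" "\<And>z. f z = ?P z * g z"
    "\<And>z. norm z \<le> R \<Longrightarrow> g z \<noteq> 0" "g 0 = f 0"
    "\<And>z. norm z \<le> 3 * R \<Longrightarrow> norm (g z) \<le> exp (C * (1 + 3 * R) powr a) / 2 ^ zero_count R"
    using quotient_by_zeros[OF R(1)] by blast
  define M where "M = C * (1 + 3 * R) powr a - ln (norm (f 0)) + 1"
  have ld: "deriv f w / f w = (\<Sum>\<rho>\<in>zeros_within R. of_nat (zero_mult \<rho>) / (w - \<rho>)) + deriv g w / g w"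
    if "f w \<noteq> 0" for w
  proof -
    have w: "w \<notin> zeros_within R" using that by (auto simp: zeros_within_def)
    have "(g has_field_derivative deriv g w) (at w)"
      using g(1) by (rule holomorphic_derivI) auto
    from DERIV_mult[OF prod_power_has_log_deriv[OF finite_zeros_within zero_notin_zeros_within w, of zero_mult] this]
    moreover have "(\<lambda>z. ?P z * g z) = f" using g(2) by (intro ext) simp
    ultimately have "deriv f w = ?P w * (\<Sum>\<rho>\<in>zeros_within R. of_nat (zero_mult \<rho>) / (w - \<rho>)) * g w + deriv g w * ?P w"
      by (intro DERIV_imp_deriv) simp
    moreover have "?P w \<noteq> 0" "g w \<noteq> 0" using that g(2)[of w] by auto
    ultimately show ?thesis by (simp add: g(2) field_simps)
  qed
  have "norm (deriv g z / g z - deriv g 0 / g 0) \<le> 96 * M / R\<^sup>2 * norm z"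
  proof (rule log_deriv_diff_bound)
    show "g holomorphic_on ball 0 R" using g(1) holomorphic_on_subset by blast
    fix w :: complex assume w: "norm w < R"
    show "g w \<noteq> 0" using g(3)[of w] w by simp
    have "norm (g w) \<le> exp (C * (1 + 3 * R) powr a) / 2 ^ zero_count R" using g(5)[of w] w R by simp
    also have "\<dots> \<le> exp (C * (1 + 3 * R) powr a)" by (simp add: divide_le_eq)
    also have "\<dots> < exp (C * (1 + 3 * R) powr a + 1)" by simp
    also have "\<dots> = norm (g 0) * exp M"
      using nz0 by (simp add: M_def g(4) exp_add exp_diff)
    finally show "norm (g w) < norm (g 0) * exp M" .
  qed (use R in auto)
  moreover have "deriv g z / g z - deriv g 0 / g 0 = deriv f z / f z - deriv f 0 / f 0 -
      (\<Sum>\<rho>\<in>zeros_within R. of_nat (zero_mult \<rho>) * (1 / (z - \<rho>) + 1 / \<rho>))"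
    unfolding ld[OF z] ld[OF nz0]
    by (simp add: ring_distribs sum.distrib sum_negf flip: sum_divide_distrib)
  ultimately show ?thesis by (simp add: M_def)
qed

text \<open>
  The partial fraction expansion that Hadamard's factorisation theorem would give after
  logarithmic differentiation: the error in \<open>log_deriv_approx\<close> is of size \<open>R powr (a - 2)\<close>.
\<close>

lemma log_deriv_has_sum:
  assumes z: "f z \<noteq> 0"
  shows "((\<lambda>\<rho>. of_nat (zero_mult \<rho>) * (1 / (z - \<rho>) + 1 / \<rho>)) has_sum
      (deriv f z / f z - deriv f 0 / f 0)) {\<rho>. f \<rho> = 0}"
proof -
  let ?Z = "{\<rho>. f \<rho> = 0}"
  let ?t = "\<lambda>\<rho>. of_nat (zero_mult \<rho>) * (1 / (z - \<rho>) + 1 / \<rho>)"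
  let ?L = "deriv f z / f z - deriv f 0 / f 0"
  let ?b = "\<lambda>R. 96 * (C * (1 + 3 * R) powr a - ln (norm (f 0)) + 1) / R\<^sup>2 * norm z"
  have lim: "((\<lambda>R. \<Sum>\<rho>\<in>zeros_within R. ?t \<rho>) \<longlongrightarrow> ?L) at_top"
  proof -
    have "((\<lambda>R. ?L - (\<Sum>\<rho>\<in>zeros_within R. ?t \<rho>)) \<longlongrightarrow> 0) at_top"
    proof (rule Lim_null_comparison)
    show "eventually (\<lambda>R. norm (?L - (\<Sum>\<rho>\<in>zeros_within R. ?t \<rho>)) \<le> ?b R) at_top"
      using eventually_ge_at_top[of "4 * norm z + 1"]
      by eventually_elim (rule log_deriv_approx[OF z], use norm_ge_zero[of z] in linarith, simp)
      show "(?b \<longlongrightarrow> 0) at_top" using C a by real_asymp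
    qed
    from tendsto_diff[OF tendsto_const this, of ?L] show ?thesis by simp
  qed
  have "filterlim zeros_within (finite_subsets_at_top ?Z) at_top"
  proof (unfold filterlim_finite_subsets_at_top, intro allI impI)
    fix F assume F: "finite F \<and> F \<subseteq> ?Z"
    obtain B where B: "\<And>\<rho>. \<rho> \<in> F \<Longrightarrow> norm \<rho> \<le> B"
      using finite_imp_bounded[of F] F by (auto simp: bounded_iff)
    show "eventually (\<lambda>R. finite (zeros_within R) \<and> F \<subseteq> zeros_within R \<and> zeros_within R \<subseteq> ?Z) at_top"
      using eventually_ge_at_top[of B]
    proof eventually_elim
      case (elim R)
      then show ?case using B F finite_zeros_within by (force simp: zeros_within_def)
    qed
  qed
  with has_sum_infsum[OF summable_log_deriv_terms[OF z]]
  have "((\<lambda>R. \<Sum>\<rho>\<in>zeros_within R. ?t \<rho>) \<longlongrightarrow> infsum ?t ?Z) at_top"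
    unfolding has_sum_def by (rule filterlim_compose)
  with lim have "infsum ?t ?Z = ?L"
    using tendsto_unique[OF trivial_limit_at_top_linorder] by blast
  with has_sum_infsum[OF summable_log_deriv_terms[OF z]] show ?thesis by simp
qed

end

section \<open>Riemann's integral for the zeta function\<close>

lemma series_holomorphic_deriv:
  fixes f :: "nat \<Rightarrow> complex \<Rightarrow> complex"
  assumes S: "open S" and f: "\<And>n. f n holomorphic_on S"
    and M: "\<And>x. x \<in> S \<Longrightarrow> \<exists>d>0. \<exists>M. cball x d \<subseteq> S \<and> summable M \<and> (\<forall>n. \<forall>y\<in>cball x d. norm (f n y) \<le> M n)"
  shows "(\<lambda>s. \<Sum>n. f n s) holomorphic_on S"
    and "x \<in> S \<Longrightarrow> (\<lambda>n. deriv (f n) x) sums deriv (\<lambda>s. \<Sum>n. f n s) x"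
proof -
  have unif: "\<exists>d. 0 < d \<and> cball x d \<subseteq> S \<and>
      uniform_limit (cball x d) (\<lambda>k s. \<Sum>n<k. f n s) (\<lambda>s. \<Sum>n. f n s) sequentially" if x: "x \<in> S" for x
  proof -
    obtain d M where "d > 0" "cball x d \<subseteq> S" "summable M" "\<And>n y. y \<in> cball x d \<Longrightarrow> norm (f n y) \<le> M n"
      using M[OF x] by blast
    then show ?thesis by (intro exI[of _ d] conjI Weierstrass_m_test) auto
  qed
  have der: "(f n has_field_derivative deriv (f n) x) (at x)" if "x \<in> S" for n x
    by (rule holomorphic_derivI[OF f S that])
  have "((\<lambda>s. \<Sum>n<k. f n s) has_field_derivative (\<Sum>n<k. deriv (f n) x)) (at x)" if "x \<in> S" for k x
    by (intro DERIV_sum der that)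
  from has_complex_derivative_uniform_sequence[OF S this unif]
  obtain g' where g': "\<And>x. x \<in> S \<Longrightarrow> ((\<lambda>s. \<Sum>n. f n s) has_field_derivative g' x) (at x)"
      "\<And>x. x \<in> S \<Longrightarrow> (\<lambda>k. \<Sum>n<k. deriv (f n) x) \<longlonglongrightarrow> g' x" by blast
  show "(\<lambda>s. \<Sum>n. f n s) holomorphic_on S"
    using g'(1) S by (auto simp: holomorphic_on_open)
  show "(\<lambda>n. deriv (f n) x) sums deriv (\<lambda>s. \<Sum>n. f n s) x" if "x \<in> S"
    using g'[OF that] by (simp add: sums_def DERIV_imp_deriv)
qed

text \<open>
  Weierstrass' test in the form that suits Dirichlet series: the majorants may depend on the
  distance to the boundary line and on a bound for the modulus.
\<close>

lemma half_plane_series: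
  fixes f :: "nat \<Rightarrow> complex \<Rightarrow> complex" and \<sigma> :: real
  assumes f: "\<And>n. f n holomorphic_on {s. Re s > \<sigma>}"
    and M: "\<And>d r. d > 0 \<Longrightarrow> r > 0 \<Longrightarrow> \<exists>M. summable M \<and>
      (\<forall>n y. Re y \<ge> \<sigma> + d \<longrightarrow> norm y \<le> r \<longrightarrow> norm (f n y) \<le> M n)"
  shows "(\<lambda>s. \<Sum>n. f n s) holomorphic_on {s. Re s > \<sigma>}"
    and "Re x > \<sigma> \<Longrightarrow> (\<lambda>n. deriv (f n) x) sums deriv (\<lambda>s. \<Sum>n. f n s) x"
proof -
  have bd: "\<exists>d>0. \<exists>M. cball x d \<subseteq> {s. Re s > \<sigma>} \<and> summable M \<and> (\<forall>n. \<forall>y\<in>cball x d. norm (f n y) \<le> M n)"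
    if x: "x \<in> {s. Re s > \<sigma>}" for x
  proof -
    define d where "d = (Re x - \<sigma>) / 2"
    have d: "d > 0" using x by (simp add: d_def)
    then have "norm x + d > 0" by (simp add: add_nonneg_pos)
    with M[OF d] obtain M where M: "summable M"
      "\<And>n y. Re y \<ge> \<sigma> + d \<Longrightarrow> norm y \<le> norm x + d \<Longrightarrow> norm (f n y) \<le> M n" by blast
    have Re: "Re y \<ge> \<sigma> + d" if "y \<in> cball x d" for y
      using abs_Re_le_cmod[of "x - y"] that by (simp add: dist_norm d_def field_simps abs_le_iff)
    have "norm y \<le> norm x + d" if "y \<in> cball x d" for y
      using that norm_triangle_ineq2[of y x] by (simp add: dist_norm norm_minus_commute)
    moreover have "cball x d \<subseteq> {s. Re s > \<sigma>}" using Re d by fastforce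
    ultimately show ?thesis using d M Re by blast
  qed
  note * = series_holomorphic_deriv[OF open_halfspace_Re_gt f bd]
  show "(\<lambda>s. \<Sum>n. f n s) holomorphic_on {s. Re s > \<sigma>}" by (rule *(1))
  show "(\<lambda>n. deriv (f n) x) sums deriv (\<lambda>s. \<Sum>n. f n s) x" if "Re x > \<sigma>"
    by (rule *(2)) (use that in auto)
qed

lemma Gamma_integral_scaled:
  assumes s: "s > (0::real)" and a: "a > 0"
  shows "((\<lambda>t. t powr (s - 1) * exp (- a * t)) has_integral Gamma s / a powr s) {0..}"
proof -
  let ?f = "\<lambda>t::real. indicator {0..} t * t powr (s - 1) / exp t"
  let ?g = "\<lambda>t::real. indicator {0..} t * (t powr (s - 1) * exp (- a * t))"
  have eq: "a * ?f (0 + a * t) = a powr s * ?g t" for t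
  proof (cases "t \<ge> 0")
    case True
    have "a * (a * t) powr (s - 1) = a powr s * t powr (s - 1)"
      using a True by (simp add: powr_mult powr_diff)
    then show ?thesis using a True by (simp add: exp_minus field_simps)
  next
    case False
    then have "\<not> a * t \<ge> 0" using a by (simp add: zero_le_mult_iff)
    then show ?thesis using False by simp
  qed
  have "ennreal (Gamma s) = (\<integral>\<^sup>+t. ennreal (?f t) \<partial>lborel)"
    by (rule Gamma_conv_nn_integral_real[OF s])
  also have "\<dots> = ennreal \<bar>a\<bar> * (\<integral>\<^sup>+t. ennreal (?f (0 + a * t)) \<partial>lborel)"
    using a by (intro nn_integral_real_affine) auto
  also have "\<dots> = (\<integral>\<^sup>+t. ennreal (a * ?f (0 + a * t)) \<partial>lborel)"
  proof -
    have "(\<lambda>t. ennreal (?f (0 + a * t))) \<in> borel_measurable lborel" by measurable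
    from nn_integral_cmult[OF this, of "ennreal \<bar>a\<bar>"] a show ?thesis
      by (simp only: ennreal_mult'[OF less_imp_le[OF a]] abs_of_pos)
  qed
  also have "\<dots> = (\<integral>\<^sup>+t. ennreal (a powr s * ?g t) \<partial>lborel)" by (simp only: eq)
  finally have "(\<integral>\<^sup>+t. ennreal (a powr s * ?g t) \<partial>lborel) = ennreal (Gamma s)" by simp
  then have "((\<lambda>t. a powr s * ?g t) has_integral Gamma s) UNIV"
    using s Gamma_real_pos[OF s] by (intro nn_integral_has_integral) (auto simp: less_imp_le)
  from has_integral_mult_right[OF this, of "1 / a powr s"]
  have "(?g has_integral Gamma s / a powr s) UNIV" using a by (simp add: field_simps)
  moreover have "?g = (\<lambda>t. if t \<in> {0..} then t powr (s - 1) * exp (- a * t) else 0)"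
    by (auto simp: indicator_def)
  ultimately show ?thesis by (simp only: has_integral_restrict_UNIV)
qed

text \<open>
  The geometric series \<open>1 / (exp t - 1) = \<Sum> exp (- n * t)\<close> is integrated term by term, which
  monotone convergence permits for real \<open>s\<close>. Real values of \<open>s\<close> are enough to identify
  holomorphic functions later.
\<close>

lemma zeta_integral_real:
  assumes s: "s > (1::real)"
  shows "((\<lambda>t. t powr (s - 1) / (exp t - 1)) has_integral
     Gamma s * (\<Sum>n. 1 / real (Suc n) powr s)) {0<..}"
proof -
  let ?u = "\<lambda>t::real. t powr (s - 1) / (exp t - 1)"
  let ?f = "\<lambda>k t. \<Sum>n<k. t powr (s - 1) * exp (- real (Suc n) * t)"
  have summ: "summable (\<lambda>n. 1 / real (Suc n) powr s)"
  proof -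
    have "summable (\<lambda>n. real n powr (- s))" using s by (simp add: summable_real_powr_iff)
    then show ?thesis by (subst (asm) summable_Suc_iff[symmetric]) (simp add: powr_minus divide_inverse)
  qed
  have int: "(?f k has_integral (\<Sum>n<k. Gamma s / real (Suc n) powr s)) {0<..}" for k
  proof -
    have "(?f k has_integral (\<Sum>n<k. Gamma s / real (Suc n) powr s)) {0..}"
      using s by (intro has_integral_sum Gamma_integral_scaled) auto
    then show ?thesis
      by (rule has_integral_spike_set_eq[THEN iffD1, rotated -1]) (rule negligible_subset[of "{0}"]; auto)+
  qed
  have "?u integrable_on {0<..} \<and> (\<lambda>k. integral {0<..} (?f k)) \<longlonglongrightarrow> integral {0<..} ?u"
  proof (rule monotone_convergence_increasing)
    show "?f k integrable_on {0<..}" for k using int by blast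
    show "?f k t \<le> ?f (Suc k) t" for k and t :: real by simp
    show "(\<lambda>k. ?f k t) \<longlonglongrightarrow> ?u t" if "t \<in> {0<..}" for t :: real
    proof -
      have geo: "(\<lambda>n. exp (- t) ^ n) sums (1 / (1 - exp (- t)))"
        using that by (intro geometric_sums) simp
      have e: "exp (- real (Suc n) * t) = exp (- t) * exp (- t) ^ n" for n
        by (simp add: algebra_simps flip: exp_of_nat_mult exp_add)
      from sums_mult[OF geo, of "t powr (s - 1) * exp (- t)"]
      have "(\<lambda>n. t powr (s - 1) * exp (- real (Suc n) * t)) sums
          (t powr (s - 1) * exp (- t) * (1 / (1 - exp (- t))))"
        by (simp only: e mult.assoc)
      also have "t powr (s - 1) * exp (- t) * (1 / (1 - exp (- t))) = ?u t"
        using that by (simp add: exp_minus field_simps)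
      finally show ?thesis by (simp add: sums_def)
    qed
    have "(\<lambda>k. \<Sum>n<k. Gamma s / real (Suc n) powr s) \<longlonglongrightarrow> Gamma s * (\<Sum>n. 1 / real (Suc n) powr s)"
      using sums_mult[OF summable_sums[OF summ], of "Gamma s"] by (simp add: sums_def)
    then have "bounded (range (\<lambda>k. \<Sum>n<k. Gamma s / real (Suc n) powr s))"
      using convergent_imp_bounded by blast
    then show "bounded (range (\<lambda>k. integral {0<..} (?f k)))"
      by (simp only: integral_unique[OF int])
  qed
  moreover have "(\<lambda>k. integral {0<..} (?f k)) \<longlonglongrightarrow> Gamma s * (\<Sum>n. 1 / real (Suc n) powr s)"
    unfolding integral_unique[OF int]
    using sums_mult[OF summable_sums[OF summ], of "Gamma s"] by (simp add: sums_def)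
  ultimately show ?thesis
    using LIMSEQ_unique by (auto simp: has_integral_iff)
qed

text \<open>
  These are the Taylor coefficients of \<open>z / (exp z - 1)\<close>. The poles nearest to \<open>0\<close> are
  \<open>2 * pi * \<i>\<close> and its conjugate, so the radius of convergence exceeds \<open>1\<close> and the
  coefficients are absolutely summable.
\<close>

lemma bose_coefficients:
  obtains b :: "nat \<Rightarrow> complex" where "b 0 = 1" "summable (\<lambda>n. norm (b n))"
    "\<And>x. 0 < x \<Longrightarrow> x \<le> 1 \<Longrightarrow> (\<lambda>n. b n * of_real x ^ n) sums of_real (x / (exp x - 1))"
proof -
  \<comment> \<open>The entire function \<open>(exp z - 1) / z\<close>, with its removable singularity filled in.\<close>
  define k :: "complex \<Rightarrow> complex" where
    "k = (\<lambda>z. if z = 0 then deriv exp 0 else (exp z - exp 0) / (z - 0))"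
  have k: "k holomorphic_on UNIV" unfolding k_def
    by (rule pole_lemma_open) (auto intro!: holomorphic_intros)
  have k0: "k 0 = 1" by (simp add: k_def DERIV_imp_deriv[OF DERIV_exp])
  have nz: "k z \<noteq> 0" if "norm z < 2" for z
  proof
    assume "k z = 0"
    then have "z \<noteq> 0" "exp z = 1" using k0 by (auto simp: k_def split: if_splits)
    then obtain n :: int where n: "Re z = 0" "Im z = of_int (2 * n) * pi" using exp_eq_1 by auto
    then have "n \<noteq> 0" using \<open>z \<noteq> 0\<close> by (auto simp: complex_eq_iff)
    then have "\<bar>of_int (2 * n)\<bar> \<ge> (2::real)" by linarith
    then have "\<bar>Im z\<bar> \<ge> 2 * pi" using n(2) by (simp add: abs_mult mult_right_mono)
    moreover have "\<bar>Im z\<bar> < 2" using abs_Im_le_cmod[of z] that by simp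
    ultimately show False using pi_gt3 by simp
  qed
  define h where "h = (\<lambda>z. 1 / k z)"
  have h: "h holomorphic_on ball 0 2" unfolding h_def
    by (intro holomorphic_intros holomorphic_on_subset[OF k]) (use nz in auto)
  define b where "b = (\<lambda>n. (deriv ^^ n) h 0 / fact n)"
  have sums: "(\<lambda>n. b n * w ^ n) sums h w" if "norm w < 2" for w
    using holomorphic_power_series[OF h, of w] that by (simp add: b_def)
  have "summable (\<lambda>n. norm (b n * 1 ^ n))"
    by (rule powser_insidea[of _ "3/2"]) (use sums[of "3/2"] in \<open>auto simp: sums_iff\<close>)
  moreover have "b 0 = 1" by (simp add: b_def h_def k0)
  moreover have "(\<lambda>n. b n * of_real x ^ n) sums of_real (x / (exp x - 1))" if "0 < x" "x \<le> 1" for x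
    using sums[of "of_real x"] that by (simp add: h_def k_def exp_of_real)
  ultimately show ?thesis using that by simp
qed

lemma norm_sin_le: "norm (sin z) \<le> exp \<bar>Im z\<bar>" for z :: complex
proof -
  have "norm (sin z) \<le> (norm (exp (\<i> * z)) + norm (exp (- (\<i> * z)))) / 2"
    using norm_triangle_ineq4[of "exp (\<i> * z)" "exp (- (\<i> * z))"]
    by (simp add: sin_exp_eq norm_divide norm_mult)
  also have "\<dots> \<le> (exp \<bar>Im z\<bar> + exp \<bar>Im z\<bar>) / 2"
    by (intro divide_right_mono add_mono) (auto simp: norm_exp_eq_Re)
  finally show ?thesis by simp
qed

text \<open>
  The estimate depends only on the imaginary part, so it is uniform over all integer
  translates of the argument; this is what lets sums of \<open>b n * sinc (s + n - 1)\<close> converge.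
\<close>

lemma sinc_entire:
  obtains sinc :: "complex \<Rightarrow> complex" and K :: real where "sinc holomorphic_on UNIV"
    "sinc 0 = 1" "\<And>w. w \<noteq> 0 \<Longrightarrow> sinc w = sin (of_real pi * w) / (of_real pi * w)"
    "\<And>w. norm (sinc w) \<le> K * exp (pi * \<bar>Im w\<bar>)" "K > 0"
proof -
  define S :: "complex \<Rightarrow> complex" where
    "S = (\<lambda>z. if z = 0 then deriv (\<lambda>z. sin (of_real pi * z)) 0
       else (sin (of_real pi * z) - sin (of_real pi * 0)) / (z - 0))"
  have S: "S holomorphic_on UNIV" unfolding S_def
    by (rule pole_lemma_open) (auto intro!: holomorphic_intros)
  have "((\<lambda>z::complex. sin (of_real pi * z)) has_field_derivative of_real pi) (at 0)"
    by (auto intro!: derivative_eq_intros)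
  then have S0: "S 0 = of_real pi" by (simp add: S_def DERIV_imp_deriv)
  define sinc where "sinc = (\<lambda>z. S z / of_real pi)"
  have hol: "sinc holomorphic_on UNIV" unfolding sinc_def by (intro holomorphic_intros S) auto
  have eq: "sinc w = sin (of_real pi * w) / (of_real pi * w)" if "w \<noteq> 0" for w
    using that by (simp add: sinc_def S_def)
  have "compact (sinc ` cball 0 1)"
    using hol by (intro compact_continuous_image holomorphic_on_imp_continuous_on)
      (auto intro: holomorphic_on_subset)
  then obtain K where K: "K > 0" "\<And>w. norm w \<le> 1 \<Longrightarrow> norm (sinc w) \<le> K"
    using compact_imp_bounded bounded_pos[of "sinc ` cball 0 1"] by (auto simp: image_iff)
  have "norm (sinc w) \<le> max K 1 * exp (pi * \<bar>Im w\<bar>)" for w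
  proof (cases "norm w \<le> 1")
    case True
    have "1 \<le> exp (pi * \<bar>Im w\<bar>)" by simp
    with K(2)[OF True] K(1) have "norm (sinc w) * 1 \<le> max K 1 * exp (pi * \<bar>Im w\<bar>)"
      by (intro mult_mono) auto
    then show ?thesis by simp
  next
    case False
    have "norm (sin (of_real pi * w)) \<le> exp \<bar>Im (of_real pi * w)\<bar>"
      by (rule norm_sin_le)
    then have 1: "norm (sin (of_real pi * w)) \<le> exp (pi * \<bar>Im w\<bar>)" by (simp add: abs_mult)
    have "norm (sinc w) = norm (sin (of_real pi * w)) / (pi * norm w)"
      using False by (subst eq) (auto simp: norm_divide norm_mult)
    also have "\<dots> \<le> exp (pi * \<bar>Im w\<bar>) / 1"
    proof (rule frac_le)
      have "1 * 1 \<le> pi * norm w" using False pi_gt3 by (intro mult_mono) auto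
      then show "1 \<le> pi * norm w" by simp
    qed (use 1 in auto)
    also have "\<dots> \<le> max K 1 * exp (pi * \<bar>Im w\<bar>)" by (simp add: mult_le_cancel_right1)
    finally show ?thesis .
  qed
  moreover have "sinc 0 = 1" by (simp add: sinc_def S0)
  ultimately show ?thesis using that[of sinc "max K 1"] hol eq by simp
qed

text \<open>
  Since \<open>x powr (s - 1) / (exp x - 1) = \<Sum> b n * x powr (s - 2 + n)\<close> on \<open>(0, 1]\<close>, and all partial
  sums are dominated by the integrable function \<open>(\<Sum> norm (b n)) * x powr (s - 2)\<close>.
\<close>

lemma zeta_integral_unit:
  assumes s: "s > (1::real)"
    and b: "summable (\<lambda>n. norm (b n))"
      "\<And>x. 0 < x \<Longrightarrow> x \<le> 1 \<Longrightarrow> (\<lambda>n. b n * of_real x ^ n) sums of_real (x / (exp x - 1))"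
  shows "((\<lambda>x. complex_of_real (x powr (s - 1) / (exp x - 1))) has_integral
     (\<Sum>n. b n / of_real (s + real n - 1))) {0<..1}"
proof (rule has_integral_dominated_convergence)
  have I: "((\<lambda>x. x powr (s - 2 + real n)) has_integral 1 / (s + real n - 1)) {0<..1}" for n
  proof -
    have "((\<lambda>x. x powr (s - 2 + real n)) has_integral 1 / (s + real n - 1)) {0..1}"
      using has_integral_powr_from_0[of "s - 2 + real n" 1] s by (simp add: algebra_simps)
    then show ?thesis
      by (rule has_integral_spike_set_eq[THEN iffD1, rotated -1]) (rule negligible_subset[of "{0}"]; auto)+
  qed
  show "((\<lambda>x. \<Sum>n<k. b n * of_real (x powr (s - 2 + real n))) has_integral
      (\<Sum>n<k. b n / of_real (s + real n - 1))) {0<..1}" for k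
  proof (rule has_integral_sum, simp)
    fix n
    have "((\<lambda>x. complex_of_real (x powr (s - 2 + real n))) has_integral of_real (1 / (s + real n - 1))) {0<..1}"
      using I[of n] by (rule has_integral_of_real)
    from has_integral_mult_right[OF this, of "b n"]
    show "((\<lambda>x. b n * complex_of_real (x powr (s - 2 + real n))) has_integral
      b n / of_real (s + real n - 1)) {0<..1}" by simp
  qed
  show "(\<lambda>x. (\<Sum>n. norm (b n)) * x powr (s - 2 + real 0)) integrable_on {0<..1}"
    using has_integral_mult_right[OF I[of 0]] by blast
  show "\<forall>x\<in>{0<..1}. norm (\<Sum>n<k. b n * complex_of_real (x powr (s - 2 + real n)))
      \<le> (\<Sum>n. norm (b n)) * x powr (s - 2 + real 0)" for k
  proof
    fix x :: real assume x: "x \<in> {0<..1}"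
    have "norm (\<Sum>n<k. b n * complex_of_real (x powr (s - 2 + real n))) \<le>
        (\<Sum>n<k. norm (b n) * x powr (s - 2 + real 0))"
    proof (rule sum_norm_le)
      fix n
      have "x powr (s - 2 + real n) \<le> x powr (s - 2 + real 0)"
        using x by (intro powr_mono') auto
      then show "norm (b n * complex_of_real (x powr (s - 2 + real n))) \<le>
         norm (b n) * x powr (s - 2 + real 0)"
        by (simp add: norm_mult mult_left_mono)
    qed
    also have "\<dots> = (\<Sum>n<k. norm (b n)) * x powr (s - 2 + real 0)" by (simp add: sum_distrib_right)
    also have "\<dots> \<le> (\<Sum>n. norm (b n)) * x powr (s - 2 + real 0)"
      by (intro mult_right_mono sum_le_suminf b) auto
    finally show "norm (\<Sum>n<k. b n * complex_of_real (x powr (s - 2 + real n)))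
      \<le> (\<Sum>n. norm (b n)) * x powr (s - 2 + real 0)" .
  qed
  show "\<forall>x\<in>{0<..1}. (\<lambda>k. \<Sum>n<k. b n * complex_of_real (x powr (s - 2 + real n)))
      \<longlonglongrightarrow> complex_of_real (x powr (s - 1) / (exp x - 1))"
  proof
    fix x :: real assume x: "x \<in> {0<..1}"
    have "x powr (s - 1) = x powr (s - 2) * x" using x by (simp add: powr_diff power2_eq_square field_simps)
    then have "of_real (x powr (s - 2)) * of_real (x / (exp x - 1)) = complex_of_real (x powr (s - 1) / (exp x - 1))"
      by (simp del: of_real_diff of_real_exp flip: of_real_mult)
    moreover have "complex_of_real (x powr (s - 2 + real n)) = of_real (x powr (s - 2)) * of_real x ^ n" for n
      using x by (simp add: powr_add powr_realpow)
    ultimately show "(\<lambda>k. \<Sum>n<k. b n * complex_of_real (x powr (s - 2 + real n)))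
      \<longlonglongrightarrow> complex_of_real (x powr (s - 1) / (exp x - 1))"
      using sums_mult[OF b(2), of x "of_real (x powr (s - 2))"] x
      by (simp add: sums_def mult_ac)
  qed
  have "summable (\<lambda>n. b n / of_real (s + real n - 1))"
  proof (rule summable_comparison_test)
    show "\<exists>N. \<forall>n\<ge>N. norm (b n / of_real (s + real n - 1)) \<le> norm (b n) * (1 / (s - 1))"
    proof (intro exI allI impI)
      fix n
      have "norm (b n / of_real (s + real n - 1)) = norm (b n) * (1 / (s + real n - 1))"
        using s unfolding norm_divide norm_of_real by simp
      also have "\<dots> \<le> norm (b n) * (1 / (s - 1))"
        using s by (intro mult_left_mono divide_left_mono) auto
      finally show "norm (b n / of_real (s + real n - 1)) \<le> norm (b n) * (1 / (s - 1))" .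
    qed
    show "summable (\<lambda>n. norm (b n) * (1 / (s - 1)))" using b(1) by (rule summable_mult2)
  qed
  then show "(\<lambda>k. \<Sum>n<k. b n / of_real (s + real n - 1)) \<longlonglongrightarrow> (\<Sum>n. b n / of_real (s + real n - 1))"
    using summable_sums sums_def by blast
qed

text \<open>
  The integral over \<open>[1, \<infinity>)\<close> is cut into unit intervals and becomes a series of integrals over
  compact intervals, each of them entire in \<open>s\<close>.
\<close>

definition bose_piece :: "nat \<Rightarrow> complex \<Rightarrow> complex" where
  "bose_piece j s = integral {real j + 1..real j + 2} (\<lambda>x. of_real x powr (s - 1) / of_real (exp x - 1))"

lemma bose_piece_integrable:
  "(\<lambda>x. complex_of_real x powr (s - 1) / of_real (exp x - 1)) integrable_on {real j + 1..real j + 2}"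
  by (intro integrable_continuous_interval continuous_intros) auto

lemma bose_piece_holomorphic: "bose_piece j holomorphic_on UNIV"
  unfolding bose_piece_def box_real[symmetric]
proof (rule leibniz_rule_holomorphic)
  let ?I = "cbox (real j + 1) (real j + 2)"
  fix s :: complex and x :: real assume "x \<in> ?I"
  then show "((\<lambda>s. of_real x powr (s - 1) / of_real (exp x - 1)) has_field_derivative
     (of_real x powr (s - 1) * ln (of_real x)) / of_real (exp x - 1)) (at s within UNIV)"
    by (auto intro!: derivative_eq_intros intro: has_field_derivative_powr_right[THEN DERIV_chain2] simp: Ln_of_real)
next
  show "continuous_on (UNIV \<times> cbox (real j + 1) (real j + 2))
     (\<lambda>(s::complex, x). (of_real x powr (s - 1) * ln (of_real x)) / of_real (exp x - 1))"
    by (auto simp: case_prod_unfold intro!: continuous_intros)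
qed (use bose_piece_integrable in auto)

lemma norm_bose_piece:
  assumes "Re s \<le> 2"
  shows "norm (bose_piece j s) \<le> (real j + 2) / (exp (real j + 1) - 1)"
proof -
  have "norm (integral (cbox (real j + 1) (real j + 2)) (\<lambda>x. complex_of_real x powr (s - 1) / of_real (exp x - 1)))
     \<le> ((real j + 2) / (exp (real j + 1) - 1)) * measure lborel (cbox (real j + 1) (real j + 2))"
  proof (rule has_integral_bound[OF _ integrable_integral])
    fix x :: real assume "x \<in> cbox (real j + 1) (real j + 2)"
    then have x: "real j + 1 \<le> x" "x \<le> real j + 2" by auto
    have "norm (complex_of_real x powr (s - 1) / of_real (exp x - 1)) = x powr (Re s - 1) / (exp x - 1)"
      using x unfolding norm_divide norm_of_real by (simp add: norm_powr_real_powr)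
    also have "\<dots> \<le> (real j + 2) / (exp (real j + 1) - 1)"
    proof (rule frac_le)
      have "x powr (Re s - 1) \<le> x powr 1" using x assms by (intro powr_mono) auto
      then show "x powr (Re s - 1) \<le> real j + 2" using x by simp
    qed (use x in auto)
    finally show "norm (complex_of_real x powr (s - 1) / of_real (exp x - 1)) \<le> (real j + 2) / (exp (real j + 1) - 1)" .
  qed (use bose_piece_integrable in \<open>auto simp: divide_nonneg_nonneg\<close>)
  then show ?thesis by (simp add: bose_piece_def)
qed

lemma summable_bose_bound: "summable (\<lambda>j. (real j + 2) / (exp (real j + 1) - 1))"
proof (rule summable_comparison_test_bigo)
  show "summable (\<lambda>j. norm (1 / real j ^ 2))"
    using inverse_power_summable[of 2, where 'a = real] by (simp add: inverse_eq_divide)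
  show "(\<lambda>j. (real j + 2) / (exp (real j + 1) - 1)) \<in> O(\<lambda>j. 1 / real j ^ 2)"
    by real_asymp
qed

lemma zeta_integral_pieces:
  assumes s: "1 < s" "s < (2::real)"
    and b: "summable (\<lambda>n. norm (b n))"
      "\<And>x. 0 < x \<Longrightarrow> x \<le> 1 \<Longrightarrow> (\<lambda>n. b n * of_real x ^ n) sums of_real (x / (exp x - 1))"
  shows "of_real (Gamma s * (\<Sum>n. 1 / real (Suc n) powr s)) =
     (\<Sum>n. b n / of_real (s + real n - 1)) + (\<Sum>j. bose_piece j (of_real s))"
proof -
  let ?u = "\<lambda>x. complex_of_real (x powr (s - 1) / (exp x - 1))"
  have upto: "(?u has_integral (\<Sum>n. b n / of_real (s + real n - 1)) + (\<Sum>j<N. bose_piece j (of_real s))) {0<..real N + 1}" for N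
  proof (induction N)
    case 0
    then show ?case using zeta_integral_unit[OF s(1) b] by simp
  next
    case (Suc N)
    have "((\<lambda>x. complex_of_real x powr (of_real s - 1) / of_real (exp x - 1)) has_integral bose_piece N (of_real s))
       {real N + 1..real N + 2}"
      unfolding bose_piece_def using bose_piece_integrable by (rule integrable_integral)
    then have "(?u has_integral bose_piece N (of_real s)) {real N + 1..real N + 2}"
      
    proof (rule has_integral_eq[rotated])
      fix x :: real assume x: "x \<in> {real N + 1..real N + 2}"
      have "complex_of_real x powr (of_real s - 1) = complex_of_real x powr of_real (s - 1)" by simp
      also have "\<dots> = of_real (x powr (s - 1))" using x by (subst powr_of_real) auto
      finally show "complex_of_real x powr (of_real s - 1) / of_real (exp x - 1) = ?u x" by simp
    qed
    from has_integral_Un[OF Suc.IH this]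
    have "(?u has_integral (\<Sum>n. b n / of_real (s + real n - 1)) + (\<Sum>j<Suc N. bose_piece j (of_real s)))
       ({0<..real N + 1} \<union> {real N + 1..real N + 2})"
      by (simp add: add_ac Int_atLeastAtMost negligible_subset[of "{real N + 1}"] subset_iff)
    moreover have "{0<..real N + 1} \<union> {real N + 1..real N + 2} = {0<..real (Suc N) + 1}" by auto
    ultimately show ?case by simp
  qed
  have lim: "(\<lambda>N. (\<Sum>n. b n / of_real (s + real n - 1)) + (\<Sum>j<N. bose_piece j (of_real s)))
     \<longlonglongrightarrow> (\<Sum>n. b n / of_real (s + real n - 1)) + (\<Sum>j. bose_piece j (of_real s))"
  proof (intro tendsto_intros)
    have "summable (\<lambda>j. bose_piece j (of_real s))"
      by (rule summable_comparison_test'[OF summable_bose_bound]) (use s in \<open>auto intro!: norm_bose_piece\<close>)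
    then show "(\<lambda>N. \<Sum>j<N. bose_piece j (of_real s)) \<longlonglongrightarrow> (\<Sum>j. bose_piece j (of_real s))"
      using summable_sums sums_def by blast
  qed
  have "(?u has_integral (\<Sum>n. b n / of_real (s + real n - 1)) + (\<Sum>j. bose_piece j (of_real s))) {0<..}"
  proof (rule has_integral_dominated_convergence[OF _ _ _ _ lim])
    \<comment> \<open>The integrand itself dominates its truncations: it is nonnegative and integrable.\<close>
    let ?f = "\<lambda>N x. if x \<in> {0<..real N + 1} then ?u x else 0"
    show "(?f N has_integral (\<Sum>n. b n / of_real (s + real n - 1)) + (\<Sum>j<N. bose_piece j (of_real s))) {0<..}" for N
      using upto[of N] by (subst has_integral_restrict) auto
    show "(\<lambda>x. x powr (s - 1) / (exp x - 1)) integrable_on {0<..}"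
      using zeta_integral_real[OF s(1)] by blast
    show "\<forall>x\<in>{0<..}. norm (?f N x) \<le> x powr (s - 1) / (exp x - 1)" for N
      by (auto simp del: of_real_divide of_real_diff)
    show "\<forall>x\<in>{0<..}. (\<lambda>N. ?f N x) \<longlonglongrightarrow> ?u x"
    proof
      fix x :: real assume x: "x \<in> {0<..}"
      have "eventually (\<lambda>N. ?f N x = ?u x) sequentially"
        using eventually_ge_at_top[of "nat \<lceil>x\<rceil>"] by eventually_elim (use x in auto)
      then show "(\<lambda>N. ?f N x) \<longlonglongrightarrow> ?u x" by (rule tendsto_eventually)
    qed
  qed
  moreover have "(?u has_integral of_real (Gamma s * (\<Sum>n. 1 / real (Suc n) powr s))) {0<..}"
    using zeta_integral_real[OF s(1)] by (rule has_integral_of_real)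
  ultimately show ?thesis using has_integral_unique by blast
qed

section \<open>Continuation and growth of the zeta function\<close>

definition zeta_series :: "complex \<Rightarrow> complex" where
  "zeta_series s = (\<Sum>n. 1 / of_nat (Suc n) powr s)"

lemma norm_zeta_term: "norm (1 / of_nat (Suc n) powr s :: complex) = real (Suc n) powr (- Re s)"
proof -
  have "norm (of_nat (Suc n) powr s :: complex) = real (Suc n) powr Re s"
    using norm_powr_real_powr[of "of_nat (Suc n)" s] by (simp del: of_nat_Suc)
  then show ?thesis by (simp add: norm_divide norm_inverse powr_minus divide_inverse del: of_nat_Suc)
qed

lemma summable_zeta_bound:
  assumes "x > (1::real)" shows "summable (\<lambda>n. real (Suc n) powr (- x))"
proof -
  have "summable (\<lambda>n. real n powr (- x))" using assms by (simp add: summable_real_powr_iff)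
  then show ?thesis by (subst (asm) summable_Suc_iff[symmetric])
qed

lemma zeta_series_sums:
  assumes "Re s > 1" shows "(\<lambda>n. 1 / of_nat (Suc n) powr s) sums zeta_series s"
proof -
  have "summable (\<lambda>n. norm (1 / of_nat (Suc n) powr s :: complex))"
    unfolding norm_zeta_term by (rule summable_zeta_bound[OF assms])
  then show ?thesis unfolding zeta_series_def by (rule summable_sums[OF summable_norm_cancel])
qed

lemma zeta_series_deriv:
  shows zeta_series_holomorphic: "zeta_series holomorphic_on {s. Re s > 1}"
    and zeta_series_deriv_sums: "Re s > 1 \<Longrightarrow>
      (\<lambda>n. - of_real (ln (real (Suc n))) / of_nat (Suc n) powr s) sums deriv zeta_series s"
proof -
  let ?S = "{s. Re s > 1}"
  let ?f = "\<lambda>n s. 1 / of_nat (Suc n) powr s :: complex"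
  have hol: "?f n holomorphic_on ?S" for n by (intro holomorphic_intros) auto
  have bd: "\<exists>M. summable M \<and> (\<forall>n y. Re y \<ge> 1 + d \<longrightarrow> norm y \<le> r \<longrightarrow> norm (?f n y) \<le> M n)" if "d > 0" for d r
    unfolding norm_zeta_term using that
    by (intro exI[of _ "\<lambda>n. real (Suc n) powr (- (1 + d))"] conjI summable_zeta_bound allI impI powr_mono) auto
  have eq: "(\<lambda>s. \<Sum>n. ?f n s) = zeta_series" by (simp add: zeta_series_def fun_eq_iff)
  show "zeta_series holomorphic_on ?S"
    using half_plane_series(1)[OF hol bd] by (simp only: eq)
  assume s: "Re s > 1"
  have "deriv (?f n) s = - of_real (ln (real (Suc n))) / of_nat (Suc n) powr s" for n
  proof -
    have "((\<lambda>s. of_nat (Suc n) powr s) has_field_derivative Ln (of_nat (Suc n)) * of_nat (Suc n) powr s) (at s)"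
      by (rule has_field_derivative_powr_right) (simp del: of_nat_Suc)
    from DERIV_inverse'[OF this] have
      "(?f n has_field_derivative - (inverse (of_nat (Suc n) powr s) * (Ln (of_nat (Suc n)) * of_nat (Suc n) powr s) *
        inverse (of_nat (Suc n) powr s))) (at s)"
      by (simp add: divide_inverse del: of_nat_Suc)
    moreover have "Ln (of_nat (Suc n)) = of_real (ln (real (Suc n)))"
      using Ln_of_real[of "real (Suc n)"] by (simp del: of_nat_Suc)
    ultimately show ?thesis by (intro DERIV_imp_deriv) (simp add: field_simps del: of_nat_Suc)
  qed
  then show "(\<lambda>n. - of_real (ln (real (Suc n))) / of_nat (Suc n) powr s) sums deriv zeta_series s"
    using half_plane_series(2)[OF hol bd s] by (simp only: eq)
qed

lemma norm_zeta_series_le: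
  assumes "Re s \<ge> 3 / 2"
  shows "norm (zeta_series s) \<le> (\<Sum>n. real (Suc n) powr (- (3 / 2)))"
  unfolding zeta_series_def
proof (rule norm_suminf_le)
  show "norm (1 / of_nat (Suc n) powr s :: complex) \<le> real (Suc n) powr (- (3 / 2))" for n
    unfolding norm_zeta_term using assms by (intro powr_mono) auto
qed (rule summable_zeta_bound, simp)

lemma norm_Gamma_le:
  assumes "Re z > 0" shows "norm (Gamma z) \<le> Gamma (Re z)"
proof -
  note 1 = Gamma_integral_complex[OF assms] and 2 = Gamma_integral_real[OF assms]
  have "norm (integral {0..} (\<lambda>t. complex_of_real t powr (z - 1) / of_real (exp t)))
     \<le> integral {0..} (\<lambda>t. t powr (Re z - 1) / exp t)"
  proof (rule integral_norm_bound_integral)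
    fix t :: real assume "t \<in> {0..}"
    then show "norm (complex_of_real t powr (z - 1) / of_real (exp t)) \<le> t powr (Re z - 1) / exp t"
      unfolding norm_divide norm_of_real by (simp add: norm_powr_real_powr)
  qed (use 1 2 in blast)+
  then show ?thesis by (simp only: integral_unique[OF 1] integral_unique[OF 2])
qed

text \<open>
  The recurrence \<open>Gamma x = (x - 1) * Gamma (x - 1)\<close>, used until the argument falls below
  \<open>3 / 2\<close>, gives \<open>K * (1 + x) powr x\<close>. The exponent \<open>3 / 2\<close> then comes from
  \<open>ln y \<le> 2 * sqrt y\<close>.
\<close>

lemma Gamma_real_growth:
  obtains K where "K > 0" "\<And>x::real. x \<ge> 1 / 2 \<Longrightarrow> Gamma x \<le> K * exp (2 * (1 + x) powr (3 / 2))"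
proof -
  have "compact (Gamma ` {1/2..3/2::real})"
    by (intro compact_continuous_image continuous_intros compact_Icc) (auto simp: nonpos_Ints_def)
  then obtain K where K: "K > 0" "\<And>x::real. 1/2 \<le> x \<Longrightarrow> x \<le> 3/2 \<Longrightarrow> norm (Gamma x) \<le> K"
    using compact_imp_bounded bounded_pos[of "Gamma ` {1/2..3/2::real}"] by (auto simp: image_iff)
  have step: "1/2 \<le> x \<Longrightarrow> x \<le> 3/2 + real k \<Longrightarrow> Gamma x \<le> K * (1 + x) powr x" for x :: real and k
  proof (induction k arbitrary: x)
    case 0
    have "Gamma x * 1 \<le> K * (1 + x) powr x"
      using K(1) K(2)[of x] 0 by (intro mult_mono ge_one_powr_ge_zero) auto
    then show ?case by simp
  next
    case (Suc k)
    show ?case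
    proof (cases "x \<le> 3/2")
      case True
      then show ?thesis using Suc by (intro Suc.IH) auto
    next
      case False
      have "Gamma x = (x - 1) * Gamma (x - 1)"
        using Gamma_plus1[of "x - 1"] False by (auto simp: nonpos_Ints_def)
      also have "\<dots> \<le> (1 + x) * (K * (1 + x) powr (x - 1))"
      proof (intro mult_mono)
        have "Gamma (x - 1) \<le> K * (1 + (x - 1)) powr (x - 1)"
          using Suc.prems False by (intro Suc.IH) auto
        also have "\<dots> \<le> K * (1 + x) powr (x - 1)"
          using K(1) False by (intro mult_left_mono powr_mono2) auto
        finally show "Gamma (x - 1) \<le> K * (1 + x) powr (x - 1)" .
      qed (use False Gamma_real_pos[of "x - 1"] in auto)
      also have "\<dots> = K * (1 + x) powr x" using False by (simp add: powr_diff)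
      finally show ?thesis .
    qed
  qed
  have "Gamma x \<le> K * exp (2 * (1 + x) powr (3 / 2))" if x: "x \<ge> 1/2" for x
  proof -
    obtain k where "x \<le> real k" using real_arch_simple by blast
    then have "Gamma x \<le> K * (1 + x) powr x" using step[of x k] x by simp
    also have "(1 + x) powr x \<le> exp (2 * (1 + x) powr (3 / 2))"
    proof -
      have "ln (1 + x) = 2 * ln ((1 + x) powr (1/2))" using x by (simp add: ln_powr)
      also have "\<dots> \<le> 2 * (1 + x) powr (1/2)"
        using x by (intro mult_left_mono less_imp_le[OF ln_less_self]) auto
      finally have "x * ln (1 + x) \<le> (1 + x) * (2 * (1 + x) powr (1/2))"
        using x by (intro mult_mono) auto
      also have "\<dots> = 2 * (1 + x) powr (1 + 1/2)" using x by (subst powr_add) auto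
      finally show ?thesis using x by (simp add: powr_def)
    qed
    finally show ?thesis using K(1) by simp
  qed
  with K(1) show ?thesis using that by blast
qed

lemma sin_add_nat_pi: "sin (z + of_nat n * of_real pi) = (- 1) ^ n * sin z" for z :: complex
proof (induction n)
  case (Suc n)
  have "sin (z + of_nat (Suc n) * of_real pi) = sin ((z + of_nat n * of_real pi) + of_real pi)"
    by (simp add: algebra_simps)
  also have "\<dots> = - sin (z + of_nat n * of_real pi)" by (simp add: sin_add)
  finally show ?case by (simp add: Suc)
qed simp

text \<open>
  The reflection formula turns \<open>Gamma s * \<zeta> s = \<Sum> b n / (s + n - 1) + E s\<close>, where \<open>E\<close> is the
  integral over \<open>[1, \<infinity>)\<close>, into a formula for \<open>\<zeta> s / Gamma (1 - s)\<close> after multiplication by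
  \<open>sin (pi * s) / pi\<close>. Each quotient
  \<open>sin (pi * s) / (pi * (s + n - 1))\<close> is, up to sign, a translate of \<open>sinc\<close> and so has no pole.
  The value at \<open>1\<close>, where only the term \<open>n = 0\<close> survives, becomes the residue of \<open>\<zeta>\<close>.
\<close>

lemma zeta_times_rGamma_holomorphic:
  obtains A :: "complex \<Rightarrow> complex" and B :: real where "A holomorphic_on {s. Re s < 2}" "A 1 = - 1"
    "\<And>s. 1 < s \<Longrightarrow> s < 2 \<Longrightarrow> A (of_real s) = zeta_series (of_real s) * rGamma (1 - of_real s)"
    "B > 0" "\<And>s. Re s < 2 \<Longrightarrow> norm (A s) \<le> B * exp (pi * norm s)"
proof -
  obtain b :: "nat \<Rightarrow> complex" where b: "b 0 = 1" "summable (\<lambda>n. norm (b n))"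
    "\<And>x. 0 < x \<Longrightarrow> x \<le> 1 \<Longrightarrow> (\<lambda>n. b n * of_real x ^ n) sums of_real (x / (exp x - 1))"
    using bose_coefficients by blast
  obtain sinc :: "complex \<Rightarrow> complex" and K :: real where sinc: "sinc holomorphic_on UNIV"
    "sinc 0 = 1" "\<And>w. w \<noteq> 0 \<Longrightarrow> sinc w = sin (of_real pi * w) / (of_real pi * w)"
    "\<And>w. norm (sinc w) \<le> K * exp (pi * \<bar>Im w\<bar>)" "K > 0"
    using sinc_entire by blast
  define f where "f = (\<lambda>n s. b n * (- 1) ^ Suc n * sinc (s + of_nat n - 1))"
  define S where "S = (\<lambda>s. \<Sum>n. f n s)"
  define E where "E = (\<lambda>s. \<Sum>j. bose_piece j s)"
  define A where "A = (\<lambda>s. S s + sin (of_real pi * s) / of_real pi * E s)"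
  let ?H = "{s. Re s < 2}"
  have fb: "norm (f n s) \<le> norm (b n) * (K * exp (pi * r))" if "\<bar>Im s\<bar> \<le> r" for n s r
  proof -
    have "norm (sinc (s + of_nat n - 1)) \<le> K * exp (pi * \<bar>Im (s + of_nat n - 1)\<bar>)" by (rule sinc(4))
    also have "\<dots> \<le> K * exp (pi * r)" using that sinc(5) by simp
    finally show ?thesis unfolding f_def norm_mult by (simp add: norm_power mult_left_mono)
  qed
  have fsum: "summable (\<lambda>n. norm (b n) * c)" for c using b(2) by (rule summable_mult2)
  have S: "S holomorphic_on UNIV" unfolding S_def
  proof (rule series_holomorphic_deriv(1)[OF open_UNIV])
    have "(sinc \<circ> (\<lambda>s. s + of_nat n - 1)) holomorphic_on UNIV" for n
      by (rule holomorphic_on_compose_gen[OF _ sinc(1)]) (auto intro!: holomorphic_intros)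
    then have c: "(\<lambda>s. sinc (s + of_nat n - 1)) holomorphic_on UNIV" for n by (simp only: o_def)
    show "f n holomorphic_on UNIV" for n unfolding f_def by (intro holomorphic_intros c)
    show "\<exists>d>0. \<exists>M. cball x d \<subseteq> UNIV \<and> summable M \<and> (\<forall>n. \<forall>y\<in>cball x d. norm (f n y) \<le> M n)" for x
    proof (intro exI[of _ 1] exI[of _ "\<lambda>n. norm (b n) * (K * exp (pi * (norm x + 1)))"] conjI allI ballI)
      fix n y assume "y \<in> cball x 1"
      then have "\<bar>Im y\<bar> \<le> norm x + 1"
        using abs_Im_le_cmod[of y] norm_triangle_ineq2[of y x] by (simp add: dist_norm norm_minus_commute)
      then show "norm (f n y) \<le> norm (b n) * (K * exp (pi * (norm x + 1)))" by (rule fb)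
    qed (use fsum in auto)
  qed
  have E: "E holomorphic_on ?H" unfolding E_def
  proof (rule series_holomorphic_deriv(1))
    show "open ?H" by (rule open_halfspace_Re_lt)
    show "bose_piece j holomorphic_on ?H" for j
      using bose_piece_holomorphic by (rule holomorphic_on_subset) simp
    fix x assume x: "x \<in> ?H"
    define d where "d = (2 - Re x) / 2"
    have d: "d > 0" using x by (simp add: d_def)
    have Re: "Re y < 2" if "y \<in> cball x d" for y
    proof -
      have "Re y - Re x \<le> d" using abs_Re_le_cmod[of "x - y"] that by (simp add: dist_norm abs_le_iff)
      then show ?thesis using d by (simp add: d_def field_simps)
    qed
    then have "cball x d \<subseteq> ?H" by auto
    moreover have "norm (bose_piece j y) \<le> (real j + 2) / (exp (real j + 1) - 1)" if "y \<in> cball x d" for j y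
      using Re[OF that] by (intro norm_bose_piece) auto
    ultimately show "\<exists>d>0. \<exists>M. cball x d \<subseteq> ?H \<and> summable M \<and> (\<forall>n. \<forall>y\<in>cball x d. norm (bose_piece n y) \<le> M n)"
      using d summable_bose_bound by blast
  qed
  have A: "A holomorphic_on ?H" unfolding A_def
    by (intro holomorphic_intros E holomorphic_on_subset[OF S]) auto
  have "A 1 = - 1"
  proof -
    have "sinc (of_nat n) = 0" if "n > 0" for n
      using sinc(3)[of "of_nat n"] sin_add_nat_pi[of 0 n] that by (simp add: mult.commute)
    then have "f n 1 = (if n = 0 then - 1 else 0)" for n by (auto simp: f_def b(1) sinc(2))
    then have "S 1 = - 1"
      unfolding S_def using sums_unique[OF sums_single[of 0 "\<lambda>_. - 1 :: complex"]] by simp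
    then show ?thesis by (simp add: A_def)
  qed
  moreover have "A (of_real s) = zeta_series (of_real s) * rGamma (1 - of_real s)" if s: "1 < s" "s < 2" for s
  proof -
    define sn where "sn = sin (of_real pi * complex_of_real s) / of_real pi"
    have fn: "f n (of_real s) = sn * (b n / of_real (s + real n - 1))" for n
    proof -
      have nz: "complex_of_real s + of_nat n - 1 \<noteq> 0"
      proof
        assume "complex_of_real s + of_nat n - 1 = 0"
        from arg_cong[OF this, of Re] have "s + real n - 1 = 0" by simp
        then show False using s by simp
      qed
      have "sin (of_real pi * (complex_of_real s + of_nat n - 1)) =
         - sin (of_real pi * (complex_of_real s + of_nat n - 1) + of_real pi)" by (simp add: sin_add)
      also have "of_real pi * (complex_of_real s + of_nat n - 1) + of_real pi =
        of_real pi * of_real s + of_nat n * of_real pi" by (simp add: algebra_simps)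
      also have "- sin \<dots> = (- 1) ^ Suc n * sin (of_real pi * complex_of_real s)"
        by (simp only: sin_add_nat_pi power_Suc) simp
      finally have "sinc (of_real s + of_nat n - 1) =
        (- 1) ^ Suc n * sin (of_real pi * complex_of_real s) / (of_real pi * (complex_of_real s + of_nat n - 1))"
        using sinc(3)[OF nz] by simp
      then show ?thesis by (simp add: f_def sn_def field_simps)
    qed
    have fs: "summable (\<lambda>n. f n (of_real s))"
      by (rule summable_comparison_test'[OF fsum[of "K * exp (pi * 0)"]]) (rule fb, simp)
    have sn: "sn \<noteq> 0"
    proof
      assume "sn = 0"
      then have "Gamma (complex_of_real s) * Gamma (1 - complex_of_real s) = 0"
        unfolding Gamma_reflection_complex by (simp add: sn_def)
      then have "complex_of_real s \<in> \<int>\<^sub>\<le>\<^sub>0 \<or> complex_of_real (1 - s) \<in> \<int>\<^sub>\<le>\<^sub>0"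
        by (simp add: Gamma_eq_zero_iff)
      then have "s \<in> \<int>\<^sub>\<le>\<^sub>0 \<or> 1 - s \<in> \<int>\<^sub>\<le>\<^sub>0" by (simp only: of_real_in_nonpos_Ints_iff)
      then obtain n :: int where "n \<le> 0" "s = of_int n \<or> 1 - s = of_int n" by (auto elim!: nonpos_Ints_cases)
      then have "s = of_int n \<or> s = of_int (1 - n)" by auto
      then obtain m :: int where "s = of_int m" by blast
      then have "1 < m" "m < 2" using s by simp_all
      then show False by simp
    qed
    have "S (of_real s) = sn * (\<Sum>n. b n / of_real (s + real n - 1))"
      unfolding S_def fn by (rule suminf_mult[OF summable_mult_D[OF fs[unfolded fn] sn]])
    then have "A (of_real s) = sn * ((\<Sum>n. b n / of_real (s + real n - 1)) + E (of_real s))"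
      by (simp add: A_def sn_def algebra_simps)
    also have "\<dots> = sn * of_real (Gamma s * (\<Sum>n. 1 / real (Suc n) powr s))"
      unfolding E_def by (simp only: zeta_integral_pieces[OF s b(2,3)])
    also have "\<dots> = sn * Gamma (of_real s) * of_real (\<Sum>n. 1 / real (Suc n) powr s)"
      by (simp add: Gamma_complex_of_real)
    also have "of_real (\<Sum>n. 1 / real (Suc n) powr s) = zeta_series (of_real s)"
    proof -
      have "(\<lambda>n. 1 / real (Suc n) powr s) sums (\<Sum>n. 1 / real (Suc n) powr s)"
        using summable_zeta_bound[OF s(1)] by (intro summable_sums) (simp add: powr_minus divide_inverse)
      from sums_of_real[OF this, where 'a = complex]
      have "(\<lambda>n. 1 / of_nat (Suc n) powr of_real s) sums complex_of_real (\<Sum>n. 1 / real (Suc n) powr s)"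
        by (simp add: powr_of_real[symmetric] del: of_nat_Suc)
      then show ?thesis unfolding zeta_series_def by (simp add: sums_iff)
    qed
    also have "sn * Gamma (of_real s) = rGamma (1 - of_real s)"
    proof -
      have "sn = rGamma (of_real s) * rGamma (1 - of_real s)"
        unfolding sn_def by (rule rGamma_reflection_complex[symmetric])
      moreover have "complex_of_real s \<notin> \<int>\<^sub>\<le>\<^sub>0"
        unfolding of_real_in_nonpos_Ints_iff using s by (auto simp: nonpos_Ints_def)
      ultimately show ?thesis by (simp add: Gamma_def rGamma_eq_zero_iff)
    qed
    finally show ?thesis by (simp add: mult.commute)
  qed
  moreover have "norm (A s) \<le> ((\<Sum>n. norm (b n)) * K + (\<Sum>j. (real j + 2) / (exp (real j + 1) - 1)) + 1) * exp (pi * norm s)"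
    if s: "Re s < 2" for s
  proof -
    have "norm (S s) \<le> (\<Sum>n. norm (b n) * (K * exp (pi * norm s)))"
      unfolding S_def by (rule norm_suminf_le[OF _ fsum]) (rule fb, rule abs_Im_le_cmod)
    also have "\<dots> = (\<Sum>n. norm (b n)) * (K * exp (pi * norm s))"
      by (rule suminf_mult2[OF b(2), symmetric])
    finally have 1: "norm (S s) \<le> (\<Sum>n. norm (b n)) * K * exp (pi * norm s)" by simp
    have 2: "norm (E s) \<le> (\<Sum>j. (real j + 2) / (exp (real j + 1) - 1))"
      unfolding E_def by (rule norm_suminf_le[OF norm_bose_piece summable_bose_bound]) (use s in auto)
    have "norm (sin (of_real pi * s)) \<le> exp \<bar>Im (of_real pi * s)\<bar>" by (rule norm_sin_le)
    also have "\<dots> \<le> exp (pi * norm s)" using abs_Im_le_cmod[of s] by (simp add: abs_mult)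
    finally have "norm (sin (of_real pi * s) / of_real pi) \<le> exp (pi * norm s) / 1"
      unfolding norm_divide norm_of_real using pi_gt3 by (intro frac_le) auto
    then have "norm (sin (of_real pi * s) / of_real pi * E s) \<le>
       exp (pi * norm s) * (\<Sum>j. (real j + 2) / (exp (real j + 1) - 1))"
      unfolding norm_mult using 2 by (intro mult_mono) auto
    with 1 have "norm (A s) \<le> (\<Sum>n. norm (b n)) * K * exp (pi * norm s) +
       exp (pi * norm s) * (\<Sum>j. (real j + 2) / (exp (real j + 1) - 1))"
      unfolding A_def by (intro norm_triangle_mono)
    also have "\<dots> \<le> \<dots> + exp (pi * norm s)" by simp
    finally show ?thesis by (simp add: algebra_simps)
  qed
  moreover have "(\<Sum>n. norm (b n)) * K + (\<Sum>j. (real j + 2) / (exp (real j + 1) - 1)) + 1 > 0"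
    using sinc(5) by (intro add_nonneg_pos add_nonneg_nonneg mult_nonneg_nonneg suminf_nonneg b(2) summable_bose_bound) auto
  ultimately show ?thesis using that A by blast
qed

text \<open>
  \<open>- Gamma (2 - s) * A s\<close> is holomorphic for \<open>Re s < 2\<close> and \<open>(s - 1) * zeta_series s\<close> for
  \<open>Re s > 1\<close>; they agree on the real interval \<open>(1, 2)\<close>, hence on the strip, and fit together to an
  entire function. For \<open>Re s \<le> 3 / 2\<close> the growth is that of \<open>Gamma\<close> and \<open>A\<close>; to the right of
  this line the Dirichlet series is bounded.
\<close>

lemma zeta_entire_exists:
  obtains F :: "complex \<Rightarrow> complex" and C :: real where "F holomorphic_on UNIV" "F 1 = 1"
    "\<And>s. Re s > 1 \<Longrightarrow> F s = (s - 1) * zeta_series s"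
    "C > 0" "\<And>s. norm (F s) \<le> exp (C * (1 + norm s) powr (3 / 2))"
proof -
  obtain A :: "complex \<Rightarrow> complex" and B :: real where A: "A holomorphic_on {s. Re s < 2}" "A 1 = - 1"
    "\<And>s. 1 < s \<Longrightarrow> s < 2 \<Longrightarrow> A (of_real s) = zeta_series (of_real s) * rGamma (1 - of_real s)"
    "B > 0" "\<And>s. Re s < 2 \<Longrightarrow> norm (A s) \<le> B * exp (pi * norm s)"
    using zeta_times_rGamma_holomorphic by blast
  define L where "L = (\<lambda>s. - Gamma (2 - s) * A s)"
  define R where "R = (\<lambda>s. (s - 1) * zeta_series s)"
  define F where "F = (\<lambda>s. if Re s < 2 then L s else R s)"
  have L: "L holomorphic_on {s. Re s < 2}" unfolding L_def
    by (intro holomorphic_intros A) (auto elim!: nonpos_Ints_cases simp: complex_eq_iff)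
  have R: "R holomorphic_on {s. Re s > 1}" unfolding R_def
    by (intro holomorphic_intros zeta_series_holomorphic)
  let ?S = "{s. Re s > 1} \<inter> {s. Re s < 2}"
  have real_eq: "L (of_real s) - R (of_real s) = 0" if s: "1 < s" "s < 2" for s
  proof -
    have nz: "complex_of_real (1 - s) \<notin> \<int>\<^sub>\<le>\<^sub>0"
    proof
      assume "complex_of_real (1 - s) \<in> \<int>\<^sub>\<le>\<^sub>0"
      then obtain n :: int where "1 - s = of_int n" unfolding of_real_in_nonpos_Ints_iff
        by (auto elim!: nonpos_Ints_cases)
      then have "s = of_int (1 - n)" by simp
      then have "1 < 1 - n" "1 - n < 2" using s by (simp_all del: of_int_diff)
      then show False by simp
    qed
    have G: "Gamma (2 - complex_of_real s) = (1 - of_real s) * Gamma (1 - of_real s)"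
      using Gamma_plus1[OF nz] by (simp add: algebra_simps)
    have "L (of_real s) = (of_real s - 1) * zeta_series (of_real s) *
        (Gamma (1 - of_real s) * rGamma (1 - of_real s))"
      unfolding L_def A(3)[OF s] G by (simp add: algebra_simps)
    moreover have "Gamma (1 - complex_of_real s) * rGamma (1 - of_real s) = 1"
      using nz by (simp add: Gamma_def rGamma_eq_zero_iff)
    ultimately show ?thesis by (simp add: R_def)
  qed
  have strip: "L s = R s" if "s \<in> ?S" for s
  proof -
    have "L s - R s = 0"
    proof (rule analytic_continuation[where f = "\<lambda>s. L s - R s" and w = s and S = ?S and U = "of_real ` {1<..<2}" and \<xi> = "of_real (3/2)"])
      show "(\<lambda>s. L s - R s) holomorphic_on ?S"
        by (intro holomorphic_intros holomorphic_on_subset[OF L] holomorphic_on_subset[OF R]) auto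
      show "open ?S" by (intro open_Int open_halfspace_Re_gt open_halfspace_Re_lt)
      show "connected ?S" by (intro convex_connected convex_Int convex_halfspace_Re_gt convex_halfspace_Re_lt)
      show "complex_of_real (3/2) islimpt of_real ` {1<..<2}"
        unfolding islimpt_approachable
      proof (intro allI impI)
        fix e :: real assume e: "e > 0"
        define d where "d = min (e / 2) (1 / 4)"
        have d: "0 < d" "d < e" "d \<le> 1/4" using e by (auto simp: d_def)
        have "dist (complex_of_real (3/2 + d)) (of_real (3/2)) < e"
          using d by (simp only: dist_of_real) (simp add: dist_real_def)
        moreover have "complex_of_real (3/2 + d) \<noteq> of_real (3/2)"
          using d unfolding of_real_eq_iff by simp
        moreover have "3/2 + d \<in> {1<..<2}" using d by simp
        ultimately show "\<exists>x'\<in>complex_of_real ` {1<..<2}. x' \<noteq> of_real (3/2) \<and> dist x' (of_real (3/2)) < e"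
          by blast
      qed
    qed (use real_eq that in auto)
    then show ?thesis by simp
  qed
  have FR: "F s = R s" if "Re s > 1" for s using strip[of s] that by (simp add: F_def)
  have "F holomorphic_on ({s. Re s < 2} \<union> {s. Re s > 1})"
  proof (rule holomorphic_on_Un)
    show "F holomorphic_on {s. Re s < 2}" by (rule holomorphic_transform[OF L]) (simp add: F_def)
    show "F holomorphic_on {s. Re s > 1}" by (rule holomorphic_transform[OF R]) (simp add: FR)
  qed (auto simp: open_halfspace_Re_lt open_halfspace_Re_gt)
  moreover have "{s. Re s < 2} \<union> {s. Re s > 1} = UNIV" by auto
  ultimately have "F holomorphic_on UNIV" by simp
  moreover have "F 1 = 1" by (simp add: F_def L_def A(2))
  moreover have "F s = (s - 1) * zeta_series s" if "Re s > 1" for s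
    using FR[OF that] by (simp add: R_def)
  moreover have "\<exists>C>0. \<forall>s. norm (F s) \<le> exp (C * (1 + norm s) powr (3 / 2))"
  proof -
    obtain K where K: "K > 0" "\<And>x::real. x \<ge> 1 / 2 \<Longrightarrow> Gamma x \<le> K * exp (2 * (1 + x) powr (3 / 2))"
      using Gamma_real_growth by blast
    define Z where "Z = (\<Sum>n. real (Suc n) powr (- (3 / 2)))"
    have Z: "Z \<ge> 0" unfolding Z_def by (intro suminf_nonneg summable_zeta_bound) auto
    define M where "M = K * B + Z + 1"
    have M: "M \<ge> 1" "K * B \<le> M" "Z \<le> M" using K(1) A(4) Z by (auto simp: M_def)
    define C where "C = 2 * 3 powr (3 / 2) + pi + ln M"
    have C: "C > 0" unfolding C_def using M(1) by (intro add_pos_nonneg) auto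
    have key: "norm (F s) \<le> M * exp (2 * (3 * (1 + norm s)) powr (3 / 2)) * exp (pi * norm s)" for s
    proof (cases "Re s \<le> 3 / 2")
      case True
      have "norm (Gamma (2 - s)) \<le> Gamma (Re (2 - s))" using True by (intro norm_Gamma_le) auto
      also have "\<dots> \<le> K * exp (2 * (1 + Re (2 - s)) powr (3 / 2))" using True by (intro K) auto
      also have "\<dots> \<le> K * exp (2 * (3 * (1 + norm s)) powr (3 / 2))"
        using K(1) True abs_Re_le_cmod[of s] norm_ge_zero[of s]
        by (intro mult_left_mono exp_le_cancel_iff[THEN iffD2] powr_mono2) (auto simp: abs_le_iff)
      finally have "norm (F s) \<le> K * exp (2 * (3 * (1 + norm s)) powr (3 / 2)) * (B * exp (pi * norm s))"
        using True A(5)[of s] K(1) by (simp add: F_def L_def norm_mult mult_mono)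
      also have "\<dots> = K * B * (exp (2 * (3 * (1 + norm s)) powr (3 / 2)) * exp (pi * norm s))" by simp
      also have "\<dots> \<le> M * (exp (2 * (3 * (1 + norm s)) powr (3 / 2)) * exp (pi * norm s))"
        using M by (intro mult_right_mono) auto
      finally show ?thesis by (simp add: mult.assoc)
    next
      case False
      have "norm (s - 1) \<le> 1 + norm s" using norm_triangle_ineq4[of s 1] by simp
      also have "\<dots> \<le> exp (norm s)" by (rule exp_ge_add_one_self)
      also have "\<dots> \<le> exp (pi * norm s)" using pi_gt3 by (simp add: mult_le_cancel_right1)
      finally have "norm (F s) \<le> exp (pi * norm s) * Z"
        using False norm_zeta_series_le[of s] by (simp add: FR R_def norm_mult Z_def mult_mono)
      also have "\<dots> \<le> exp (pi * norm s) * (M * exp (2 * (3 * (1 + norm s)) powr (3 / 2)))"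
      proof (intro mult_left_mono)
        have "M * 1 \<le> M * exp (2 * (3 * (1 + norm s)) powr (3 / 2))"
          using M by (intro mult_left_mono) auto
        then show "Z \<le> M * exp (2 * (3 * (1 + norm s)) powr (3 / 2))" using M by linarith
      qed simp
      finally show ?thesis by (simp add: mult_ac)
    qed
    have "norm (F s) \<le> exp (C * (1 + norm s) powr (3 / 2))" for s
    proof -
      let ?t = "(1 + norm s) powr (3 / 2)"
      have t1: "1 \<le> ?t" by (intro ge_one_powr_ge_zero) auto
      have "(1 + norm s) powr 1 \<le> ?t" by (intro powr_mono) auto
      then have "pi * norm s \<le> pi * ?t" by (intro mult_left_mono) auto
      moreover have "2 * (3 * (1 + norm s)) powr (3 / 2) = 2 * 3 powr (3/2) * ?t" by (subst powr_mult) auto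
      moreover have "ln M \<le> ln M * ?t" using M t1 by (simp add: mult_le_cancel_left1)
      ultimately have "ln M + 2 * (3 * (1 + norm s)) powr (3 / 2) + pi * norm s \<le> C * ?t"
        unfolding C_def ring_distribs by linarith
      then have "exp (ln M + 2 * (3 * (1 + norm s)) powr (3 / 2) + pi * norm s) \<le> exp (C * ?t)" by simp
      with key[of s] M(1) show ?thesis by (simp add: exp_add)
    qed
    with C show ?thesis by blast
  qed
  ultimately show ?thesis using that by blast
qed

text \<open>
  The quotient also has the right value at \<open>s = 1\<close>: division by zero yields \<open>0\<close>, which is the
  normalisation in the definition of \<^const>\<open>riemann_zeta\<close>.
\<close>

lemma zeta_characterisation:
  obtains F :: "complex \<Rightarrow> complex" and C :: real where "F holomorphic_on UNIV" "F 1 = 1"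
    "C > 0" "\<And>s. norm (F s) \<le> exp (C * (1 + norm s) powr (3 / 2))"
    "\<And>s. riemann_zeta s = F s / (s - 1)" "\<And>s. Re s > 1 \<Longrightarrow> riemann_zeta s = zeta_series s"
proof -
  obtain F :: "complex \<Rightarrow> complex" and C :: real where F: "F holomorphic_on UNIV" "F 1 = 1"
    "\<And>s. Re s > 1 \<Longrightarrow> F s = (s - 1) * zeta_series s"
    "C > 0" "\<And>s. norm (F s) \<le> exp (C * (1 + norm s) powr (3 / 2))"
    using zeta_entire_exists by blast
  let ?z = "\<lambda>s. F s / (s - 1)"
  let ?P = "\<lambda>f. f holomorphic_on (UNIV - {1}) \<and> f 1 = 0 \<and>
     (\<forall>s. Re s > 1 \<longrightarrow> (\<lambda>n. 1 / of_nat (Suc n) powr s) sums f s)"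
  have zz: "?z s = zeta_series s" if "Re s > 1" for s using F(3)[OF that] that by auto
  have "?z holomorphic_on (UNIV - {1})"
    by (intro holomorphic_intros holomorphic_on_subset[OF F(1)]) auto
  then have P: "?P ?z" using zeta_series_sums zz by auto
  have "riemann_zeta = ?z" unfolding riemann_zeta_def
  proof (rule the_equality)
    fix f assume f: "?P f"
    have "f s = ?z s" for s
    proof (cases "s = 1")
      case False
      show ?thesis
      proof (rule analytic_continuation_open[where s = "{s. Re s > 1}" and s' = "UNIV - {1}" and f = f])
        show "connected (UNIV - {1 :: complex})" using connected_punctured_universe[of "1::complex"] by (simp add: Compl_eq_Diff_UNIV)
        show "{s. Re s > 1} \<noteq> {}" 
        proof -
          have "2 \<in> {s :: complex. Re s > 1}" by simp
          then show ?thesis by blast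
        qed
        show "f s = ?z s" if "s \<in> {s. Re s > 1}" for s
        proof (rule sums_unique2)
          show "(\<lambda>n. 1 / of_nat (Suc n) powr s) sums f s" using f that by blast
          show "(\<lambda>n. 1 / of_nat (Suc n) powr s) sums ?z s" using P that by blast
        qed
      qed (use f P False open_halfspace_Re_gt in auto)
    qed (use f in auto)
    then show "f = ?z" by blast
  qed (rule P)
  then have eq: "riemann_zeta s = ?z s" for s by (rule fun_cong)
  show ?thesis
  proof (rule that[OF F(1,2,4,5)])
    show "riemann_zeta s = ?z s" for s by (rule eq)
    show "riemann_zeta s = zeta_series s" if "Re s > 1" for s unfolding eq by (rule zz[OF that])
  qed
qed

section \<open>The logarithmic derivative of the zeta function at the origin\<close>

text \<open>
  The mean value inequality is applied twice: to \<open>g'\<close> over a step of length one, and then to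
  the first difference of \<open>g\<close>, where \<open>g z = z powr (- s)\<close>.
\<close>

lemma powr_second_difference_bound:
  fixes s :: complex and a :: real
  assumes a: "a \<ge> 1" and s: "Re s \<ge> - 2"
  shows "norm (of_real a powr (- s) - 2 * of_real (a + 1) powr (- s) + of_real (a + 2) powr (- s))
     \<le> norm s * norm (s + 1) * a powr (- Re s - 2)"
proof -
  define B where "B = norm s * norm (s + 1) * a powr (- Re s - 2)"
  define I where "I = (\<lambda>b. complex_of_real ` {a..b})"
  have cvx: "convex (I b)" for b
    unfolding I_def by (intro convex_linear_image bounded_linear.linear bounded_linear_of_real) auto
  define g g' g'' where "g = (\<lambda>z. z powr (- s))" and "g' = (\<lambda>z. (- s) * z powr (- s - 1))"
    and "g'' = (\<lambda>z. (- s) * ((- s - 1) * z powr (- s - 1 - 1)))"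
  have pos: "z \<notin> \<real>\<^sub>\<le>\<^sub>0" if "z \<in> I b" for z b
    using that a by (auto simp: I_def complex_nonpos_Reals_iff)
  have dg: "(g has_field_derivative g' z) (at z)" if "z \<in> I b" for z b
    unfolding g_def g'_def by (rule has_field_derivative_powr[OF pos[OF that]])
  have dg': "(g' has_field_derivative g'' z) (at z)" if "z \<in> I b" for z b
    unfolding g'_def g''_def by (rule DERIV_cmult[OF has_field_derivative_powr[OF pos[OF that]]])
  have g''B: "norm (g'' z) \<le> B" if z: "z \<in> I b" for z b
  proof -
    obtain x where x: "z = of_real x" "x \<ge> a" using z unfolding I_def by auto
    have "norm (z powr (- s - 1 - 1)) = x powr (- Re s - 2)"
    proof -
      have "Re (- s - 1 - 1) = - Re s - 2" by simp
      moreover have "norm (z powr (- s - 1 - 1)) = Re z powr Re (- s - 1 - 1)"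
        using x a by (intro norm_powr_real_powr) auto
      ultimately show ?thesis using x by (simp only: Re_complex_of_real)
    qed
    also have "\<dots> \<le> a powr (- Re s - 2)" using x a s by (intro powr_mono2') auto
    finally have "norm s * norm (s + 1) * norm (z powr (- s - 1 - 1)) \<le> B"
      unfolding B_def by (rule mult_left_mono) simp
    moreover have "norm (- s - 1) = norm (s + 1)"
      using norm_minus_cancel[of "s + 1"] by simp
    ultimately show ?thesis unfolding g''_def norm_mult norm_minus_cancel by (simp only: mult.assoc)
  qed
  have shift: "z + 1 \<in> I (a + 2)" "z \<in> I (a + 2)" if z: "z \<in> I (a + 1)" for z
  proof -
    obtain x where x: "z = of_real x" "x \<in> {a..a+1}" using z unfolding I_def by blast
    then have "z + 1 = of_real (x + 1)" "x + 1 \<in> {a..a+2}" by auto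
    then show "z + 1 \<in> I (a + 2)" unfolding I_def by blast
    show "z \<in> I (a + 2)" using x by (auto simp: I_def)
  qed
  have "norm ((g (of_real (a + 1) + 1) - g (of_real (a + 1))) - (g (of_real a + 1) - g (of_real a)))
     \<le> B * norm (complex_of_real (a + 1) - of_real a)"
  proof (rule field_differentiable_bound[where S = "I (a + 1)" and f' = "\<lambda>z. g' (z + 1) - g' z"])
    fix z assume z: "z \<in> I (a + 1)"
    have "((\<lambda>z. g (z + 1)) has_field_derivative g' (z + 1)) (at z)"
      using dg[OF shift(1)[OF z]] by (simp add: DERIV_shift)
    then show "((\<lambda>z. g (z + 1) - g z) has_field_derivative g' (z + 1) - g' z) (at z within I (a + 1))"
      by (intro has_field_derivative_at_within[OF DERIV_diff] dg[OF z])
    have "norm (g' (z + 1) - g' z) \<le> B * norm (z + 1 - z)"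
      by (rule field_differentiable_bound[OF cvx has_field_derivative_at_within[OF dg'] g''B shift(1)[OF z] shift(2)[OF z]])
    then show "norm (g' (z + 1) - g' z) \<le> B" by simp
  next
    show "convex (I (a + 1))" by (rule cvx)
    show "complex_of_real (a + 1) \<in> I (a + 1)" "complex_of_real a \<in> I (a + 1)"
      unfolding I_def by (rule imageI, simp)+
  qed
  then show ?thesis by (simp add: g_def B_def algebra_simps)
qed

text \<open>
  Twice the alternating series \<open>\<Sum> (- 1) ^ n / (n + 1) powr s\<close>, without one copy of its first
  term, can be grouped into second differences. They are of size \<open>m powr (- Re s - 2)\<close>, so the
  grouped series converges for \<open>Re s > - 1\<close>, a region that contains \<open>0\<close>.
\<close>

definition eta_term :: "nat \<Rightarrow> complex \<Rightarrow> complex" where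
  "eta_term m s = 1 / of_nat (Suc (2 * m)) powr s - 2 / of_nat (Suc (2 * m + 1)) powr s
     + 1 / of_nat (Suc (2 * m + 2)) powr s"

definition eta_series :: "complex \<Rightarrow> complex" where
  "eta_series s = (\<Sum>m. eta_term m s)"

lemma norm_eta_term_le:
  assumes "Re s \<ge> - 2"
  shows "norm (eta_term m s) \<le> norm s * norm (s + 1) * real (Suc (2 * m)) powr (- Re s - 2)"
proof -
  have "1 + complex_of_nat m * 2 + 1 = 2 + 2 * of_nat m" "1 + complex_of_nat m * 2 + 2 = 3 + 2 * of_nat m"
    by simp_all
  then show ?thesis
    using powr_second_difference_bound[of "real (Suc (2 * m))" s] assms
    by (simp add: eta_term_def powr_minus_divide add_ac mult_ac)
qed

lemma eta_series_deriv:
  shows eta_series_holomorphic: "eta_series holomorphic_on {s. Re s > - 1}"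
    and eta_series_deriv_0: "(\<lambda>m. deriv (eta_term m) 0) sums deriv eta_series 0"
proof -
  let ?S = "{s. Re s > - 1}"
  have hol: "eta_term n holomorphic_on ?S" for n
    unfolding eta_term_def by (intro holomorphic_intros) (auto simp del: of_nat_Suc)
  have bd: "\<exists>M. summable M \<and> (\<forall>n y. Re y \<ge> - 1 + d \<longrightarrow> norm y \<le> r \<longrightarrow> norm (eta_term n y) \<le> M n)"
    if d: "d > 0" and r: "r > 0" for d r
  proof (intro exI[of _ "\<lambda>n. r * (r + 1) * real (Suc n) powr (- (1 + d))"] conjI allI impI)
    show "summable (\<lambda>n. r * (r + 1) * real (Suc n) powr (- (1 + d)))"
      using d by (intro summable_mult summable_zeta_bound) auto
    fix n and y :: complex assume y: "Re y \<ge> - 1 + d" "norm y \<le> r"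
    have "norm (eta_term n y) \<le> norm y * norm (y + 1) * real (Suc (2 * n)) powr (- Re y - 2)"
      using y d by (intro norm_eta_term_le) auto
    also have "\<dots> \<le> r * (r + 1) * real (Suc n) powr (- (1 + d))"
    proof (intro mult_mono)
      show "norm (y + 1) \<le> r + 1" using y norm_triangle_ineq[of y 1] by simp
      have "real (Suc (2 * n)) powr (- Re y - 2) \<le> real (Suc (2 * n)) powr (- (1 + d))"
        using y by (intro powr_mono) auto
      also have "\<dots> \<le> real (Suc n) powr (- (1 + d))" using d by (intro powr_mono2') auto
      finally show "real (Suc (2 * n)) powr (- Re y - 2) \<le> real (Suc n) powr (- (1 + d))" .
    qed (use y r in auto)
    finally show "norm (eta_term n y) \<le> r * (r + 1) * real (Suc n) powr (- (1 + d))" .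
  qed
  have eq: "(\<lambda>s. \<Sum>n. eta_term n s) = eta_series" by (simp add: eta_series_def fun_eq_iff)
  show "eta_series holomorphic_on ?S"
    using half_plane_series(1)[OF hol bd] by (simp only: eq)
  show "(\<lambda>m. deriv (eta_term m) 0) sums deriv eta_series 0"
    using half_plane_series(2)[OF hol bd, of 0] by (simp only: eq) simp
qed

lemma eta_series_0: "eta_series 0 = 0"
  unfolding eta_series_def by (simp add: eta_term_def del: of_nat_Suc)

text \<open>
  The partial sums are the logarithms of the partial products in Wallis' formula.
\<close>

lemma deriv_eta_series_0: "deriv eta_series 0 = of_real (ln (pi / 2))"
proof -
  have d: "((\<lambda>s. c / of_nat (Suc n) powr s) has_field_derivative - c * of_real (ln (real (Suc n)))) (at 0)" for n and c :: complex
  proof -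
    have "((\<lambda>s. of_nat (Suc n) powr (- s)) has_field_derivative
        Ln (of_nat (Suc n)) * of_nat (Suc n) powr (- 0) * (- 1)) (at (0 :: complex))"
      by (rule DERIV_chain2[OF has_field_derivative_powr_right]) (auto intro!: derivative_eq_intros simp del: of_nat_Suc)
    from DERIV_cmult[OF this, of c] show ?thesis
      using Ln_of_real[of "real (Suc n)"] by (simp add: powr_minus_divide del: of_nat_Suc)
  qed
  have "deriv (eta_term m) 0 = of_real (2 * ln (real (Suc (2 * m + 1))) - ln (real (Suc (2 * m)))
      - ln (real (Suc (2 * m + 2))))" for m
    unfolding eta_term_def[abs_def]
    by (rule DERIV_imp_deriv, rule DERIV_cong[OF DERIV_add[OF DERIV_diff[OF d d] d]])
       (simp del: of_nat_Suc)
  then have 1: "(\<lambda>m. complex_of_real (2 * ln (real (Suc (2 * m + 1))) - ln (real (Suc (2 * m)))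
      - ln (real (Suc (2 * m + 2))))) sums deriv eta_series 0"
    using eta_series_deriv_0 by simp
  let ?w = "\<lambda>k. (4 * real k ^ 2) / (4 * real k ^ 2 - 1)"
  let ?l = "\<lambda>m. 2 * ln (real (Suc (2 * m + 1))) - ln (real (Suc (2 * m))) - ln (real (Suc (2 * m + 2)))"
  have lw: "?l m = ln (?w (Suc m))" "?w (Suc m) > 0" for m
  proof -
    have e: "4 * real (Suc m) ^ 2 = real (Suc (2 * m + 1)) ^ 2"
      "4 * real (Suc m) ^ 2 - 1 = real (Suc (2 * m)) * real (Suc (2 * m + 2))"
      by (simp_all add: power2_eq_square algebra_simps)
    have w: "?w (Suc m) = real (Suc (2 * m + 1)) ^ 2 / (real (Suc (2 * m)) * real (Suc (2 * m + 2)))"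
      by (subst e(2)) (subst e(1), rule refl)
    show "?w (Suc m) > 0" unfolding w by (intro divide_pos_pos mult_pos_pos zero_less_power) auto
    show "?l m = ln (?w (Suc m))"
      unfolding w by (simp add: ln_div ln_mult ln_realpow del: of_nat_Suc of_nat_add of_nat_mult)
  qed
  have partial: "(\<Sum>m<n. ?l m) = ln (\<Prod>k=1..n. ?w k)" for n
  proof -
    have "(\<Prod>k=1..n. ?w k) = (\<Prod>m<n. ?w (Suc m))"
      by (rule prod.reindex_bij_witness[of _ Suc "\<lambda>k. k - 1"]) auto
    moreover have "ln (\<Prod>m<n. ?w (Suc m)) = (\<Sum>m<n. ln (?w (Suc m)))"
    proof (rule ln_prod)
      show "?w (Suc i) \<noteq> 0" for i using lw(2)[of i] by linarith
    qed simp
    ultimately show ?thesis by (simp only: lw(1))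
  qed
  have "(\<lambda>n. ln (\<Prod>k=1..n. ?w k)) \<longlonglongrightarrow> ln (pi / 2)"
    by (intro tendsto_ln wallis) simp
  then have "?l sums ln (pi / 2)" unfolding sums_def partial .
  from sums_of_real[OF this, where 'a = complex] 1 show ?thesis using sums_unique2 by blast
qed

text \<open>
  Terms at even positions of the alternating series add up to \<open>2 powr (- s) * zeta_series s\<close>,
  and those at odd positions to the rest of \<open>zeta_series s\<close>.
\<close>

lemma eta_zeta_series:
  assumes s: "Re s > 1"
  shows "1 + eta_series s = 2 * (1 - 2 powr (1 - s)) * zeta_series s"
proof -
  let ?t = "\<lambda>n. 1 / of_nat (Suc n) powr s :: complex"
  note z = zeta_series_sums[OF s]
  have tw: "?t (2 * m + 1) = (1 / 2 powr s) * ?t m" for m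
  proof -
    have "of_nat (Suc (2 * m + 1)) = (2 * of_nat (Suc m) :: complex)" by simp
    then show ?thesis using powr_times_real[of 2 "of_nat (Suc m)" s] by (simp del: of_nat_Suc)
  qed
  have even: "(\<lambda>m. ?t (2 * m + 1)) sums ((1 / 2 powr s) * zeta_series s)"
    unfolding tw by (rule sums_mult[OF z])
  have "(\<lambda>m. ?t (2 * m) + ?t (2 * m + 1)) sums zeta_series s"
    using sums_group[OF z, of 2] by (simp add: numeral_2_eq_2 mult.commute sum.atLeast_Suc_lessThan)
  from sums_diff[OF this even]
  have odd: "(\<lambda>m. ?t (2 * m)) sums (zeta_series s - (1 / 2 powr s) * zeta_series s)" by simp
  then have "(\<lambda>m. ?t (2 * Suc m)) sums (zeta_series s - (1 / 2 powr s) * zeta_series s - 1)"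
    by (subst sums_Suc_iff) simp
  then have odd': "(\<lambda>m. ?t (2 * m + 2)) sums (zeta_series s - (1 / 2 powr s) * zeta_series s - 1)"
    by simp
  have "(\<lambda>m. eta_term m s) sums ((zeta_series s - (1 / 2 powr s) * zeta_series s)
     - 2 * ((1 / 2 powr s) * zeta_series s) + (zeta_series s - (1 / 2 powr s) * zeta_series s - 1))"
    using sums_add[OF sums_diff[OF odd sums_mult[OF even, of 2]] odd'] by (simp add: eta_term_def)
  then have "eta_series s = (zeta_series s - (1 / 2 powr s) * zeta_series s)
     - 2 * ((1 / 2 powr s) * zeta_series s) + (zeta_series s - (1 / 2 powr s) * zeta_series s - 1)"
    unfolding eta_series_def by (rule sums_unique[symmetric])
  then show ?thesis by (simp add: powr_diff algebra_simps)
qed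

text \<open>
  The two sides of \<open>(1 - 2 powr (1 - s)) * F s = (s - 1) * (1 + eta_series s) / 2\<close> are compared
  at \<open>0\<close>, in value and in derivative.
\<close>

lemma zeta_log_deriv_at_0:
  assumes F: "F holomorphic_on UNIV" "\<And>s. Re s > 1 \<Longrightarrow> F s = (s - 1) * zeta_series s"
  shows "F 0 = 1 / 2" "deriv F 0 / F 0 = of_real (ln (2 * pi)) - 1"
proof -
  let ?S = "{s. Re s > - 1}"
  let ?L = "\<lambda>s. (1 - 2 powr (1 - s)) * F s" and ?R = "\<lambda>s. (s - 1) * (1 + eta_series s) / 2"
  have eq: "?L s = ?R s" if "s \<in> ?S" for s
  proof (rule analytic_continuation_open[where s = "{s. Re s > 1}" and s' = ?S and f = ?L])
    show "{s. Re s > 1} \<noteq> {}"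
    proof -
      have "2 \<in> {s :: complex. Re s > 1}" by simp
      then show ?thesis by blast
    qed
    show "connected ?S" by (intro convex_connected convex_halfspace_Re_gt)
    show "?L s = ?R s" if "s \<in> {s. Re s > 1}" for s
      using F(2)[of s] eta_zeta_series[of s] that by simp
    show "?L holomorphic_on ?S" by (intro holomorphic_intros holomorphic_on_subset[OF F(1)]) auto
    show "?R holomorphic_on ?S" by (intro holomorphic_intros eta_series_holomorphic) auto
  qed (use that open_halfspace_Re_gt in auto)
  have "?L 0 = ?R 0" by (rule eq) simp
  then show F0: "F 0 = 1 / 2" by (simp add: eta_series_0)
  have dF: "(F has_field_derivative deriv F 0) (at 0)" by (rule holomorphic_derivI[OF F(1)]) auto
  have dE: "(eta_series has_field_derivative of_real (ln (pi / 2))) (at 0)"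
    using holomorphic_derivI[OF eta_series_holomorphic open_halfspace_Re_gt, of 0]
    by (simp add: deriv_eta_series_0)
  have "((\<lambda>s. 2 powr (1 - s)) has_field_derivative Ln 2 * 2 powr (1 - 0) * (- 1)) (at (0 :: complex))"
    by (rule DERIV_chain2[OF has_field_derivative_powr_right]) (auto intro!: derivative_eq_intros)
  from DERIV_mult[OF DERIV_diff[OF DERIV_const[of 1] this] dF]
  have 1: "(?L has_field_derivative Ln 2 - deriv F 0) (at 0)"
    by (rule DERIV_cong) (simp add: F0)
  have 2: "(?R has_field_derivative 1 / 2 - of_real (ln (pi / 2)) / 2) (at 0)"
    by (rule DERIV_cong[OF DERIV_cdivide[OF DERIV_mult[OF DERIV_diff[OF DERIV_ident DERIV_const]
        DERIV_add[OF DERIV_const dE]]]]) (simp add: eta_series_0)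
  have "(?R has_field_derivative Ln 2 - deriv F 0) (at 0)"
    by (rule has_field_derivative_transform_within_open[OF 1 open_halfspace_Re_gt[of "- 1"]]) (use eq in auto)
  with 2 have "1 / 2 - of_real (ln (pi / 2)) / 2 = Ln 2 - deriv F 0" by (rule DERIV_unique)
  moreover have "Ln 2 = complex_of_real (ln 2)" using Ln_of_real[of 2] by simp
  moreover have "ln (pi / 2) = ln pi - ln 2" "ln (2 * pi) = ln 2 + ln pi"
    by (simp_all add: ln_div ln_mult)
  ultimately show "deriv F 0 / F 0 = of_real (ln (2 * pi)) - 1"
    by (simp add: F0 field_simps)
qed

section \<open>The logarithmic derivative of the zeta function over prime powers\<close>

lemma mangoldt_bounds:
  "0 \<le> (mangoldt n :: real)" "(mangoldt n :: real) \<le> ln (real n)"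
proof -
  have pos: "0 \<le> (mangoldt d :: real)" for d
  proof (cases "primepow d")
    case True
    then obtain p k where "prime p" "k > 0" "d = p ^ k" by (auto simp: primepow_def)
    then show ?thesis using prime_ge_1_nat[of p] by (simp add: mangoldt_primepow)
  qed (simp add: mangoldt_def)
  then show "0 \<le> (mangoldt n :: real)" .
  show "(mangoldt n :: real) \<le> ln (real n)"
  proof (cases "n = 0")
    case False
    have "mangoldt n \<le> (\<Sum>d | d dvd n. mangoldt d :: real)"
      using False pos by (intro member_le_sum) auto
    with False show ?thesis by (simp add: mangoldt_sum)
  qed simp
qed

lemma summable_mangoldt:
  assumes "x > (1::real)"
  shows "summable (\<lambda>n. mangoldt (Suc n) * real (Suc n) powr (- x))"
proof (rule summable_comparison_test')
  define d where "d = (x - 1) / 2"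
  have d: "d > 0" using assms by (simp add: d_def)
  show "summable (\<lambda>n. 1 / d * real (Suc n) powr (- (1 + d)))"
    using d by (intro summable_mult summable_zeta_bound) auto
  fix n
  have "mangoldt (Suc n) \<le> ln (real (Suc n))" by (rule mangoldt_bounds)
  also have "\<dots> \<le> real (Suc n) powr d / d" using d by (intro ln_powr_bound) auto
  finally have "mangoldt (Suc n) * real (Suc n) powr (- x) \<le> real (Suc n) powr d / d * real (Suc n) powr (- x)"
    by (rule mult_right_mono) simp
  also have "\<dots> = 1 / d * (real (Suc n) powr d * real (Suc n) powr (- x))" by simp
  also have "\<dots> = 1 / d * (real (Suc n) powr (d + - x))" by (simp only: powr_add)
  also have "d + - x = - (1 + d)" by (simp add: d_def field_simps)
  finally show "norm (mangoldt (Suc n) * real (Suc n) powr (- x)) \<le> 1 / d * real (Suc n) powr (- (1 + d))"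
    using mangoldt_bounds(1)[of "Suc n"] by (simp del: of_nat_Suc)
qed

definition mangoldt_series :: "complex \<Rightarrow> complex" where
  "mangoldt_series s = (\<Sum>n. mangoldt (Suc n) * (1 / of_nat (Suc n) powr s))"

lemma norm_mangoldt_term:
  "norm (mangoldt (Suc n) * (1 / of_nat (Suc n) powr s) :: complex) = mangoldt (Suc n) * real (Suc n) powr (- Re s)"
proof -
  have "norm (mangoldt (Suc n) :: complex) = mangoldt (Suc n)"
    using norm_of_real[of "mangoldt (Suc n)", where 'a = complex] mangoldt_bounds(1)[of "Suc n"] by simp
  then show ?thesis by (simp only: norm_mult norm_zeta_term)
qed

lemma mangoldt_series_holomorphic: "mangoldt_series holomorphic_on {s. Re s > 1}"
proof -
  let ?S = "{s. Re s > 1}"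
  let ?f = "\<lambda>n s. mangoldt (Suc n) * (1 / of_nat (Suc n) powr s) :: complex"
  have hol: "?f n holomorphic_on ?S" for n by (intro holomorphic_intros) auto
  have bd: "\<exists>M. summable M \<and> (\<forall>n y. Re y \<ge> 1 + d \<longrightarrow> norm y \<le> r \<longrightarrow> norm (?f n y) \<le> M n)" if "d > 0" for d r
    unfolding norm_mangoldt_term using that mangoldt_bounds(1)
    by (intro exI[of _ "\<lambda>n. mangoldt (Suc n) * real (Suc n) powr (- (1 + d))"] conjI summable_mangoldt allI impI
        mult_left_mono powr_mono) auto
  have eq: "(\<lambda>s. \<Sum>n. ?f n s) = mangoldt_series" by (simp add: mangoldt_series_def fun_eq_iff)
  show ?thesis
    using half_plane_series(1)[OF hol bd] by (simp only: eq)
qed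

lemma has_sum_Suc_iff: "((\<lambda>n. f (Suc n)) has_sum S) UNIV \<longleftrightarrow> (f has_sum S) {0<..}"
  by (rule has_sum_reindex_bij_betw, rule bij_betwI[of _ _ _ "\<lambda>n. n - 1"]) auto

lemma norm_summable_Suc_imp_summable_on:
  fixes f :: "nat \<Rightarrow> complex"
  assumes "summable (\<lambda>n. norm (f (Suc n)))"
  shows "(\<lambda>n. norm (f n)) summable_on {0<..}"
proof -
  have "((\<lambda>n. norm (f (Suc n))) has_sum (\<Sum>n. norm (f (Suc n)))) UNIV"
    by (rule norm_summable_imp_has_sum) (use assms in \<open>simp_all add: summable_sums\<close>)
  then have "((\<lambda>n. norm (f n)) has_sum (\<Sum>n. norm (f (Suc n)))) {0<..}"
    by (rule has_sum_Suc_iff[of "\<lambda>n. norm (f n)", THEN iffD1])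
  then show ?thesis unfolding summable_on_def by blast
qed

text \<open>
  The product of the two absolutely convergent series is regrouped by \<open>n = d * m\<close>; the sum of
  \<^const>\<open>mangoldt\<close> over the divisors of \<open>n\<close> is \<open>ln n\<close>, the coefficient in \<open>- \<zeta>'\<close>.
\<close>

lemma mangoldt_convolution:
  assumes s: "Re s > 1"
  shows mangoldt_series_has_sum: "((\<lambda>n. mangoldt n * (1 / of_nat n powr s)) has_sum mangoldt_series s) {0<..}"
    and deriv_zeta_series: "deriv zeta_series s = - mangoldt_series s * zeta_series s"
proof -
  let ?N = "{0<..} :: nat set"
  let ?a = "\<lambda>n. 1 / of_nat n powr s :: complex"
  let ?b = "\<lambda>n. mangoldt n * ?a n"
  have sa: "summable (\<lambda>n. norm (?a (Suc n)))"
    unfolding norm_zeta_term by (rule summable_zeta_bound[OF s])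
  have sb: "summable (\<lambda>n. norm (?b (Suc n)))"
    unfolding norm_mangoldt_term by (rule summable_mangoldt[OF s])
  have a: "(?a has_sum zeta_series s) ?N"
    using norm_summable_imp_has_sum[OF sa zeta_series_sums[OF s]]
    by (rule has_sum_Suc_iff[of ?a, THEN iffD1])
  have "(\<lambda>n. ?b (Suc n)) sums mangoldt_series s"
    unfolding mangoldt_series_def by (rule summable_sums[OF summable_norm_cancel[OF sb]])
  from norm_summable_imp_has_sum[OF sb this]
  show b: "(?b has_sum mangoldt_series s) ?N" by (rule has_sum_Suc_iff[of ?b, THEN iffD1])
  have na: "(\<lambda>n. norm (?a n)) summable_on ?N"
    by (rule norm_summable_Suc_imp_summable_on[of ?a, OF sa])
  have nb: "(\<lambda>n. norm (?b n)) summable_on ?N"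
    by (rule norm_summable_Suc_imp_summable_on[of ?b, OF sb])
  let ?P = "\<lambda>(d, m). ?b d * ?a m"
  have nP: "norm (?P (d, m)) = norm (?b d) * norm (?a m)" for d m by (simp only: prod.case norm_mult)
  have "(\<lambda>x. norm (?P x)) summable_on (?N \<times> ?N)"
    unfolding Infinite_Sum.abs_summable_on_Sigma_iff
  proof (intro conjI ballI)
    fix d :: nat
    show "(\<lambda>m. norm (?P (d, m))) summable_on ?N"
      using summable_on_cmult_right[OF na, of "norm (?b d)"] by (simp only: nP)
    have "(\<lambda>d. norm (?b d) * infsum (\<lambda>m. norm (?a m)) ?N) summable_on ?N"
      by (rule summable_on_cmult_left[OF nb])
    then show "(\<lambda>d. norm (infsum (\<lambda>m. norm (?P (d, m))) ?N)) summable_on ?N"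
      by (simp only: nP infsum_cmult_right' real_norm_def abs_mult abs_norm_cancel abs_of_nonneg infsum_nonneg norm_ge_zero)
  qed
  then have "?P summable_on (?N \<times> ?N)" by (rule abs_summable_summable)
  then have P: "(?P has_sum mangoldt_series s * zeta_series s) (?N \<times> ?N)"
  proof (rule has_sum_SigmaI[rotated 2])
    show "((\<lambda>m. ?P (d, m)) has_sum ?b d * zeta_series s) ?N" for d
      using has_sum_cmult_right[OF a, of "?b d"] by simp
    show "((\<lambda>d. ?b d * zeta_series s) has_sum mangoldt_series s * zeta_series s) ?N"
      by (rule has_sum_cmult_left[OF b])
  qed
  have "((\<lambda>(n, d). mangoldt d * ?a n) has_sum mangoldt_series s * zeta_series s) (Sigma ?N (\<lambda>n. {d. d dvd n}))
     \<longleftrightarrow> (?P has_sum mangoldt_series s * zeta_series s) (?N \<times> ?N)"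
  proof (rule has_sum_reindex_bij_witness[of _ "\<lambda>(d, m). (d * m, d)" "\<lambda>(n, d). (d, n div d)"])
    fix x :: "nat \<times> nat" assume x: "x \<in> Sigma ?N (\<lambda>n. {d. d dvd n})"
    obtain n d where nd: "x = (n, d)" by (cases x) auto
    obtain m where m: "n = d * m" using x nd by auto
    have "d > 0" "m > 0" using x nd m by auto
    moreover have "of_nat (d * m) powr s = of_nat d powr s * (of_nat m :: complex) powr s"
      using powr_times_real[of "of_nat d" "of_nat m" s] by simp
    ultimately show "?P (case x of (n, d) \<Rightarrow> (d, n div d)) = (\<lambda>(n, d). mangoldt d * ?a n) x"
      using nd m by simp
  qed (auto elim!: dvdE)
  with P have "((\<lambda>(n, d). mangoldt d * ?a n) has_sum mangoldt_series s * zeta_series s)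
      (Sigma ?N (\<lambda>n. {d. d dvd n}))" by simp
  then have "((\<lambda>n. \<Sum>d | d dvd n. mangoldt d * ?a n) has_sum mangoldt_series s * zeta_series s) ?N"
    by (rule has_sum_SigmaD) (auto intro!: has_sum_finite)
  then have "((\<lambda>n. of_real (ln (real n)) * ?a n) has_sum mangoldt_series s * zeta_series s) ?N"
  proof (rule has_sum_cong[THEN iffD1, rotated])
    fix n :: nat assume "n \<in> ?N"
    then show "(\<Sum>d | d dvd n. mangoldt d * ?a n) = of_real (ln (real n)) * ?a n"
      by (simp only: sum_distrib_right[symmetric] mangoldt_sum greaterThan_iff neq0_conv)
  qed
  then have "(\<lambda>n. of_real (ln (real (Suc n))) * ?a (Suc n)) sums (mangoldt_series s * zeta_series s)"
    by (intro has_sum_imp_sums) (simp only: has_sum_Suc_iff[of "\<lambda>n. of_real (ln (real n)) * ?a n"])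
  from sums_minus[OF this] zeta_series_deriv_sums[OF s]
  show "deriv zeta_series s = - mangoldt_series s * zeta_series s"
    using sums_unique2 by (force simp: mult.commute)
qed

text \<open>
  The equation \<open>\<zeta>' = - mangoldt_series * \<zeta>\<close> is a linear differential equation on a half-plane, so
  a single zero would force \<open>\<zeta>\<close>, and with it \<open>F\<close>, to vanish identically.
\<close>

lemma zeta_series_nonzero:
  assumes F: "F holomorphic_on UNIV" "F 1 = 1" "\<And>s. Re s > 1 \<Longrightarrow> F s = (s - 1) * zeta_series s"
    and s: "Re s > 1"
  shows "zeta_series s \<noteq> 0"
proof
  assume z: "zeta_series s = 0"
  let ?S = "{s. Re s > 1}"
  have S: "convex ?S" "open ?S" by (auto intro: convex_halfspace_Re_gt open_halfspace_Re_gt)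
  \<comment> \<open>\<open>exp P\<close> is an integrating factor.\<close>
  obtain P where P: "\<And>x. x \<in> ?S \<Longrightarrow> (P has_field_derivative mangoldt_series x) (at x)"
    using holomorphic_convex_primitive'[OF S mangoldt_series_holomorphic]
    by (metis S(2) at_within_open)
  have "((\<lambda>x. zeta_series x * exp (P x)) has_field_derivative 0) (at x within ?S)" if x: "x \<in> ?S" for x
  proof -
    have "(zeta_series has_field_derivative - mangoldt_series x * zeta_series x) (at x)"
      using holomorphic_derivI[OF zeta_series_holomorphic S(2) x] deriv_zeta_series[of x] x by simp
    from DERIV_mult[OF this DERIV_fun_exp[OF P[OF x]]]
    have "((\<lambda>x. zeta_series x * exp (P x)) has_field_derivative 0) (at x)" by (rule DERIV_cong) simp
    then show ?thesis by (rule has_field_derivative_at_within)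
  qed
  from has_field_derivative_zero_constant[OF S(1) this]
  obtain c where c: "\<And>x. x \<in> ?S \<Longrightarrow> zeta_series x * exp (P x) = c" by blast
  have "c = 0" using c[of s] z s by simp
  then have z0: "zeta_series x = 0" if "Re x > 1" for x using c[of x] that by simp
  have "F 1 = (\<lambda>_. 0) (1 :: complex)"
  proof (rule analytic_continuation_open[where s = ?S and s' = UNIV and f = F])
    show "?S \<noteq> {}" using s by blast
    show "F z = (\<lambda>_. 0) z" if "z \<in> ?S" for z using F(3)[of z] z0[of z] that by simp
  qed (use F S in auto)
  with F(2) show False by simp
qed

lemma log_deriv_zeta_prime_powers:
  assumes F: "F holomorphic_on UNIV" "F 1 = 1" "\<And>s. Re s > 1 \<Longrightarrow> F s = (s - 1) * zeta_series s"
    and s: "Re s > 1"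
  shows "((\<lambda>(p, k). of_real (ln (real p)) * exp (- s * of_real (real k * ln (real p)))) has_sum
     - (deriv zeta_series s / zeta_series s)) ({p. prime p} \<times> {k::nat. k \<ge> 1})"
proof -
  let ?b = "\<lambda>n. mangoldt n * (1 / of_nat n powr s) :: complex"
  have L: "mangoldt_series s = - (deriv zeta_series s / zeta_series s)"
    using deriv_zeta_series[OF s] zeta_series_nonzero[OF F s] by simp
  have "(?b has_sum - (deriv zeta_series s / zeta_series s)) (Collect primepow)"
    using mangoldt_series_has_sum[OF s] unfolding L
    by (rule has_sum_cong_neutral[THEN iffD1, rotated -1])
       (auto simp: mangoldt_def primepow_gt_0_nat)
  moreover have bij: "bij_betw (\<lambda>(p, k). p ^ k :: nat) ({p. prime p} \<times> {k. k \<ge> 1}) (Collect primepow)"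
  proof -
    have "bij_betw (\<lambda>(p, k). (p, k - 1)) ({p::nat. prime p} \<times> {k::nat. k \<ge> 1}) (Collect prime \<times> UNIV)"
      by (rule bij_betwI[of _ _ _ "\<lambda>(p, k). (p, Suc k)"]) auto
    from bij_betw_trans[OF this bij_betw_primepows]
    show ?thesis by (rule bij_betw_cong[THEN iffD1, rotated]) (auto simp del: power_Suc)
  qed
  ultimately have "((\<lambda>x. ?b (case x of (p, k) \<Rightarrow> p ^ k)) has_sum
     - (deriv zeta_series s / zeta_series s)) ({p. prime p} \<times> {k. k \<ge> 1})"
    by (subst has_sum_reindex_bij_betw[OF bij, of ?b])
  then show ?thesis
  proof (rule has_sum_cong[THEN iffD1, rotated])
    fix x :: "nat \<times> nat" assume x: "x \<in> {p. prime p} \<times> {k. k \<ge> 1}"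
    obtain p k where pk: "x = (p, k)" "prime p" "k \<ge> 1" using x by auto
    then have p: "p > 0" using prime_gt_0_nat by auto
    then have "Ln (of_nat (p ^ k)) = complex_of_real (real k * ln (real p))"
      using Ln_of_real[of "real (p ^ k)"] by (simp add: ln_realpow)
    then show "?b (case x of (p, k) \<Rightarrow> p ^ k) =
      (case x of (p, k) \<Rightarrow> of_real (ln (real p)) * exp (- s * of_real (real k * ln (real p))))"
      using pk p by (simp add: powr_def exp_minus divide_inverse)
  qed
qed

section \<open>Laplace transforms\<close>

lemma dominated_by_exp_integrable:
  fixes g :: "real \<Rightarrow> complex"
  assumes "continuous_on {a..} g" "c > 0" "\<And>t. t \<ge> a \<Longrightarrow> norm (g t) \<le> C * exp (- c * t)"
  shows "g integrable_on {a..}" "norm (integral {a..} g) \<le> C * (exp (- c * a) / c)"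
proof -
  have h: "((\<lambda>t. C * exp (- c * t)) has_integral C * (exp (- c * a) / c)) {a..}"
    using assms(2) by (intro has_integral_mult_right has_integral_exp_minus_to_infinity)
  show g: "g integrable_on {a..}"
  proof (rule measurable_bounded_by_integrable_imp_integrable)
    show "g \<in> borel_measurable (lebesgue_on {a..})"
      using assms(1) by (rule continuous_imp_measurable_on_sets_lebesgue) auto
    show "(\<lambda>t. C * exp (- c * t)) integrable_on {a..}" using h by blast
  qed (use assms(3) in auto)
  have "norm (integral {a..} g) \<le> integral {a..} (\<lambda>t. C * exp (- c * t))"
    by (rule integral_norm_bound_integral[OF g]) (use h assms(3) in auto)
  then show "norm (integral {a..} g) \<le> C * (exp (- c * a) / c)"
    by (simp only: integral_unique[OF h])
qed

lemma integral_to_infinity_FTC: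
  fixes \<phi> \<Phi> :: "real \<Rightarrow> complex"
  assumes cont: "continuous_on {a..} \<phi>" and c: "c > 0" "\<And>t. t \<ge> a \<Longrightarrow> norm (\<phi> t) \<le> C * exp (- c * t)"
    and deriv: "\<And>t. t \<ge> a \<Longrightarrow> (\<Phi> has_vector_derivative \<phi> t) (at t)"
    and lim: "(\<Phi> \<longlongrightarrow> L) at_top"
  shows "(\<phi> has_integral (L - \<Phi> a)) {a..}"
proof (rule has_integral_dominated_convergence)
  let ?f = "\<lambda>N t. if t \<in> {a..a + real N} then \<phi> t else 0"
  show "(?f N has_integral (\<Phi> (a + real N) - \<Phi> a)) {a..}" for N
  proof -
    have "(\<phi> has_integral (\<Phi> (a + real N) - \<Phi> a)) {a..a + real N}"
      by (rule fundamental_theorem_of_calculus)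
         (auto intro: has_vector_derivative_at_within deriv)
    then show ?thesis by (subst has_integral_restrict) auto
  qed
  show "(\<lambda>t. C * exp (- c * t)) integrable_on {a..}"
    using has_integral_mult_right[OF has_integral_exp_minus_to_infinity[OF c(1)]] by blast
  show "\<forall>t\<in>{a..}. norm (?f N t) \<le> C * exp (- c * t)" for N
    using c(2) order_trans[OF norm_ge_zero c(2)] by auto
  show "\<forall>t\<in>{a..}. (\<lambda>N. ?f N t) \<longlonglongrightarrow> \<phi> t"
  proof
    fix t assume t: "t \<in> {a..}"
    have "eventually (\<lambda>N. ?f N t = \<phi> t) sequentially"
      using eventually_ge_at_top[of "nat \<lceil>t - a\<rceil>"]
    proof eventually_elim
      case (elim N)
      then have "t \<le> a + real N" by linarith
      then show ?case using t by simp
    qed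
    then show "(\<lambda>N. ?f N t) \<longlonglongrightarrow> \<phi> t" by (rule tendsto_eventually)
  qed
  have "filterlim (\<lambda>N. a + real N) at_top sequentially"
    by (intro filterlim_tendsto_add_at_top[OF tendsto_const] filterlim_real_sequentially)
  from filterlim_compose[OF lim this]
  show "(\<lambda>N. \<Phi> (a + real N) - \<Phi> a) \<longlonglongrightarrow> L - \<Phi> a" by (intro tendsto_intros)
qed

lemma laplace_exp:
  assumes "Re z < s"
  shows "((\<lambda>t. exp (z * of_real t) * of_real (exp (- s * t))) has_integral 1 / (of_real s - z)) {0..}"
proof -
  let ?w = "z - of_real s"
  have w: "?w \<noteq> 0" using assms by auto
  have eq: "exp (z * of_real t) * of_real (exp (- s * t)) = exp (?w * of_real t)" for t
    by (simp add: algebra_simps exp_of_real[symmetric] flip: exp_add)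
  have n: "norm (exp (?w * of_real t)) = exp (- (s - Re z) * t)" for t
    by (simp add: norm_exp_eq_Re algebra_simps)
  have "((\<lambda>t. exp (?w * of_real t)) has_integral (0 - exp (?w * of_real 0) / ?w)) {0..}"
  proof (rule integral_to_infinity_FTC[where c = "s - Re z" and C = 1])
    show "continuous_on {0..} (\<lambda>t. exp (?w * of_real t))" by (intro continuous_intros)
    show "((\<lambda>t. exp (?w * of_real t) / ?w) has_vector_derivative exp (?w * of_real t)) (at t)" for t
    proof -
      have "((\<lambda>x. exp (?w * x) / ?w) has_field_derivative exp (?w * of_real t)) (at (of_real t))"
        using w by (auto intro!: derivative_eq_intros)
      from has_vector_derivative_real_field[OF this] show ?thesis by simp
    qed
    have "((\<lambda>t. exp (- (s - Re z) * t)) \<longlongrightarrow> 0) at_top" using assms by real_asymp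
    then have "((\<lambda>t. exp (?w * of_real t)) \<longlongrightarrow> 0) at_top"
      unfolding n[symmetric] by (rule tendsto_norm_zero_cancel)
    from tendsto_divide[OF this tendsto_const w]
    show "((\<lambda>t. exp (?w * of_real t) / ?w) \<longlongrightarrow> 0) at_top" by simp
  qed (use assms n in auto)
  moreover have "0 - exp (?w * of_real 0) / ?w = 1 / (of_real s - z)"
    using minus_divide_right[of 1 ?w] by simp
  ultimately show ?thesis unfolding eq by (simp only:)
qed

lemma laplace_hinge:
  assumes a: "a \<ge> 0" and s: "s > 0"
  shows "((\<lambda>t. complex_of_real (max 0 (t - a)) * of_real (exp (- s * t))) has_integral
     of_real (exp (- s * a) / s\<^sup>2)) {0..}"
proof (rule has_integral_on_superset)
  let ?\<Phi> = "\<lambda>t. complex_of_real (- ((t - a) / s + 1 / s\<^sup>2) * exp (- s * t))"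
  have b: "t - a \<le> 2 / s * exp (s / 2 * t)" if "t \<ge> a" for t
  proof -
    have "s / 2 * t \<le> exp (s / 2 * t)" using exp_ge_add_one_self[of "s / 2 * t"] by linarith
    then have "t \<le> 2 / s * exp (s / 2 * t)" using s by (simp add: field_simps)
    then show ?thesis using a by simp
  qed
  have "((\<lambda>t. complex_of_real (max 0 (t - a)) * of_real (exp (- s * t))) has_integral (0 - ?\<Phi> a)) {a..}"
  proof (rule integral_to_infinity_FTC[where \<Phi> = ?\<Phi> and c = "s / 2" and C = "2 / s"])
    fix t assume t: "t \<ge> a"
    have "(t - a) * exp (- s * t) \<le> 2 / s * exp (s / 2 * t) * exp (- s * t)"
      using b[OF t] by (rule mult_right_mono) simp
    also have "\<dots> = 2 / s * exp (- (s / 2) * t)" by (simp add: field_simps flip: exp_add)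
    finally show "norm (complex_of_real (max 0 (t - a)) * of_real (exp (- s * t))) \<le> 2 / s * exp (- (s / 2) * t)"
      using t unfolding norm_mult norm_of_real by simp
    have "((\<lambda>t. - ((t - a) / s + 1 / s\<^sup>2) * exp (- s * t)) has_real_derivative max 0 (t - a) * exp (- s * t)) (at t)"
      using s t by (auto intro!: derivative_eq_intros simp: field_simps power2_eq_square)
    from has_vector_derivative_of_real[OF this]
    show "(?\<Phi> has_vector_derivative complex_of_real (max 0 (t - a)) * of_real (exp (- s * t))) (at t)"
      by (simp only: of_real_mult)
  next
    have "((\<lambda>t. - ((t - a) / s + 1 / s\<^sup>2) * exp (- s * t)) \<longlongrightarrow> 0) at_top" using s by real_asymp
    from tendsto_of_real[OF this] show "(?\<Phi> \<longlongrightarrow> 0) at_top" by (simp only: of_real_0)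
  qed (use s in \<open>auto intro!: continuous_intros\<close>)
  then show "((\<lambda>t. complex_of_real (max 0 (t - a)) * of_real (exp (- s * t))) has_integral
     of_real (exp (- s * a) / s\<^sup>2)) {a..}" by simp
qed (use a in auto)

text \<open>
  In the variable \<open>x = exp (- t)\<close> the function \<open>f t * exp (- 3 * t)\<close> extends continuously to
  \<open>[0, 1]\<close>, and the hypothesis says that \<open>f t * exp (- 4 * t)\<close> is orthogonal to all polynomials
  in \<open>x\<close>. Approximating the former by polynomials shows that the integral of their product
  \<open>(f t)\<^sup>2 * exp (- 7 * t)\<close> is \<open>0\<close>.
\<close>

lemma laplace_unique_real:
  fixes f :: "real \<Rightarrow> real"
  assumes cont: "continuous_on {0..} f" and bound: "\<And>t. t \<ge> 0 \<Longrightarrow> \<bar>f t\<bar> \<le> C * exp (2 * t)"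
    and zero: "\<And>k::nat. k \<ge> 3 \<Longrightarrow> ((\<lambda>t. f t * exp (- real k * t)) has_integral 0) {0..}"
    and t0: "t0 \<ge> 0"
  shows "f t0 = 0"
proof -
  have C: "C \<ge> 0" using order_trans[OF abs_ge_zero bound[of 0]] by simp
  define u where "u = (\<lambda>x. if x = 0 then 0 else f (- ln x) * x ^ 3)"
  have u_exp: "u (exp (- t)) = f t * exp (- 3 * t)" for t
    by (simp add: u_def flip: exp_of_nat_mult)
  have u_bound: "\<bar>u x\<bar> \<le> C * x" if "0 \<le> x" "x \<le> 1" for x
  proof (cases "x = 0")
    case False
    then have x: "x > 0" using that by simp
    have "\<bar>u x\<bar> = \<bar>f (- ln x)\<bar> * x ^ 3" using x by (simp add: u_def abs_mult)
    also have "\<dots> \<le> C * exp (2 * (- ln x)) * x ^ 3"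
      using x that by (intro mult_right_mono bound) auto
    also have "exp (2 * (- ln x)) = 1 / x ^ 2"
      using x exp_of_nat_mult[of 2 "- ln x"] by (simp add: exp_minus field_simps)
    also have "C * (1 / x ^ 2) * x ^ 3 = C * x" using x by (simp add: power2_eq_square power3_eq_cube)
    finally show ?thesis .
  qed (simp add: u_def)
  have u_cont: "continuous_on {0..1} u"
    unfolding continuous_on_eq_continuous_within
  proof
    fix x :: real assume x: "x \<in> {0..1}"
    show "continuous (at x within {0..1}) u"
    proof (cases "x = 0")
      case True
      have "((\<lambda>x. C * x) \<longlongrightarrow> C * 0) (at 0 within {0..1})" by (intro tendsto_intros)
      then have "(u \<longlongrightarrow> 0) (at 0 within {0..1})"
        by (intro Lim_null_comparison[of u "\<lambda>x. C * x"])
           (auto simp: eventually_at_filter u_bound)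
      then show ?thesis by (simp add: True continuous_within u_def)
    next
      case False
      have "continuous_on {0<..1} (\<lambda>x. f (- ln x) * x ^ 3)"
        by (intro continuous_intros continuous_on_compose2[OF cont]) auto
      then have "continuous_on {0<..1} u"
        by (rule continuous_on_eq) (auto simp: u_def)
      then have "continuous (at x within {0<..1}) u"
        using x False by (simp add: continuous_on_eq_continuous_within)
      moreover have "at x within {0<..1} = at x within {0..1}"
        using False x by (intro at_within_nhd[of _ "{0<..}"]) auto
      ultimately show ?thesis by simp
    qed
  qed
  have expb: "exp (- real k * t) \<le> exp (- 3 * t)" if "k \<ge> 3" "t \<ge> 0" for k t
    using that by (simp add: mult_right_mono)
  \<comment> \<open>The first factor absorbs the growth of \<open>f\<close>, the second is the one that is approximated.\<close>
  let ?g = "\<lambda>t. f t * exp (- 4 * t) * (f t * exp (- 3 * t))"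
  have gi: "?g integrable_on {0..}" and gle: "\<And>e. e > 0 \<Longrightarrow> integral {0..} ?g \<le> C * e"
  proof -
    have ffb: "\<bar>f t * exp (- 4 * t)\<bar> \<le> C * exp (- 2 * t)" if "t \<ge> 0" for t
    proof -
      have "\<bar>f t\<bar> * exp (- 4 * t) \<le> C * exp (2 * t) * exp (- 4 * t)"
        using bound[OF that] by (rule mult_right_mono) simp
      also have "\<dots> = C * exp (- 2 * t)" by (simp flip: exp_add)
      finally show ?thesis by (simp add: abs_mult)
    qed
    show gi: "?g integrable_on {0..}"
    proof (rule measurable_bounded_by_integrable_imp_integrable)
      have "continuous_on {0..} ?g" by (intro continuous_intros cont)
      then show "?g \<in> borel_measurable (lebesgue_on {0..})"
        by (rule continuous_imp_measurable_on_sets_lebesgue) auto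
      have "((\<lambda>t. C * C * exp (- 2 * t)) has_integral C * C * (exp (- 2 * 0) / 2)) {0..}"
        by (intro has_integral_mult_right has_integral_exp_minus_to_infinity) auto
      then show "(\<lambda>t. C * C * exp (- 2 * t)) integrable_on {0..}" by blast
      fix t :: real assume t: "t \<in> {0..}"
      have "\<bar>f t * exp (- 3 * t)\<bar> \<le> C"
      proof -
        have "\<bar>u (exp (- t))\<bar> \<le> C * exp (- t)" using t by (intro u_bound) auto
        also have "\<dots> \<le> C * 1" using C t by (intro mult_left_mono) auto
        finally show ?thesis unfolding u_exp by simp
      qed
      then have "\<bar>f t * exp (- 4 * t)\<bar> * \<bar>f t * exp (- 3 * t)\<bar> \<le> C * exp (- 2 * t) * C"
        using ffb[of t] t C by (intro mult_mono) auto
      then show "norm (?g t) \<le> C * C * exp (- 2 * t)" by (simp add: abs_mult mult_ac)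
    qed auto
    fix e :: real assume e: "e > 0"
    obtain p where "real_polynomial_function p" and p: "\<And>x. x \<in> {0..1} \<Longrightarrow> \<bar>u x - p x\<bar> < e"
      using Stone_Weierstrass_real_polynomial_function[OF compact_Icc u_cont e] by auto
    then obtain c n where pe: "p = (\<lambda>x. \<Sum>i\<le>n. c i * x ^ i)"
      unfolding real_polynomial_function_iff_sum by blast
    have pz: "((\<lambda>t. f t * exp (- 4 * t) * p (exp (- t))) has_integral 0) {0..}"
    proof -
      have "((\<lambda>t. \<Sum>i\<le>n. c i * (f t * exp (- real (4 + i) * t))) has_integral (\<Sum>i\<le>n. c i * 0)) {0..}"
        by (intro has_integral_sum has_integral_mult_right zero) auto
      moreover have "(\<Sum>i\<le>n. c i * (f t * exp (- real (4 + i) * t))) = f t * exp (- 4 * t) * p (exp (- t))" for t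
      proof -
        have "exp (- real (4 + i) * t) = exp (- 4 * t) * exp (- t) ^ i" for i
          by (simp add: algebra_simps flip: exp_of_nat_mult exp_add)
        then show ?thesis by (simp add: pe sum_distrib_left mult_ac)
      qed
      ultimately show ?thesis by simp
    qed
    have d: "((\<lambda>t. ?g t - f t * exp (- 4 * t) * p (exp (- t))) has_integral integral {0..} ?g - 0) {0..}"
      by (rule has_integral_diff[OF integrable_integral[OF gi] pz])
    have h: "((\<lambda>t. C * e * exp (- 2 * t)) has_integral C * e * (exp (- 2 * 0) / 2)) {0..}"
      by (intro has_integral_mult_right has_integral_exp_minus_to_infinity) auto
    have "integral {0..} ?g - 0 \<le> C * e * (exp (- 2 * 0) / 2)"
    proof (rule has_integral_le[OF d h])
      fix t :: real assume t: "t \<in> {0..}"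
      have "?g t - f t * exp (- 4 * t) * p (exp (- t)) = f t * exp (- 4 * t) * (u (exp (- t)) - p (exp (- t)))"
        unfolding u_exp by (simp add: algebra_simps)
      also have "\<dots> \<le> \<bar>f t * exp (- 4 * t)\<bar> * \<bar>u (exp (- t)) - p (exp (- t))\<bar>"
        by (metis abs_ge_self abs_mult)
      also have "\<dots> \<le> C * exp (- 2 * t) * e"
        using t C by (intro mult_mono ffb less_imp_le[OF p]) auto
      finally show "?g t - f t * exp (- 4 * t) * p (exp (- t)) \<le> C * e * exp (- 2 * t)" by (simp add: mult_ac)
    qed
    also have "\<dots> \<le> C * e" using C e by simp
    finally show "integral {0..} ?g \<le> C * e" by simp
  qed
  have gpos: "?g t \<ge> 0" for t
  proof -
    have "0 \<le> (f t * f t) * (exp (- 4 * t) * exp (- 3 * t))" by (rule mult_nonneg_nonneg[OF zero_le_square]) simp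
    then show ?thesis by (simp only: mult_ac)
  qed
  have "integral {0..} ?g \<le> 0"
  proof (rule ccontr)
    assume "\<not> integral {0..} ?g \<le> 0"
    then have pos: "integral {0..} ?g > 0" by simp
    have "integral {0..} ?g \<le> C * (integral {0..} ?g / (2 * (C + 1)))"
      using pos C by (intro gle) simp
    also have "\<dots> < integral {0..} ?g"
    proof -
      have "C / (2 * (C + 1)) < 1" using C by simp
      from mult_strict_right_mono[OF this pos] show ?thesis by simp
    qed
    finally show False by simp
  qed
  have gc: "continuous_on {0..t0 + 1} ?g"
    by (intro continuous_intros continuous_on_subset[OF cont]) auto
  have "integral {0..t0 + 1} ?g \<le> integral {0..} ?g"
    using gpos by (intro integral_subset_le gi integrable_continuous_interval[OF gc]) auto
  moreover have "integral {0..t0 + 1} ?g \<ge> 0"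
    using gpos by (intro integral_nonneg integrable_continuous_interval[OF gc]) auto
  ultimately have "integral {0..t0 + 1} ?g = 0" using \<open>integral {0..} ?g \<le> 0\<close> by linarith
  then have "(?g has_integral 0) (cbox 0 (t0 + 1))"
    using integrable_integral[OF integrable_continuous_interval[OF gc]] by simp
  then have "?g t0 = 0"
    by (rule has_integral_0_cbox_imp_0[rotated 2]) (use gc gpos t0 in auto)
  then show ?thesis by simp
qed

lemma laplace_unique:
  fixes f :: "real \<Rightarrow> complex"
  assumes cont: "continuous_on {0..} f" and bound: "\<And>t. t \<ge> 0 \<Longrightarrow> norm (f t) \<le> C * exp (2 * t)"
    and zero: "\<And>k::nat. k \<ge> 3 \<Longrightarrow> ((\<lambda>t. f t * of_real (exp (- real k * t))) has_integral 0) {0..}"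
    and t0: "t0 \<ge> 0"
  shows "f t0 = 0"
proof -
  have "Re (f t0) = 0"
  proof (rule laplace_unique_real[OF _ _ _ t0])
    show "\<bar>Re (f t)\<bar> \<le> C * exp (2 * t)" if "t \<ge> 0" for t
      using abs_Re_le_cmod[of "f t"] bound[OF that] by simp
    show "((\<lambda>t. Re (f t) * exp (- real k * t)) has_integral 0) {0..}" if "k \<ge> 3" for k
      using has_integral_linear[OF zero[OF that] bounded_linear_Re] by (simp add: o_def)
  qed (intro continuous_intros cont)
  moreover have "Im (f t0) = 0"
  proof (rule laplace_unique_real[OF _ _ _ t0])
    show "\<bar>Im (f t)\<bar> \<le> C * exp (2 * t)" if "t \<ge> 0" for t
      using abs_Im_le_cmod[of "f t"] bound[OF that] by simp
    show "((\<lambda>t. Im (f t) * exp (- real k * t)) has_integral 0) {0..}" if "k \<ge> 3" for k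
      using has_integral_linear[OF zero[OF that] bounded_linear_Im] by (simp add: o_def)
  qed (intro continuous_intros cont)
  ultimately show ?thesis by (simp add: complex_eq_iff)
qed

text \<open>
  Outside a finite set \<open>F\<close> of indices the family contributes at most
  \<open>(infsum a I - sum a F) * exp (2 * t)\<close>. Multiplied by \<open>exp (- 2 * t)\<close> this is uniform in \<open>t\<close>,
  which gives continuity; integrated against \<open>exp (- s * t)\<close> it tends to \<open>0\<close>, which gives the
  exchange of sum and integral.
\<close>

lemma dominated_family_laplace:
  fixes q :: "'i \<Rightarrow> real \<Rightarrow> complex" and a :: "'i \<Rightarrow> real"
  assumes cont: "\<And>i. i \<in> I \<Longrightarrow> continuous_on {0..} (q i)"
    and bound: "\<And>i t. i \<in> I \<Longrightarrow> t \<ge> 0 \<Longrightarrow> norm (q i t) \<le> a i * exp (2 * t)"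
    and a: "a summable_on I"
  defines "Q \<equiv> \<lambda>t. infsum (\<lambda>i. q i t) I"
  shows "continuous_on {0..} Q"
    and "t \<ge> 0 \<Longrightarrow> norm (Q t) \<le> infsum a I * exp (2 * t)"
    and "s \<ge> 3 \<Longrightarrow> (\<And>i. i \<in> I \<Longrightarrow> ((\<lambda>t. q i t * of_real (exp (- s * t))) has_integral L i) {0..}) \<Longrightarrow>
      (L has_sum L') I \<Longrightarrow> ((\<lambda>t. Q t * of_real (exp (- s * t))) has_integral L') {0..}"
proof -
  have nsum: "(\<lambda>i. norm (q i t)) summable_on J" if "t \<ge> 0" "J \<subseteq> I" for t J
  proof (rule summable_on_comparison_test)
    show "(\<lambda>i. a i * exp (2 * t)) summable_on J"
      by (rule summable_on_cmult_left[OF summable_on_subset_banach[OF a that(2)]])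
    show "norm (q i t) \<le> a i * exp (2 * t)" if "i \<in> J" for i
      using bound[of i t] \<open>i \<in> J\<close> \<open>t \<ge> 0\<close> \<open>J \<subseteq> I\<close> by auto
  qed simp
  have qsum: "(\<lambda>i. q i t) summable_on J" if "t \<ge> 0" "J \<subseteq> I" for t J
    by (rule abs_summable_summable[OF nsum[OF that]])
  have nb: "norm (infsum (\<lambda>i. q i t) J) \<le> infsum a J * exp (2 * t)" if t: "t \<ge> 0" and J: "J \<subseteq> I" for t J
  proof -
    have "norm (infsum (\<lambda>i. q i t) J) \<le> infsum (\<lambda>i. norm (q i t)) J"
      by (rule norm_infsum_bound[OF nsum[OF t J]])
    also have "\<dots> \<le> infsum (\<lambda>i. a i * exp (2 * t)) J"
      using bound t J by (intro infsum_mono nsum summable_on_cmult_left summable_on_subset_banach[OF a]) auto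
    also have "\<dots> = infsum a J * exp (2 * t)" by (rule infsum_cmult_left')
    finally show ?thesis .
  qed
  have tail: "norm (Q t - (\<Sum>i\<in>F. q i t)) \<le> (infsum a I - sum a F) * exp (2 * t)"
    if "t \<ge> 0" "finite F" "F \<subseteq> I" for t F
  proof -
    have "Q t - (\<Sum>i\<in>F. q i t) = infsum (\<lambda>i. q i t) (I - F)"
      unfolding Q_def using that by (subst infsum_Diff) (auto intro: qsum)
    moreover have "infsum a (I - F) = infsum a I - sum a F"
      using that a by (subst infsum_Diff) auto
    ultimately show ?thesis using nb[of t "I - F"] that by auto
  qed
  have aF: "(sum a \<longlongrightarrow> infsum a I) (finite_subsets_at_top I)"
    using has_sum_infsum[OF a] by (simp add: has_sum_def)
  have evI: "eventually (\<lambda>F. finite F \<and> F \<subseteq> I) (finite_subsets_at_top I)"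
    by (rule eventually_finite_subsets_at_top_weakI) auto
  have "uniform_limit {0..} (\<lambda>F t. (\<Sum>i\<in>F. q i t) * of_real (exp (- 2 * t)))
      (\<lambda>t. Q t * of_real (exp (- 2 * t))) (finite_subsets_at_top I)"
  proof (rule uniform_limitI)
    fix e :: real assume "e > 0"
    from tendstoD[OF aF this] evI
    show "eventually (\<lambda>F. \<forall>t\<in>{0..}. dist ((\<Sum>i\<in>F. q i t) * of_real (exp (- 2 * t))) (Q t * of_real (exp (- 2 * t))) < e)
       (finite_subsets_at_top I)"
    proof eventually_elim
      case (elim F)
      show ?case
      proof
        fix t :: real assume t: "t \<in> {0..}"
        have "dist ((\<Sum>i\<in>F. q i t) * of_real (exp (- 2 * t))) (Q t * of_real (exp (- 2 * t)))
           = norm (Q t - (\<Sum>i\<in>F. q i t)) * exp (- 2 * t)"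
          by (simp add: dist_norm norm_minus_commute norm_mult flip: left_diff_distrib)
        also have "\<dots> \<le> (infsum a I - sum a F) * exp (2 * t) * exp (- 2 * t)"
          using tail[of t F] elim t by (intro mult_right_mono) auto
        also have "\<dots> = infsum a I - sum a F" by (simp flip: exp_add)
        also have "\<dots> < e" using elim by (simp add: dist_real_def)
        finally show "dist ((\<Sum>i\<in>F. q i t) * of_real (exp (- 2 * t))) (Q t * of_real (exp (- 2 * t))) < e" .
      qed
    qed
  qed
  then have Qe: "continuous_on {0..} (\<lambda>t. Q t * of_real (exp (- 2 * t)))"
  proof (rule uniform_limit_theorem[rotated])
    show "eventually (\<lambda>F. continuous_on {0..} (\<lambda>t. (\<Sum>i\<in>F. q i t) * of_real (exp (- 2 * t)))) (finite_subsets_at_top I)"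
      using evI by eventually_elim (intro continuous_intros cont, auto)
  qed simp
  have "continuous_on {0..} (\<lambda>t. Q t * of_real (exp (- 2 * t)) * of_real (exp (2 * t)))"
    by (rule continuous_on_mult[OF Qe]) (intro continuous_intros)
  moreover have "Q t * of_real (exp (- 2 * t)) * of_real (exp (2 * t)) = Q t" for t
  proof -
    have "complex_of_real (exp (- 2 * t)) * of_real (exp (2 * t)) = 1"
      unfolding of_real_mult[symmetric] exp_add[symmetric] by simp
    then show ?thesis by (simp only: mult.assoc mult_1_right)
  qed
  ultimately show Qc: "continuous_on {0..} Q" by (simp only:)
  show Qb: "norm (Q t) \<le> infsum a I * exp (2 * t)" if "t \<ge> 0" for t
    unfolding Q_def using nb[OF that] by simp
  assume s: "s \<ge> 3" and L: "\<And>i. i \<in> I \<Longrightarrow> ((\<lambda>t. q i t * of_real (exp (- s * t))) has_integral L i) {0..}"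
    and L': "(L has_sum L') I"
  let ?E = "\<lambda>t. complex_of_real (exp (- s * t))"
  have ee: "exp (2 * t) * exp (- s * t) = exp (- (s - 2) * t)" for t
    by (simp add: algebra_simps flip: exp_add)
  have QE: "(\<lambda>t. Q t * ?E t) integrable_on {0..}"
  proof (rule dominated_by_exp_integrable(1)[where c = "s - 2" and C = "infsum a I"])
    show "continuous_on {0..} (\<lambda>t. Q t * ?E t)" by (intro continuous_intros Qc)
    show "norm (Q t * ?E t) \<le> infsum a I * exp (- (s - 2) * t)" if "t \<ge> 0" for t
      unfolding ee[symmetric] norm_mult norm_of_real mult.assoc[symmetric] abs_exp_cancel
      by (rule mult_right_mono[OF Qb[OF that]]) simp
  qed (use s in auto)
  have "(sum L \<longlongrightarrow> integral {0..} (\<lambda>t. Q t * ?E t)) (finite_subsets_at_top I)"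
  proof (rule Lim_transform[OF _ Lim_null_comparison])
    show "((\<lambda>F. infsum a I - sum a F) \<longlongrightarrow> 0) (finite_subsets_at_top I)"
      using tendsto_diff[OF tendsto_const aF, of "infsum a I"] by simp
    show "eventually (\<lambda>F. norm (sum L F - integral {0..} (\<lambda>t. Q t * ?E t)) \<le> infsum a I - sum a F)
       (finite_subsets_at_top I)"
      using evI
    proof eventually_elim
      case (elim F)
      have "((\<lambda>t. \<Sum>i\<in>F. q i t * ?E t) has_integral sum L F) {0..}"
        using elim by (intro has_integral_sum L) auto
      then have F: "((\<lambda>t. (\<Sum>i\<in>F. q i t) * ?E t) has_integral sum L F) {0..}"
        by (simp add: sum_distrib_right)
      have D: "((\<lambda>t. (Q t - (\<Sum>i\<in>F. q i t)) * ?E t) has_integral integral {0..} (\<lambda>t. Q t * ?E t) - sum L F) {0..}"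
        using has_integral_diff[OF integrable_integral[OF QE] F] by (simp add: algebra_simps)
      have "norm (integral {0..} (\<lambda>t. (Q t - (\<Sum>i\<in>F. q i t)) * ?E t))
         \<le> (infsum a I - sum a F) * (exp (- (s - 2) * 0) / (s - 2))"
      proof (rule dominated_by_exp_integrable(2))
        show "continuous_on {0..} (\<lambda>t. (Q t - (\<Sum>i\<in>F. q i t)) * ?E t)"
          using elim cont by (intro continuous_intros Qc) auto
        show "norm ((Q t - (\<Sum>i\<in>F. q i t)) * ?E t) \<le> (infsum a I - sum a F) * exp (- (s - 2) * t)" if "t \<ge> 0" for t
          unfolding ee[symmetric] norm_mult norm_of_real mult.assoc[symmetric] abs_exp_cancel
          using elim by (intro mult_right_mono tail[OF that]) auto
      qed (use s in auto)
      also have "\<dots> \<le> (infsum a I - sum a F) * 1"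
      proof (rule mult_left_mono)
        show "0 \<le> infsum a I - sum a F" using order_trans[OF norm_ge_zero tail[of 0 F]] elim by simp
      qed (use s in auto)
      finally show ?case unfolding integral_unique[OF D] by (simp add: norm_minus_commute)
    qed
  qed simp
  moreover have "(sum L \<longlongrightarrow> L') (finite_subsets_at_top I)" using L' by (simp add: has_sum_def)
  ultimately have "integral {0..} (\<lambda>t. Q t * ?E t) = L'"
    using tendsto_unique[OF finite_subsets_at_top_neq_bot] by blast
  with QE show "((\<lambda>t. Q t * ?E t) has_integral L') {0..}" using integrable_integral by fastforce
qed

section \<open>The sum over the divisor of the zeta function\<close>

definition prime_power_indices :: "(nat \<times> nat) set" where
  "prime_power_indices = {p. prime p} \<times> {k. k \<ge> 1}"

text \<open>
  The second primitive, vanishing for \<open>t < 0\<close>, of the sum of the point masses \<open>ln p\<close> at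
  \<open>k * ln p\<close>.
\<close>

definition hinge_sum :: "real \<Rightarrow> complex" where
  "hinge_sum t = (\<Sum>\<^sub>\<infinity>(p, k)\<in>prime_power_indices.
     of_real (ln (real p)) * of_real (max 0 (t - real k * ln (real p))))"

text \<open>
  Division by \<open>s - 1\<close> adds a simple pole at \<open>1\<close>, where \<open>F\<close> does not vanish, and changes no
  other order.
\<close>

lemma zeta_divisor:
  assumes F: "F holomorphic_on UNIV" "F 1 = 1" "\<And>s. riemann_zeta s = F s / (s - 1)" "F 0 \<noteq> 0"
  shows "zeros_poles riemann_zeta = insert 1 {\<rho>. F \<rho> = 0}"
    and "zorder riemann_zeta 1 = - 1"
    and "F \<rho> = 0 \<Longrightarrow> zorder riemann_zeta \<rho> = int (nat (zorder F \<rho>))"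
proof -
  have hol: "riemann_zeta holomorphic_on UNIV - {1}"
  proof -
    have "(\<lambda>s. F s / (s - 1)) holomorphic_on UNIV - {1}"
      by (intro holomorphic_intros holomorphic_on_subset[OF F(1)]) auto
    then show ?thesis by (simp add: F(3)[abs_def])
  qed
  have "\<not> is_pole riemann_zeta \<rho>" if "\<rho> \<noteq> 1" for \<rho>
    using hol that by (intro not_is_pole_holomorphic[of "UNIV - {1}"]) auto
  then show "zeros_poles riemann_zeta = insert 1 {\<rho>. F \<rho> = 0}"
    by (auto simp: zeros_poles_def F(3))
  show "zorder riemann_zeta 1 = - 1"
    by (rule zorder_eqI[OF open_UNIV UNIV_I F(1)]) (auto simp: F(2,3) power_int_minus divide_inverse)
  assume \<rho>: "F \<rho> = 0"
  then have "\<rho> \<noteq> 1" using F(2) by auto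
  obtain h m where h: "h holomorphic_on UNIV" "h \<rho> \<noteq> 0" "\<And>z. F z = (z - \<rho>) ^ m * h z"
    using divide_out_zero[OF F(1), of \<rho>] F(4) by blast
  have "zorder F \<rho> = int m"
    by (rule zorder_eqI[OF open_UNIV UNIV_I h(1,2)]) (simp add: h(3) power_int_of_nat)
  moreover have "zorder riemann_zeta \<rho> = int m"
  proof (rule zorder_eqI[where S = "UNIV - {1}" and g = "\<lambda>z. h z / (z - 1)"])
    show "(\<lambda>z. h z / (z - 1)) holomorphic_on UNIV - {1}"
      by (intro holomorphic_intros holomorphic_on_subset[OF h(1)]) auto
  qed (use h \<open>\<rho> \<noteq> 1\<close> in \<open>auto simp: F(3) power_int_of_nat\<close>)
  ultimately show "zorder riemann_zeta \<rho> = int (nat (zorder F \<rho>))" by simp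
qed

text \<open>
  The series for \<open>- \<zeta>' / \<zeta>\<close> at \<open>s = 2\<close>. Its terms are the majorants for the family in
  \<open>hinge_sum\<close> relative to \<open>exp (2 * t)\<close>.
\<close>

lemma summable_prime_powers:
  assumes F: "F holomorphic_on UNIV" "F 1 = 1" "\<And>s. Re s > 1 \<Longrightarrow> F s = (s - 1) * zeta_series s"
  shows "(\<lambda>(p, k). ln (real p) * exp (- 2 * (real k * ln (real p)))) summable_on prime_power_indices"
proof -
  have "(\<lambda>(p, k). complex_of_real (ln (real p)) * exp (- 2 * of_real (real k * ln (real p)))) summable_on prime_power_indices"
    using log_deriv_zeta_prime_powers[OF F, of 2]
    unfolding prime_power_indices_def summable_on_def by auto
  then have "(\<lambda>x. norm (case x of (p, k) \<Rightarrow> complex_of_real (ln (real p)) * exp (- 2 * of_real (real k * ln (real p)))))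
     summable_on prime_power_indices"
    by (rule summable_on_iff_abs_summable_on_complex[THEN iffD1])
  then show ?thesis
  proof (rule summable_on_cong[THEN iffD1, rotated])
    fix x assume "x \<in> prime_power_indices"
    then obtain p k where x: "x = (p, k)" "prime p" by (auto simp: prime_power_indices_def)
    then have "ln (real p) \<ge> 0" using prime_ge_1_nat[of p] by simp
    then show "norm (case x of (p, k) \<Rightarrow> complex_of_real (ln (real p)) * exp (- 2 * of_real (real k * ln (real p)))) =
       (case x of (p, k) \<Rightarrow> ln (real p) * exp (- 2 * (real k * ln (real p))))"
      by (simp add: x norm_mult norm_exp_eq_Re)
  qed
qed

text \<open>
  The partial fractions of \<open>F' / F\<close> together with the term of the pole evaluate \<open>G\<close>, and hence
  the discrepancy. Both sides of the formula for \<open>K2\<close> are sums of families dominated by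
  \<open>exp (2 * t)\<close>, so their Laplace transforms at integers \<open>s \<ge> 3\<close> are \<open>G s / s\<^sup>2\<close> and
  \<open>(c0 + \<zeta>' / \<zeta> (s)) / s\<^sup>2\<close>; these agree because the discrepancy is constant.
\<close>

lemma zeta_explicit_formula:
  shows c0_zeta: "c0 riemann_zeta = - of_real (ln (2 * pi))"
    and K2_zeta: "t \<ge> 0 \<Longrightarrow> K2 riemann_zeta t - K2 riemann_zeta 0 = c0 riemann_zeta * of_real t - hinge_sum t"
proof -
  obtain F :: "complex \<Rightarrow> complex" and C :: real where F: "F holomorphic_on UNIV" "F 1 = 1"
    "C > 0" "\<And>s. norm (F s) \<le> exp (C * (1 + norm s) powr (3 / 2))"
    "\<And>s. riemann_zeta s = F s / (s - 1)" "\<And>s. Re s > 1 \<Longrightarrow> riemann_zeta s = zeta_series s"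
    using zeta_characterisation by blast
  have Fz: "F s = (s - 1) * zeta_series s" if "Re s > 1" for s
  proof -
    have "s \<noteq> 1" using that by auto
    then show ?thesis unfolding F(6)[OF that, symmetric] F(5) by simp
  qed
  have F0: "F 0 \<noteq> 0" "deriv F 0 / F 0 = of_real (ln (2 * pi)) - 1"
    using zeta_log_deriv_at_0[OF F(1) Fz] by auto
  interpret E: entire_order_below_2 F C "3 / 2"
    by standard (use F F0 in auto)
  let ?Z = "{\<rho>. F \<rho> = 0}" and ?ZP = "insert 1 {\<rho>. F \<rho> = 0}"
  note div = zeta_divisor[OF F(1,2,5) F0(1)]
  have one: "1 \<notin> ?Z" using F(2) by simp
  have nz: "\<rho> \<noteq> 0" if "\<rho> \<in> ?ZP" for \<rho> using that F0(1) by auto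
  have Re1: "Re \<rho> \<le> 1" if "\<rho> \<in> ?ZP" for \<rho>
  proof (rule ccontr)
    assume "\<not> Re \<rho> \<le> 1"
    then have "Re \<rho> > 1" by simp
    moreover from this have "F \<rho> = 0" using that by auto
    ultimately have "zeta_series \<rho> = 0" using Fz[of \<rho>] by auto
    with zeta_series_nonzero[OF F(1,2) Fz \<open>Re \<rho> > 1\<close>] show False by simp
  qed
  have ord: "of_int (zorder riemann_zeta \<rho>) = complex_of_nat (E.zero_mult \<rho>)" if "\<rho> \<in> ?Z" for \<rho>
    using div(3)[of \<rho>] that by (simp add: E.zero_mult_def)
  have ld: "deriv riemann_zeta s / riemann_zeta s = deriv F s / F s - 1 / (s - 1)" if "F s \<noteq> 0" "s \<noteq> 1" for s
  proof -
    have "((\<lambda>s. F s / (s - 1)) has_field_derivative (deriv F s * (s - 1) - F s * (1 - 0)) / ((s - 1) * (s - 1))) (at s)"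
      using that by (intro DERIV_divide DERIV_diff DERIV_ident DERIV_const holomorphic_derivI[OF F(1)]) auto
    then have "deriv riemann_zeta s = (deriv F s * (s - 1) - F s) / ((s - 1) * (s - 1))"
      unfolding F(5)[abs_def] by (intro DERIV_imp_deriv) simp
    moreover have "(D * x - y) / (x * x) / (y / x) = D / y - 1 / x" if "x \<noteq> 0" "y \<noteq> 0" for D x y :: complex
      using that by (simp add: field_simps)
    ultimately show ?thesis using that by (simp add: F(5))
  qed
  let ?g = "\<lambda>s \<rho>. of_int (zorder riemann_zeta \<rho>) * (s / \<rho>) * (1 / (s - \<rho>))"
  have G_sum: "(?g s has_sum (deriv riemann_zeta s / riemann_zeta s - of_real (ln (2 * pi)))) ?ZP"
    if s: "s \<notin> ?ZP" for s
  proof -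
    have "((\<lambda>\<rho>. of_nat (E.zero_mult \<rho>) * (1 / (s - \<rho>) + 1 / \<rho>)) has_sum (deriv F s / F s - deriv F 0 / F 0)) ?Z"
      using s by (intro E.log_deriv_has_sum) auto
    then have "(?g s has_sum (deriv F s / F s - deriv F 0 / F 0)) ?Z"
    proof (rule has_sum_cong[THEN iffD1, rotated])
      fix \<rho> assume \<rho>: "\<rho> \<in> ?Z"
      have "\<rho> \<noteq> 0" using nz[of \<rho>] \<rho> by blast
      moreover have "s \<noteq> \<rho>" using s \<rho> by blast
      ultimately have "1 / (s - \<rho>) + 1 / \<rho> = s / \<rho> * (1 / (s - \<rho>))" by (simp add: field_simps)
      then show "of_nat (E.zero_mult \<rho>) * (1 / (s - \<rho>) + 1 / \<rho>) = ?g s \<rho>" by (simp add: ord[OF \<rho>])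
    qed
    from has_sum_insert[OF one this]
    have "(?g s has_sum (?g s 1 + (deriv F s / F s - deriv F 0 / F 0))) ?ZP" .
    also have "?g s 1 + (deriv F s / F s - deriv F 0 / F 0) = deriv riemann_zeta s / riemann_zeta s - of_real (ln (2 * pi))"
    proof -
      have s1: "F s \<noteq> 0" "s \<noteq> 1" using s by auto
      then have "s / (s - 1) = 1 + 1 / (s - 1)" by (simp add: field_simps)
      moreover have "?g s 1 = - (s / (s - 1))" by (simp add: div(2))
      ultimately have "?g s 1 = - 1 - 1 / (s - 1)" by simp
      then show ?thesis unfolding ld[OF s1] F0(2) by simp
    qed
    finally show ?thesis .
  qed
  have disc: "discrepancy riemann_zeta s = - of_real (ln (2 * pi))" if "s \<notin> zeros_poles riemann_zeta" for s
    using infsumI[OF G_sum, of s] that unfolding discrepancy_def G_def div(1) by simp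
  have "0 \<notin> zeros_poles riemann_zeta" using F0(1) unfolding div(1) by simp
  with disc show c0: "c0 riemann_zeta = - of_real (ln (2 * pi))"
    unfolding c0_def by (intro the_equality) force+

  define \<kappa> where "\<kappa> = (\<lambda>\<rho>. norm (of_int (zorder riemann_zeta \<rho>) / \<rho>\<^sup>2))"
  have \<kappa>: "\<kappa> summable_on ?ZP"
  proof -
    have "\<kappa> summable_on ?Z"
      using E.summable_inverse_squares
      by (rule summable_on_cong[THEN iffD1, rotated]) (simp only: \<kappa>_def ord norm_divide norm_power norm_of_nat)
    then show ?thesis by (simp add: summable_on_insert_iff)
  qed
  let ?e = "\<lambda>\<rho> t. of_int (zorder riemann_zeta \<rho>) / \<rho>\<^sup>2 * exp (\<rho> * of_real t)"
  have eb: "norm (?e \<rho> t) \<le> \<kappa> \<rho> * exp (2 * t)" if "\<rho> \<in> ?ZP" "t \<ge> 0" for \<rho> t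
  proof -
    have "Re \<rho> * t \<le> 1 * t" using Re1[OF that(1)] that(2) by (rule mult_right_mono)
    then have "norm (exp (\<rho> * of_real t)) \<le> exp (2 * t)" using that(2) by (simp add: norm_exp_eq_Re)
    then show ?thesis unfolding \<kappa>_def norm_mult by (intro mult_left_mono) auto
  qed
  \<comment> \<open>Subtracting the value at \<open>0\<close> in each term makes the transform of each term a multiple of \<open>1 / s\<^sup>2\<close>.\<close>
  define q where "q = (\<lambda>\<rho> t. of_int (zorder riemann_zeta \<rho>) / \<rho>\<^sup>2 * (exp (\<rho> * of_real t) - 1))"
  have es: "(\<lambda>\<rho>. ?e \<rho> t) summable_on ?ZP" if "t \<ge> 0" for t
    by (rule abs_summable_summable, rule summable_on_comparison_test[OF summable_on_cmult_left[OF \<kappa>, of "exp (2 * t)"]])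
       (use eb that in auto)
  have qc: "continuous_on {0..} (q \<rho>)" for \<rho> unfolding q_def by (intro continuous_intros)
  have qb: "norm (q \<rho> t) \<le> 2 * \<kappa> \<rho> * exp (2 * t)" if "\<rho> \<in> ?ZP" "t \<ge> 0" for \<rho> t
  proof -
    have "q \<rho> t = ?e \<rho> t - ?e \<rho> 0" by (simp add: q_def right_diff_distrib)
    then have "norm (q \<rho> t) \<le> norm (?e \<rho> t) + norm (?e \<rho> 0)" by (metis norm_triangle_ineq4)
    also have "\<dots> \<le> \<kappa> \<rho> * exp (2 * t) + \<kappa> \<rho> * exp (2 * 0)" using that by (intro add_mono eb) auto
    also have "\<dots> \<le> \<kappa> \<rho> * exp (2 * t) + \<kappa> \<rho> * exp (2 * t)"
      using that by (intro add_left_mono mult_left_mono) (auto simp: \<kappa>_def)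
    finally show ?thesis by simp
  qed
  have qs: "(\<lambda>\<rho>. q \<rho> t) summable_on ?ZP" if "t \<ge> 0" for t
    by (rule abs_summable_summable, rule summable_on_comparison_test[OF
        summable_on_cmult_left[OF summable_on_cmult_right[OF \<kappa>, of 2], of "exp (2 * t)"]])
       (use qb that in auto)
  have K2q: "K2 riemann_zeta t - K2 riemann_zeta 0 = infsum (\<lambda>\<rho>. q \<rho> t) ?ZP" if "t \<ge> 0" for t
  proof -
    have "infsum (\<lambda>\<rho>. q \<rho> t + ?e \<rho> 0) ?ZP = infsum (\<lambda>\<rho>. q \<rho> t) ?ZP + infsum (\<lambda>\<rho>. ?e \<rho> 0) ?ZP"
      using that by (intro infsum_add qs es) auto
    moreover have "q \<rho> t + ?e \<rho> 0 = ?e \<rho> t" for \<rho> by (simp add: q_def right_diff_distrib)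
    ultimately show ?thesis using that by (simp add: K2_def div(1))
  qed
  note famK = dominated_family_laplace[of ?ZP q "\<lambda>\<rho>. 2 * \<kappa> \<rho>", OF qc qb summable_on_cmult_right[OF \<kappa>]]
  let ?K = "\<lambda>t. infsum (\<lambda>\<rho>. q \<rho> t) ?ZP"

  define v where "v = (\<lambda>(p, k) t. complex_of_real (ln (real p)) * of_real (max 0 (t - real k * ln (real p))))"
  define b where "b = (\<lambda>(p::nat, k::nat). ln (real p) * exp (- 2 * (real k * ln (real p))))"
  have lnp: "ln (real p) \<ge> 0" if "(p, k) \<in> prime_power_indices" for p k
    using that prime_ge_1_nat[of p] by (auto simp: prime_power_indices_def)
  have vc: "continuous_on {0..} (v i)" for i
    unfolding v_def by (cases i) (auto intro!: continuous_intros)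
  have vb: "norm (v i t) \<le> b i * exp (2 * t)" if i: "i \<in> prime_power_indices" and t: "t \<ge> 0" for i t
  proof -
    obtain p k where pk: "i = (p, k)" by (cases i) auto
    let ?x = "t - real k * ln (real p)"
    have "max 0 ?x \<le> exp (2 * ?x)"
    proof (rule max.boundedI)
      show "?x \<le> exp (2 * ?x)"
      proof (cases "?x \<ge> 0")
        case True
        then have "?x \<le> 1 + 2 * ?x" by simp
        then show ?thesis using exp_ge_add_one_self by (rule order_trans)
      next
        case False
        then have "?x \<le> 0" by simp
        then show ?thesis using exp_ge_zero by (rule order_trans)
      qed
    qed simp
    then have "ln (real p) * max 0 ?x \<le> ln (real p) * exp (2 * ?x)"
      using lnp[of p k] i pk by (intro mult_left_mono) auto
    also have "exp (2 * ?x) = exp (- 2 * (real k * ln (real p))) * exp (2 * t)"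
      by (simp add: algebra_simps flip: exp_add)
    finally have "ln (real p) * max 0 ?x \<le> b i * exp (2 * t)" by (simp add: b_def pk)
    moreover have "norm (v i t) = ln (real p) * max 0 ?x"
      using lnp[of p k] i pk by (simp add: v_def norm_mult)
    ultimately show ?thesis by simp
  qed
  have bs: "b summable_on prime_power_indices"
    unfolding b_def by (rule summable_prime_powers[OF F(1,2) Fz])
  note famV = dominated_family_laplace[of prime_power_indices v b, OF vc vb bs]
  let ?V = "\<lambda>t. infsum (\<lambda>i. v i t) prime_power_indices"
  have hinge: "hinge_sum t = ?V t" for t
    unfolding hinge_sum_def v_def by (rule infsum_cong) auto
  define c where "c = complex_of_real (- ln (2 * pi))"
  \<comment> \<open>The difference of the two sides; its Laplace transform is \<open>(G s - \<zeta>' / \<zeta> (s) - c) / s\<^sup>2 = 0\<close>.\<close>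
  define f where "f = (\<lambda>t. ?K t + ?V t - c * of_real t)"
  have f0: "f t = 0" if t: "t \<ge> 0" for t
  proof (rule laplace_unique[OF _ _ _ t])
    show "continuous_on {0..} f" unfolding f_def by (intro continuous_intros famK(1) famV(1))
    show "norm (f t) \<le> (infsum (\<lambda>\<rho>. 2 * \<kappa> \<rho>) ?ZP + infsum b prime_power_indices + norm c) * exp (2 * t)"
      if t: "t \<ge> 0" for t
    proof -
      have "norm (f t) \<le> norm (?K t) + norm (?V t) + norm (c * of_real t)"
        unfolding f_def by (intro norm_triangle_le_diff norm_triangle_le add_mono) auto
      also have "norm (c * of_real t) \<le> norm c * exp (2 * t)"
      proof -
        have "\<bar>t\<bar> \<le> exp (2 * t)" using t exp_ge_add_one_self[of "2 * t"] by linarith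
        then show ?thesis unfolding norm_mult norm_of_real by (rule mult_left_mono) simp
      qed
      finally show ?thesis using famK(2)[OF _ _ t] famV(2)[OF _ _ t] t by (simp add: algebra_simps)
    qed
    fix k :: nat assume k: "k \<ge> 3"
    let ?s = "complex_of_real (real k)"
    let ?E = "\<lambda>t. complex_of_real (exp (- real k * t))"
    let ?D = "deriv riemann_zeta ?s / riemann_zeta ?s"
    have k0: "?s \<noteq> 0" using k by simp
    have sZ: "?s \<notin> ?ZP" using Re1[of ?s] k by fastforce
    have K: "((\<lambda>t. ?K t * ?E t) has_integral (?D + c) / ?s\<^sup>2) {0..}"
    proof (rule famK(3))
      show "((\<lambda>t. q \<rho> t * ?E t) has_integral ?g ?s \<rho> / ?s\<^sup>2) {0..}" if \<rho>: "\<rho> \<in> ?ZP" for \<rho>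
      proof -
        have 1: "((\<lambda>t. exp (\<rho> * of_real t) * ?E t) has_integral 1 / (?s - \<rho>)) {0..}"
          using laplace_exp[of \<rho> "real k"] Re1[OF \<rho>] k by simp
        have 2: "((\<lambda>t. ?E t) has_integral 1 / ?s) {0..}"
          using laplace_exp[of 0 "real k"] k by simp
        have "((\<lambda>t. of_int (zorder riemann_zeta \<rho>) / \<rho>\<^sup>2 * (exp (\<rho> * of_real t) * ?E t - ?E t)) has_integral
            of_int (zorder riemann_zeta \<rho>) / \<rho>\<^sup>2 * (1 / (?s - \<rho>) - 1 / ?s)) {0..}"
          by (intro has_integral_mult_right has_integral_diff 1 2)
        moreover have "(1 / \<rho>\<^sup>2) * (1 / (?s - \<rho>) - 1 / ?s) = (?s / \<rho>) * (1 / (?s - \<rho>)) / ?s\<^sup>2"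
        proof -
          have "?s - \<rho> \<noteq> 0" using \<rho> sZ by auto
          then show ?thesis using nz[OF \<rho>] k0 by (simp add: divide_simps) (simp add: algebra_simps power2_eq_square)
        qed
        then have "of_int (zorder riemann_zeta \<rho>) / \<rho>\<^sup>2 * (1 / (?s - \<rho>) - 1 / ?s) = ?g ?s \<rho> / ?s\<^sup>2"
          by (metis (no_types, lifting) mult.assoc times_divide_eq_left times_divide_eq_right mult_1_right)
        moreover have "q \<rho> t * ?E t =
            of_int (zorder riemann_zeta \<rho>) / \<rho>\<^sup>2 * (exp (\<rho> * of_real t) * ?E t - ?E t)" for t
          by (simp add: q_def right_diff_distrib left_diff_distrib)
        ultimately show ?thesis by (simp only:)
      qed
      show "((\<lambda>\<rho>. ?g ?s \<rho> / ?s\<^sup>2) has_sum (?D + c) / ?s\<^sup>2) ?ZP"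
        using has_sum_cmult_left[OF G_sum[OF sZ], of "inverse (?s\<^sup>2)"] by (simp add: c_def divide_inverse)
    qed (use k in auto)
    have V: "((\<lambda>t. ?V t * ?E t) has_integral - ?D / ?s\<^sup>2) {0..}"
    proof (rule famV(3))
      let ?w = "\<lambda>i. (case i of (p, j) \<Rightarrow> of_real (ln (real p)) * exp (- ?s * of_real (real j * ln (real p))))"
      show "((\<lambda>t. v i t * ?E t) has_integral ?w i / ?s\<^sup>2) {0..}" if i: "i \<in> prime_power_indices" for i
      proof -
        obtain p j where pj: "i = (p, j)" by (cases i) auto
        have "real j * ln (real p) \<ge> 0" using lnp[of p j] i pj by auto
        from has_integral_mult_right[OF laplace_hinge[OF this, of "real k"], of "complex_of_real (ln (real p))"] k
        show ?thesis by (simp add: pj v_def mult_ac flip: exp_of_real)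
      qed
      have eq: "deriv riemann_zeta ?s = deriv zeta_series ?s" "riemann_zeta ?s = zeta_series ?s"
      proof -
        have ks: "?s \<in> {s. Re s > 1}" using k by simp
        show "riemann_zeta ?s = zeta_series ?s" using F(6) k by simp
        show "deriv riemann_zeta ?s = deriv zeta_series ?s"
        proof (rule deriv_cong_ev[OF _ refl])
          show "eventually (\<lambda>s. riemann_zeta s = zeta_series s) (nhds ?s)"
            using eventually_nhds_in_open[OF open_halfspace_Re_gt ks]
            by eventually_elim (use F(6) in auto)
        qed
      qed
      have "(?w has_sum - ?D) prime_power_indices"
      proof -
        have "Re ?s > 1" using k by simp
        from log_deriv_zeta_prime_powers[OF F(1,2) Fz this]
        show ?thesis unfolding prime_power_indices_def eq .
      qed
      from has_sum_cmult_left[OF this, of "inverse (?s\<^sup>2)"]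
      show "((\<lambda>i. ?w i / ?s\<^sup>2) has_sum - ?D / ?s\<^sup>2) prime_power_indices" by (simp only: divide_inverse)
    qed (use k in auto)
    have T: "((\<lambda>t. c * of_real t * ?E t) has_integral c / ?s\<^sup>2) {0..}"
    proof -
      have "((\<lambda>t. c * (complex_of_real (max 0 (t - 0)) * ?E t)) has_integral c * of_real (exp (- real k * 0) / (real k)\<^sup>2)) {0..}"
        using k by (intro has_integral_mult_right laplace_hinge) auto
      then have "((\<lambda>t. c * of_real t * ?E t) has_integral c * of_real (exp (- real k * 0) / (real k)\<^sup>2)) {0..}"
        by (rule has_integral_eq[rotated]) (simp add: mult.assoc)
      then show ?thesis by simp
    qed
    have "((\<lambda>t. ?K t * ?E t + ?V t * ?E t - c * of_real t * ?E t) has_integral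
       (?D + c) / ?s\<^sup>2 + - ?D / ?s\<^sup>2 - c / ?s\<^sup>2) {0..}"
      by (intro has_integral_diff has_integral_add K V T)
    moreover have "(?D + c) / ?s\<^sup>2 + - ?D / ?s\<^sup>2 - c / ?s\<^sup>2 = 0"
      by (simp add: diff_divide_distrib add_divide_distrib)
    ultimately show "((\<lambda>t. f t * ?E t) has_integral 0) {0..}"
      by (simp add: f_def ring_distribs)
  qed
  show "K2 riemann_zeta t - K2 riemann_zeta 0 = c0 riemann_zeta * of_real t - hinge_sum t" if "t \<ge> 0" for t
  proof -
    have "?K t = c * of_real t - ?V t"
      using f0[OF that] unfolding f_def by (metis add_diff_cancel_right' eq_iff_diff_eq_0)
    then show ?thesis by (simp only: K2q[OF that] hinge c0 c_def of_real_minus)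
  qed
qed

section \<open>Distributions\<close>

lemma vderiv_funpow:
  assumes "test_function \<phi>"
  shows "((vderiv ^^ n) \<phi> has_vector_derivative (vderiv ^^ Suc n) \<phi> t) (at t)"
  using assms by (auto simp: test_function_def vderiv_def vector_derivative_works[symmetric])

lemma vderivI:
  assumes "\<And>t. (f has_vector_derivative g t) (at t)" shows "vderiv f = g"
  unfolding vderiv_def by (intro ext vector_derivative_at assms)

lemma test_function_bounded_support:
  assumes "test_function \<phi>"
  obtains T where "T > 0" "\<And>t. \<bar>t\<bar> \<ge> T \<Longrightarrow> \<phi> t = 0"
proof -
  have "bounded (support \<phi>)" using assms by (simp add: test_function_def compact_imp_bounded)
  then obtain T where T: "T > 0" "\<And>t. t \<in> support \<phi> \<Longrightarrow> \<bar>t\<bar> \<le> T"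
    by (auto simp: bounded_pos)
  have "\<phi> t = 0" if "\<bar>t\<bar> \<ge> T + 1" for t
  proof (rule ccontr)
    assume "\<phi> t \<noteq> 0"
    then have "t \<in> support \<phi>" unfolding support_def by (intro closure_subset[THEN subsetD]) simp
    with T(2)[of t] that show False by simp
  qed
  then show ?thesis using T(1) that[of "T + 1"] by auto
qed

lemma vderiv_eq_0:
  assumes f: "\<And>t. \<bar>t\<bar> \<ge> T \<Longrightarrow> f t = 0" and t: "\<bar>t\<bar> > T"
  shows "vderiv f t = 0"
  unfolding vderiv_def
proof (rule vector_derivative_at)
  have "open {t::real. \<bar>t\<bar> > T}" by (intro open_Collect_less continuous_intros)
  then show "(f has_vector_derivative 0) (at t)"
    by (rule has_vector_derivative_transform_within_open[OF has_vector_derivative_const])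
       (use f t in \<open>auto simp: less_imp_le\<close>)
qed

lemma vderiv_funpow_add:
  assumes "test_function \<phi>" "test_function \<psi>"
  shows "(vderiv ^^ n) (\<lambda>t. \<phi> t + \<psi> t) = (\<lambda>t. (vderiv ^^ n) \<phi> t + (vderiv ^^ n) \<psi> t)"
proof (induction n)
  case (Suc n)
  have "(vderiv ^^ Suc n) (\<lambda>t. \<phi> t + \<psi> t) = vderiv (\<lambda>t. (vderiv ^^ n) \<phi> t + (vderiv ^^ n) \<psi> t)"
    by (simp add: Suc)
  also have "\<dots> = (\<lambda>t. (vderiv ^^ Suc n) \<phi> t + (vderiv ^^ Suc n) \<psi> t)"
    by (intro vderivI has_vector_derivative_add vderiv_funpow assms)
  finally show ?case .
qed simp

lemma vderiv_funpow_cmult: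
  assumes "test_function \<phi>"
  shows "(vderiv ^^ n) (\<lambda>t. c * \<phi> t) = (\<lambda>t. c * (vderiv ^^ n) \<phi> t)"
proof (induction n)
  case (Suc n)
  have "(vderiv ^^ Suc n) (\<lambda>t. c * \<phi> t) = vderiv (\<lambda>t. c * (vderiv ^^ n) \<phi> t)"
    by (simp add: Suc)
  also have "\<dots> = (\<lambda>t. c * (vderiv ^^ Suc n) \<phi> t)"
    by (intro vderivI has_vector_derivative_mult_right vderiv_funpow assms)
  finally show ?case .
qed simp

lemma has_vector_derivative_reflect:
  assumes "\<And>t. (f has_vector_derivative f' t) (at t)"
  shows "((\<lambda>t. f (- t)) has_vector_derivative - f' (- t)) (at t)"
proof -
  have "((f \<circ> uminus) has_vector_derivative (- 1) *\<^sub>R f' (- t)) (at t)"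
    by (rule vector_diff_chain_at) (auto intro!: assms derivative_eq_intros)
  then show ?thesis by (simp add: o_def)
qed

lemma vderiv_funpow_reflect:
  assumes "test_function \<phi>"
  shows "(vderiv ^^ n) (\<lambda>t. \<phi> (- t)) = (\<lambda>t. (- 1) ^ n * (vderiv ^^ n) \<phi> (- t))"
proof (induction n)
  case (Suc n)
  have "(vderiv ^^ Suc n) (\<lambda>t. \<phi> (- t)) = vderiv (\<lambda>t. (- 1) ^ n * (vderiv ^^ n) \<phi> (- t))"
    by (simp add: Suc)
  also have "\<dots> = (\<lambda>t. (- 1) ^ n * (- (vderiv ^^ Suc n) \<phi> (- t)))"
    by (intro vderivI has_vector_derivative_mult_right has_vector_derivative_reflect vderiv_funpow assms)
  finally show ?case by simp
qed simp

lemma test_functionI: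
  assumes "\<And>n t. ((vderiv ^^ n) \<phi>) differentiable (at t)" "\<And>t. \<bar>t\<bar> \<ge> T \<Longrightarrow> \<phi> t = 0"
  shows "test_function \<phi>"
proof -
  have "{t. \<phi> t \<noteq> 0} \<subseteq> {-T..T}" using assms(2) by (force simp: abs_le_iff)
  then have "bounded {t. \<phi> t \<noteq> 0}" by (rule bounded_subset[rotated]) simp
  then show ?thesis using assms(1) by (simp add: test_function_def support_def)
qed

lemma test_function_funpow_differentiable:
  "test_function \<phi> \<Longrightarrow> ((vderiv ^^ n) \<phi>) differentiable (at t)"
  by (simp add: test_function_def)

lemma test_function_add:
  assumes "test_function \<phi>" "test_function \<psi>" shows "test_function (\<lambda>t. \<phi> t + \<psi> t)"
proof -
  obtain T where T: "\<And>t. \<bar>t\<bar> \<ge> T \<Longrightarrow> \<phi> t = 0" using test_function_bounded_support[OF assms(1)] by blast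
  obtain U where U: "\<And>t. \<bar>t\<bar> \<ge> U \<Longrightarrow> \<psi> t = 0" using test_function_bounded_support[OF assms(2)] by blast
  show ?thesis
    by (rule test_functionI[where T = "max T U"])
       (auto simp: vderiv_funpow_add[OF assms] T U intro!: differentiable_add test_function_funpow_differentiable assms)
qed

lemma test_function_cmult:
  assumes "test_function \<phi>" shows "test_function (\<lambda>t. c * \<phi> t)"
proof -
  obtain T where T: "\<And>t. \<bar>t\<bar> \<ge> T \<Longrightarrow> \<phi> t = 0" using test_function_bounded_support[OF assms] by blast
  show ?thesis
    by (rule test_functionI[where T = T])
       (auto simp: vderiv_funpow_cmult[OF assms] T intro!: differentiable_mult test_function_funpow_differentiable assms)
qed

lemma test_function_reflect:
  assumes "test_function \<phi>" shows "test_function (\<lambda>t. \<phi> (- t))"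
proof -
  obtain T where T: "\<And>t. \<bar>t\<bar> \<ge> T \<Longrightarrow> \<phi> t = 0" using test_function_bounded_support[OF assms] by blast
  have "(\<lambda>t. (vderiv ^^ n) \<phi> (- t)) differentiable (at t)" for n t
    using has_vector_derivative_reflect[OF vderiv_funpow[OF assms, of n], of t] by (rule differentiableI_vector)
  then show ?thesis
    by (intro test_functionI[where T = T])
       (auto simp: vderiv_funpow_reflect[OF assms] T intro!: differentiable_mult)
qed

text \<open>
  A primitive of the integrand is \<open>(t - a) * \<phi>' t - \<phi> t\<close>: the second derivative of the
  function \<open>max 0 (t - a)\<close> is the point mass at \<open>a\<close>.
\<close>

lemma hinge_second_derivative:
  assumes \<phi>: "test_function \<phi>" and T: "\<phi> T = 0" "vderiv \<phi> T = 0" "a \<le> T"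
  shows "has_bochner_integral lborel (\<lambda>t. indicator {a..T} t *\<^sub>R (of_real (t - a) * vderiv (vderiv \<phi>) t)) (\<phi> a)"
proof -
  have d0: "(\<phi> has_vector_derivative vderiv \<phi> t) (at t)"
    and d1: "(vderiv \<phi> has_vector_derivative vderiv (vderiv \<phi>) t) (at t)"
    and d2: "(vderiv (vderiv \<phi>) has_vector_derivative vderiv (vderiv (vderiv \<phi>)) t) (at t)" for t
    using vderiv_funpow[OF \<phi>, of 0 t] vderiv_funpow[OF \<phi>, of 1 t] vderiv_funpow[OF \<phi>, of 2 t]
    by (simp_all add: numeral_2_eq_2)
  have "has_bochner_integral lborel (\<lambda>t. indicator {a..T} t *\<^sub>R (of_real (t - a) * vderiv (vderiv \<phi>) t))
     ((of_real (T - a) * vderiv \<phi> T - \<phi> T) - (of_real (a - a) * vderiv \<phi> a - \<phi> a))"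
  proof (rule has_bochner_integral_FTC_Icc[OF T(3)])
    show "((\<lambda>t. of_real (t - a) * vderiv \<phi> t - \<phi> t) has_vector_derivative of_real (t - a) * vderiv (vderiv \<phi>) t)
        (at t within {a..T})" for t
    proof (rule has_vector_derivative_at_within)
      have "((\<lambda>t. complex_of_real (t - a)) has_vector_derivative of_real 1) (at t)"
        by (rule has_vector_derivative_of_real) (auto intro!: derivative_eq_intros)
      from has_vector_derivative_diff[OF has_vector_derivative_mult[OF this d1] d0]
      show "((\<lambda>t. of_real (t - a) * vderiv \<phi> t - \<phi> t) has_vector_derivative of_real (t - a) * vderiv (vderiv \<phi>) t) (at t)"
        by simp
    qed
    have "continuous_on {a..T} (vderiv (vderiv \<phi>))"
      using d2 by (intro continuous_at_imp_continuous_on ballI has_vector_derivative_continuous) blast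
    then show "continuous_on {a..T} (\<lambda>t. of_real (t - a) * vderiv (vderiv \<phi>) t)"
      by (intro continuous_intros)
  qed
  then show ?thesis by (simp add: T)
qed

definition prime_powers_upto :: "real \<Rightarrow> (nat \<times> nat) set" where
  "prime_powers_upto T = {(p, k) \<in> prime_power_indices. real k * ln (real p) \<le> T}"

lemma finite_prime_powers_upto: "finite (prime_powers_upto T)"
proof (rule finite_subset)
  show "prime_powers_upto T \<subseteq> {..nat \<lceil>exp T\<rceil>} \<times> {..nat \<lceil>T / ln 2\<rceil>}"
  proof clarsimp
    fix p k assume "(p, k) \<in> prime_powers_upto T"
    then have p: "prime p" "k \<ge> 1" "real k * ln (real p) \<le> T"
      by (auto simp: prime_powers_upto_def prime_power_indices_def)
    have p2: "p \<ge> 2" using prime_ge_2_nat[OF p(1)] .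
    have "1 * ln (real p) \<le> real k * ln (real p)" using p(2) p2 by (intro mult_right_mono) auto
    then have "ln (real p) \<le> T" using p(3) by simp
    then have "real p \<le> exp T" using p2 by (subst ln_le_cancel_iff[symmetric]) auto
    moreover have "real k * ln 2 \<le> real k * ln (real p)" using p2 by (intro mult_left_mono) auto
    then have "real k \<le> T / ln 2" using p(3) by (simp add: pos_le_divide_eq)
    ultimately show "p \<le> nat \<lceil>exp T\<rceil> \<and> k \<le> nat \<lceil>T / ln 2\<rceil>" by (auto simp: le_nat_iff) linarith+
  qed
qed simp

lemma prime_power_sum_compact:
  fixes f :: "real \<Rightarrow> complex"
  assumes "\<And>t. t > T \<Longrightarrow> f t = 0"
  shows "((\<lambda>(p, k). of_real (ln (real p)) * f (real k * ln (real p))) has_sum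
     (\<Sum>(p, k)\<in>prime_powers_upto T. of_real (ln (real p)) * f (real k * ln (real p)))) prime_power_indices"
proof (rule has_sum_cong_neutral[THEN iffD1])
  fix x assume "x \<in> prime_power_indices - prime_powers_upto T"
  then show "(case x of (p, k) \<Rightarrow> of_real (ln (real p)) * f (real k * ln (real p))) = 0"
    by (cases x) (auto simp: prime_powers_upto_def not_le assms)
next
  show "((\<lambda>(p, k). of_real (ln (real p)) * f (real k * ln (real p))) has_sum
     (\<Sum>(p, k)\<in>prime_powers_upto T. of_real (ln (real p)) * f (real k * ln (real p)))) (prime_powers_upto T)"
    by (rule has_sum_finite[OF finite_prime_powers_upto])
qed (auto simp: prime_powers_upto_def)

text \<open>
  On the support of a test function only finitely many hinges are different from zero, so the
  integral splits into finitely many instances of \<open>hinge_second_derivative\<close>. The linear term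
  \<open>c0 * t\<close> is the hinge at \<open>0\<close>.
\<close>

lemma W_zeta:
  assumes \<phi>: "test_function \<phi>"
  shows "W riemann_zeta \<phi> = c0 riemann_zeta * \<phi> 0 -
    (\<Sum>\<^sub>\<infinity>(p, k)\<in>prime_power_indices. of_real (ln (real p)) * \<phi> (real k * ln (real p)))"
proof -
  obtain T0 where T0: "T0 > 0" "\<And>t. \<bar>t\<bar> \<ge> T0 \<Longrightarrow> \<phi> t = 0"
    using test_function_bounded_support[OF \<phi>] by blast
  \<comment> \<open>Each derivative needs a little more room: a function that is zero for \<open>\<bar>t\<bar> \<ge> T0\<close> is known to have
    zero derivative only for \<open>\<bar>t\<bar> > T0\<close>.\<close>
  define T where "T = T0 + 2"
  have 1: "vderiv \<phi> t = 0" if "\<bar>t\<bar> \<ge> T0 + 1" for t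
    using that by (intro vderiv_eq_0[OF T0(2)]) auto
  have 2: "vderiv (vderiv \<phi>) t = 0" if "\<bar>t\<bar> > T" for t
    using that by (intro vderiv_eq_0[OF 1]) (auto simp: T_def)
  have T: "T > 0" "\<phi> T = 0" "vderiv \<phi> T = 0" using T0 1[of T] by (auto simp: T_def)
  let ?P = "prime_powers_upto T"
  let ?h = "\<lambda>a t. indicator {a..T} t *\<^sub>R (of_real (t - a) * vderiv (vderiv \<phi>) t)"
  have pos: "real k * ln (real p) > 0" if "(p, k) \<in> prime_power_indices" for p k
    using that prime_gt_1_nat[of p] by (auto simp: prime_power_indices_def)
  have eq: "(K2 riemann_zeta t - K2 riemann_zeta 0) * indicator {0..} t * vderiv (vderiv \<phi>) t =
     c0 riemann_zeta * ?h 0 t - (\<Sum>(p, k)\<in>?P. of_real (ln (real p)) * ?h (real k * ln (real p)) t)" for t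
  proof -
    consider "t < 0" | "t > T" | "0 \<le> t" "t \<le> T" by linarith
    then show ?thesis
    proof cases
      case 1
      have "(\<Sum>(p, k)\<in>?P. of_real (ln (real p)) * ?h (real k * ln (real p)) t) = 0"
        using 1 pos by (intro sum.neutral) (force simp: prime_powers_upto_def)
      with 1 show ?thesis by simp
    next
      case 2
      then show ?thesis using \<open>\<And>t. \<bar>t\<bar> > T \<Longrightarrow> vderiv (vderiv \<phi>) t = 0\<close>[of t] by simp
    next
      case 3
      have "hinge_sum t = (\<Sum>(p, k)\<in>?P. of_real (ln (real p)) * of_real (max 0 (t - real k * ln (real p))))"
        unfolding hinge_sum_def
        by (rule infsumI, rule prime_power_sum_compact[of T "\<lambda>a. of_real (max 0 (t - a))"]) (use 3 in auto)
      then have "hinge_sum t * vderiv (vderiv \<phi>) t =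
        (\<Sum>(p, k)\<in>?P. of_real (ln (real p)) * of_real (max 0 (t - real k * ln (real p))) * vderiv (vderiv \<phi>) t)"
        by (simp add: sum_distrib_right case_prod_unfold)
      also have "\<dots> = (\<Sum>(p, k)\<in>?P. of_real (ln (real p)) * ?h (real k * ln (real p)) t)"
        using 3 by (intro sum.cong) (auto simp: indicator_def max_def)
      finally show ?thesis using 3 by (simp add: K2_zeta left_diff_distrib mult.assoc)
    qed
  qed
  have "has_bochner_integral lborel (\<lambda>t. c0 riemann_zeta * ?h 0 t -
      (\<Sum>(p, k)\<in>?P. of_real (ln (real p)) * ?h (real k * ln (real p)) t))
     (c0 riemann_zeta * \<phi> 0 - (\<Sum>(p, k)\<in>?P. of_real (ln (real p)) * \<phi> (real k * ln (real p))))"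
    unfolding case_prod_unfold
    by (intro has_bochner_integral_diff has_bochner_integral_mult_right has_bochner_integral_sum
        hinge_second_derivative \<phi> T) (use T in \<open>auto simp: prime_powers_upto_def\<close>)
  then have "W riemann_zeta \<phi> = c0 riemann_zeta * \<phi> 0 - (\<Sum>(p, k)\<in>?P. of_real (ln (real p)) * \<phi> (real k * ln (real p)))"
    unfolding W_def distr_deriv_def regular_distr_def
    by (simp add: eq has_bochner_integral_integral_eq del: indicator_simps)
  moreover have "(\<Sum>\<^sub>\<infinity>(p, k)\<in>prime_power_indices. of_real (ln (real p)) * \<phi> (real k * ln (real p))) =
      (\<Sum>(p, k)\<in>?P. of_real (ln (real p)) * \<phi> (real k * ln (real p)))"
    by (intro infsumI prime_power_sum_compact) (use T0 in \<open>auto simp: T_def\<close>)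
  ultimately show ?thesis by simp
qed

definition explicit_distr :: "complex \<Rightarrow> functional" where
  "explicit_distr c \<phi> = 2 * c * dirac 0 \<phi> - (\<Sum>\<^sub>\<infinity>(p, k)\<in>prime_power_indices.
     of_real (ln (real p)) * (dirac (real k * ln (real p)) \<phi> + dirac (- (real k * ln (real p))) \<phi>))"

lemma explicit_distr_eq_sum:
  assumes "\<And>t. \<bar>t\<bar> > T \<Longrightarrow> \<phi> t = 0"
  shows "explicit_distr c \<phi> = 2 * c * \<phi> 0 -
    (\<Sum>(p, k)\<in>prime_powers_upto T. of_real (ln (real p)) * (\<phi> (real k * ln (real p)) + \<phi> (- (real k * ln (real p)))))"
proof -
  have "(\<Sum>\<^sub>\<infinity>(p, k)\<in>prime_power_indices.
     of_real (ln (real p)) * (\<phi> (real k * ln (real p)) + \<phi> (- (real k * ln (real p))))) =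
    (\<Sum>(p, k)\<in>prime_powers_upto T. of_real (ln (real p)) * (\<phi> (real k * ln (real p)) + \<phi> (- (real k * ln (real p)))))"
    by (rule infsumI, rule prime_power_sum_compact[of T "\<lambda>a. \<phi> a + \<phi> (- a)"]) (use assms in auto)
  then show ?thesis by (simp add: explicit_distr_def dirac_def)
qed

lemma exp_abs_sum_zeta:
  assumes \<phi>: "test_function \<phi>"
  shows "exp_abs_sum riemann_zeta \<phi> = explicit_distr (c0 riemann_zeta) \<phi>"
proof -
  obtain T where T: "T > 0" "\<And>t. \<bar>t\<bar> \<ge> T \<Longrightarrow> \<phi> t = 0"
    using test_function_bounded_support[OF \<phi>] by blast
  let ?P = "prime_powers_upto T"
  have "W riemann_zeta \<phi> = c0 riemann_zeta * \<phi> 0 - (\<Sum>(p, k)\<in>?P. of_real (ln (real p)) * \<phi> (real k * ln (real p)))"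
    unfolding W_zeta[OF \<phi>] by (subst infsumI[OF prime_power_sum_compact[of T \<phi>]]) (use T in auto)
  moreover have "W riemann_zeta (\<lambda>t. \<phi> (- t)) = c0 riemann_zeta * \<phi> 0 -
      (\<Sum>(p, k)\<in>?P. of_real (ln (real p)) * \<phi> (- (real k * ln (real p))))"
    unfolding W_zeta[OF test_function_reflect[OF \<phi>]]
    by (subst infsumI[OF prime_power_sum_compact[of T "\<lambda>t. \<phi> (- t)"]]) (use T in auto)
  ultimately show ?thesis
    unfolding exp_abs_sum_def distr_reflect_def
    by (subst explicit_distr_eq_sum[of T]) (use T in \<open>auto simp: case_prod_unfold distrib_left sum.distrib\<close>)
qed

text \<open>
  A compact set meets only finitely many of the point masses, which gives an estimate by the
  supremum of the test function alone.
\<close>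

lemma distribution_explicit: "distribution (explicit_distr c)"
  unfolding distribution_def
proof (intro conjI allI impI)
  fix \<phi> \<psi> assume t: "test_function \<phi>" "test_function \<psi>"
  obtain T where T: "\<And>t. \<bar>t\<bar> \<ge> T \<Longrightarrow> \<phi> t = 0" using test_function_bounded_support[OF t(1)] by blast
  obtain U where U: "\<And>t. \<bar>t\<bar> \<ge> U \<Longrightarrow> \<psi> t = 0" using test_function_bounded_support[OF t(2)] by blast
  note e = explicit_distr_eq_sum[of "max T U"]
  show "explicit_distr c (\<lambda>t. \<phi> t + \<psi> t) = explicit_distr c \<phi> + explicit_distr c \<psi>"
    by (subst (1 2 3) e) (use T U in \<open>auto simp: case_prod_unfold algebra_simps sum.distrib\<close>)
next
  fix b \<phi> assume t: "test_function \<phi>"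
  obtain T where T: "\<And>t. \<bar>t\<bar> \<ge> T \<Longrightarrow> \<phi> t = 0" using test_function_bounded_support[OF t] by blast
  note e = explicit_distr_eq_sum[of T]
  show "explicit_distr c (\<lambda>t. b * \<phi> t) = b * explicit_distr c \<phi>"
    by (subst (1 2) e) (use T in \<open>auto simp: case_prod_unfold algebra_simps sum_distrib_left\<close>)
next
  fix K :: "real set" assume "compact K"
  then obtain T where T: "T > 0" "\<And>t. t \<in> K \<Longrightarrow> \<bar>t\<bar> \<le> T"
    using compact_imp_bounded[of K] by (auto simp: bounded_pos)
  define B where "B = 2 * norm c + (\<Sum>(p, k)\<in>prime_powers_upto T. ln (real p) * 2)"
  show "\<exists>C N. \<forall>\<phi>. test_function \<phi> \<longrightarrow> support \<phi> \<subseteq> K \<longrightarrow>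
      norm (explicit_distr c \<phi>) \<le> C * (\<Sum>n\<le>N. SUP t. norm ((vderiv ^^ n) \<phi> t))"
  proof (intro exI[of _ B] exI[of _ 0] allI impI)
    fix \<phi> assume \<phi>: "test_function \<phi>" and sup: "support \<phi> \<subseteq> K"
    have z: "\<phi> t = 0" if "\<bar>t\<bar> > T" for t
    proof (rule ccontr)
      assume "\<phi> t \<noteq> 0"
      then have "t \<in> support \<phi>" unfolding support_def by (intro closure_subset[THEN subsetD]) simp
      with T(2)[of t] sup that show False by auto
    qed
    define S where "S = (SUP t. norm (\<phi> t))"
    have cont: "continuous_on {-T..T} \<phi>"
      using vderiv_funpow[OF \<phi>, of 0]
      by (intro continuous_at_imp_continuous_on ballI) (auto intro: has_vector_derivative_continuous)
    obtain M where M: "\<And>t. t \<in> {-T..T} \<Longrightarrow> norm (\<phi> t) \<le> M"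
      using compact_imp_bounded[OF compact_continuous_image[OF cont compact_Icc]]
      unfolding bounded_iff by blast
    have "norm (\<phi> t) \<le> max M 0" for t
    proof (cases "\<bar>t\<bar> > T")
      case False
      then have "t \<in> {-T..T}" by auto
      from M[OF this] show ?thesis by simp
    qed (simp add: z)
    then have bdd: "bdd_above (range (\<lambda>t. norm (\<phi> t)))" by (rule bdd_aboveI2)
    have S: "norm (\<phi> t) \<le> S" for t
      unfolding S_def using cSUP_upper[OF UNIV_I bdd, of t] by simp
    have e: "explicit_distr c \<phi> = 2 * c * \<phi> 0 - (\<Sum>(p, k)\<in>prime_powers_upto T.
        of_real (ln (real p)) * (\<phi> (real k * ln (real p)) + \<phi> (- (real k * ln (real p)))))"
      by (rule explicit_distr_eq_sum) (rule z)
    have "norm (explicit_distr c \<phi>) \<le> norm (2 * c * \<phi> 0) +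
      norm (\<Sum>(p, k)\<in>prime_powers_upto T. of_real (ln (real p)) * (\<phi> (real k * ln (real p)) + \<phi> (- (real k * ln (real p)))))"
      unfolding e by (rule norm_triangle_ineq4)
    also have "norm (2 * c * \<phi> 0) \<le> 2 * norm c * S"
      unfolding norm_mult norm_numeral by (intro mult_left_mono S) simp
    also have "norm (\<Sum>(p, k)\<in>prime_powers_upto T. of_real (ln (real p)) * (\<phi> (real k * ln (real p)) + \<phi> (- (real k * ln (real p)))))
      \<le> (\<Sum>(p, k)\<in>prime_powers_upto T. ln (real p) * 2 * S)"
    proof (rule sum_norm_le, clarify)
      fix p k assume "(p, k) \<in> prime_powers_upto T"
      then have "ln (real p) \<ge> 0"
        using prime_ge_1_nat[of p] by (auto simp: prime_powers_upto_def prime_power_indices_def)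
      moreover have "norm (\<phi> (real k * ln (real p)) + \<phi> (- (real k * ln (real p)))) \<le> 2 * S"
        unfolding mult_2 by (rule norm_triangle_mono[OF S S])
      ultimately have "ln (real p) * norm (\<phi> (real k * ln (real p)) + \<phi> (- (real k * ln (real p)))) \<le> ln (real p) * (2 * S)"
        by (intro mult_left_mono)
      then show "norm (of_real (ln (real p)) * (\<phi> (real k * ln (real p)) + \<phi> (- (real k * ln (real p)))))
         \<le> ln (real p) * 2 * S"
        using \<open>ln (real p) \<ge> 0\<close> by (simp add: norm_mult)
    qed
    also have "2 * norm c * S + (\<Sum>(p, k)\<in>prime_powers_upto T. ln (real p) * 2 * S) = B * S"
      by (simp add: B_def case_prod_unfold distrib_right sum_distrib_right)
    finally show "norm (explicit_distr c \<phi>) \<le> B * (\<Sum>n\<le>0. SUP t. norm ((vderiv ^^ n) \<phi> t))"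
      by (simp add: S_def)
  qed
qed

lemma distribution_cong:
  assumes "distribution S" "\<And>\<phi>. test_function \<phi> \<Longrightarrow> T \<phi> = S \<phi>"
  shows "distribution T"
  using assms test_function_add test_function_cmult unfolding distribution_def by (simp cong: imp_cong)

theorem theorem6p12:
  shows "distr_eq (exp_abs_sum riemann_zeta)
           (\<lambda>\<phi>. 2 * c0 riemann_zeta * dirac 0 \<phi> -
              (\<Sum>\<^sub>\<infinity>(p, k)\<in>{p::nat. prime p} \<times> {k::nat. k \<ge> 1}.
                 of_real (ln (real p)) *
                   (dirac (real k * ln (real p)) \<phi> + dirac (- (real k * ln (real p))) \<phi>)))
       \<and> c0 riemann_zeta = - of_real (ln (2 * pi))"
proof
  have "distribution (explicit_distr (c0 riemann_zeta))" by (rule distribution_explicit)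
  moreover from this have "distribution (exp_abs_sum riemann_zeta)"
    by (rule distribution_cong) (rule exp_abs_sum_zeta)
  ultimately have "distr_eq (exp_abs_sum riemann_zeta) (explicit_distr (c0 riemann_zeta))"
    using exp_abs_sum_zeta by (simp add: distr_eq_def)
  then show "distr_eq (exp_abs_sum riemann_zeta)
           (\<lambda>\<phi>. 2 * c0 riemann_zeta * dirac 0 \<phi> -
              (\<Sum>\<^sub>\<infinity>(p, k)\<in>{p::nat. prime p} \<times> {k::nat. k \<ge> 1}.
                 of_real (ln (real p)) *
                   (dirac (real k * ln (real p)) \<phi> + dirac (- (real k * ln (real p))) \<phi>)))"
    unfolding explicit_distr_def[abs_def] prime_power_indices_def .
qed (rule c0_zeta)

end
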